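(* Let $q>2^{12}$ be an odd prime power, let $d\in\mathbb{F}_q[T]$ be monic, square-free and of even degree, and let $K=\mathbb{F}_q(T)(\sqrt d)$ be the corresponding real quadratic extension of $k=\mathbb{F}_q(T)$. Assume that $K$ has class number $1$ (i.e. $\mathbb{A}$ is a unique factorization domain). Let $(x_1,x_2)\in k_\infty^2\setminus\sigma(K)$. Then for every $\varepsilon>0$ there exist infinitely many elements $p/\pi\in K$ with $p,\pi\in\mathbb{A}$, $\pi$ a prime element of $\mathbb{A}$, such that $$\left|x_i-\frac{\sigma_i(p)}{\sigma_i(\pi)}\right|\le \mathcal{N}(\pi)^{-\frac12-\frac18+\log_q\sqrt2+\varepsilon}\qquad (i=1,2).$$
   Context: $k_\infty=\mathbb{F}_q((1/T))$ is the completion of $k=\mathbb{F}_q(T)$ at infinity, with absolute value $|\sum_{i\le n}a_iT^i|=q^n$ if $a_n\neq0$. Since $d$ is monic of even degree, $d$ has a square root $\sqrt d\in k_\infty$ (fixed choice). $\mathbb{A}=\{a+b\sqrt d: a,b\in\mathbb{F}_q[T]\}$ is the integral closure of $\mathbb{F}_q[T]$ in $K$. The two embeddings $\sigma_1,\sigma_2:K\to k_\infty$ are $\sigma_1(a+b\sqrt d)=a+b\sqrt d$, $\sigma_2(a+b\sqrt d)=a-b\sqrt d$ ($a,b\in k$), and $\sigma(K)=\{(\sigma_1(f),\sigma_2(f)):f\in K\}$. For $f\in\mathbb{A}$, $\mathcal{N}(f)=|\sigma_1(f)\sigma_2(f)|=|a^2-b^2d|$, which equals $\#(\mathbb{A}/(f))$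 for $f\ne 0$. *)

theory Defs
  imports "HOL-Computational_Algebra.Computational_Algebra"
          "HOL-Algebra.Ring_Divisibility"
begin

text \<open>k_infinity = F_q((1/T)) is modelled as the Laurent series 'a fls in the
  variable X = 1/T.  A polynomial p in F_q[T] is embedded by substituting T := X^(-1).\<close>

definition kinf_of_poly :: "'a::field poly \<Rightarrow> 'a fls" where
  "kinf_of_poly p = (\<Sum>i\<le>Polynomial.degree p. fls_const (Polynomial.coeff p i) * fls_X_inv ^ i)"

definition kinf_of_k :: "'a::field poly fract \<Rightarrow> 'a fls" where
  "kinf_of_k x = (THE y. \<exists>n m. m \<noteq> 0 \<and> x = Fract n m \<and> y = kinf_of_poly n / kinf_of_poly m)"

text \<open>Absolute value on k_infinity: |sum_{i<=n} a_i T^i| = q^n when a_n \<noteq> 0,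
  i.e. q^(- subdegree in X).\<close>
definition kinf_abs :: "'a::{field,finite} fls \<Rightarrow> real" where
  "kinf_abs f = (if f = 0 then 0 else real (card (UNIV :: 'a set)) powr (- real_of_int (fls_subdegree f)))"

text \<open>Elements a + b sqrt d of the ring A are represented as pairs (a, b) of
  polynomials; s is the fixed square root of d in k_infinity.\<close>
definition sigma1 :: "'a::field fls \<Rightarrow> 'a poly \<times> 'a poly \<Rightarrow> 'a fls" where
  "sigma1 s f = kinf_of_poly (fst f) + kinf_of_poly (snd f) * s"

definition sigma2 :: "'a::field fls \<Rightarrow> 'a poly \<times> 'a poly \<Rightarrow> 'a fls" where
  "sigma2 s f = kinf_of_poly (fst f) - kinf_of_poly (snd f) * s"

definition sigmaK :: "'a::field fls \<Rightarrow> ('a fls \<times> 'a fls) set" where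
  "sigmaK s = {(kinf_of_k a + kinf_of_k b * s, kinf_of_k a - kinf_of_k b * s) | a b. True}"

text \<open>The ring A = F_q[T][sqrt d] as a HOL-Algebra ring structure on pairs.\<close>
definition ringA :: "'a::field poly \<Rightarrow> ('a poly \<times> 'a poly) ring" where
  "ringA d = \<lparr> carrier = UNIV,
     mult = (\<lambda>x y. (fst x * fst y + snd x * snd y * d, fst x * snd y + snd x * fst y)),
     one = (1, 0),
     zero = (0, 0),
     add = (\<lambda>x y. (fst x + fst y, snd x + snd y)) \<rparr>"

definition normA :: "'a::{field,finite} fls \<Rightarrow> 'a poly \<times> 'a poly \<Rightarrow> real" where
  "normA s f = kinf_abs (sigma1 s f * sigma2 s f)"

end

theory Submission
  imports Defs "HOL-Library.Cardinality"
begin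

text \<open>For the functional \<open>ell\<close> (a residue) the elements \<open>c\<close> of \<open>A\<close> with \<open>c x\<close> close to \<open>\<sigma>(A)\<close> form an
  \<open>F_q\<close>-subspace: the annihilator of a box of multipliers \<open>j\<close>. Instead of additive characters we use
  \<open>1[t = 0] - 1/q\<close>, which has mean zero on \<open>F_q\<close> and is positive definite, so that sums of it over boxes
  either vanish or are trivial. Vaughan's identity (with factorizations encoded as multisets of prime
  representatives) splits the correlation of the von Mangoldt function with the subspace into type I
  and type II sums; a nontrivial unit makes all representatives balanced, so the variables run over
  honest boxes. Both sums reduce to counting \<open>l\<close> in a box with \<open>l x\<close> close to \<open>\<sigma>(A)\<close>, which is optimal at
  every scale \<open>Q\<close> where the lattice of pairs \<open>(c, c x - p)\<close> has no short vector. Such scales are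
  unbounded, because short vectors at consecutive scales would be proportional and \<open>x\<close> would come
  from \<open>K\<close>. Enough primes exist by an elementary Mertens estimate obtained from counting box points.
  The divisor function is bounded by \<open>q^(\<eta> n)\<close> for every \<open>\<eta> > 0\<close>, which is absorbed by \<open>\<epsilon>\<close>.\<close>

section \<open>Arithmetic functions on multisets of primes\<close>

text \<open>Origin of the exponent: let \<open>n\<close> be the norm degree of the prime
  \<open>c\<close> and let \<open>c x\<close> be within about q^(-delta) of the image of A. A
  balanced prime then gives an error near q^(-delta - n/2), so 1/2 + 1/8 means delta = n/8. This is
  what the two kinds of sums permit. With Vaughan parameters U and V, the type II sums need 2 delta
  <= U and 4 delta <= V, and the type I sums need U + V + 2 delta <= n. All are equalities for U =
  Q, V = 2 Q, n = 4 Q, 2 delta = Q, and these values recur throughout. Two obstacles shape the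
  details. The scale Q is dictated by the lattice, while only an averaged estimate for primes is
  proved, so n cannot be set to 4 Q: it is found in a window of length R below 4 Q, and a pigeonhole
  then fixes the degrees at both infinite places. Moreover, the divisor bound, powers of Q and
  bounded constants all lose something. These losses are measured by q^w with w a small fixed
  fraction of Q, and are paid for by lowering delta by 8 w.\<close>

definition submsets :: "'p multiset \<Rightarrow> 'p multiset set" where
  "submsets M = {N. N \<subseteq># M}"

definition mdeg :: "('p \<Rightarrow> nat) \<Rightarrow> 'p multiset \<Rightarrow> nat" where
  "mdeg dg M = (\<Sum>p\<in>#M. dg p)"

definition mangoldt :: "('p \<Rightarrow> nat) \<Rightarrow> 'p multiset \<Rightarrow> real" where
  "mangoldt dg M = (if card (set_mset M) = 1 then real (dg (the_elem (set_mset M))) else 0)"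

definition moebius :: "'p multiset \<Rightarrow> real" where
  "moebius M = (if \<forall>p. count M p \<le> 1 then (-1) ^ size M else 0)"

definition moebius_trunc :: "('p \<Rightarrow> nat) \<Rightarrow> nat \<Rightarrow> 'p multiset \<Rightarrow> real" where
  "moebius_trunc dg V M = (\<Sum>N\<in>submsets M. if mdeg dg N \<le> V then moebius N else 0)"

lemma submsets_mem [simp]: "N \<in> submsets M \<longleftrightarrow> N \<subseteq># M"
  by (simp add: submsets_def)

text \<open>A submultiset is recorded by its exponents on the support of \<open>M\<close>. This
  encoding serves both finiteness of \<open>submsets\<close> and the divisor bound.\<close>

lemma submsets_restrict_count:
  defines "f \<equiv> \<lambda>M N. restrict (count N) (set_mset M)"
  shows "inj_on (f M) (submsets M)"
    and "f M ` submsets M \<subseteq> PiE (set_mset M) (\<lambda>p. {..count M p})"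
proof -
  show "inj_on (f M) (submsets M)"
  proof (rule inj_onI, rule multiset_eqI)
    fix N N' p assume *: "N \<in> submsets M" "N' \<in> submsets M" "f M N = f M N'"
    show "count N p = count N' p"
    proof (cases "p \<in># M")
      case True then show ?thesis using fun_cong[OF *(3), of p] by (simp add: f_def)
    next
      case False
      then have "p \<notin># N" "p \<notin># N'" using * mset_subset_eqD by fastforce+
      then show ?thesis by (simp add: not_in_iff)
    qed
  qed
  show "f M ` submsets M \<subseteq> PiE (set_mset M) (\<lambda>p. {..count M p})"
    by (auto simp: subseteq_mset_def f_def)
qed

lemma finite_submsets [simp, intro]: "finite (submsets M)"
  by (rule inj_on_finite[OF submsets_restrict_count]) (auto intro!: finite_PiE)

lemma mdeg_plus [simp]: "mdeg dg (M + N) = mdeg dg M + mdeg dg N"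
  by (simp add: mdeg_def)

lemma mdeg_empty [simp]: "mdeg dg {#} = 0"
  by (simp add: mdeg_def)

lemma mdeg_add_mset [simp]: "mdeg dg (add_mset p M) = dg p + mdeg dg M"
  by (simp add: mdeg_def)

lemma mdeg_diff: "N \<subseteq># M \<Longrightarrow> mdeg dg (M - N) = mdeg dg M - mdeg dg N"
  by (metis add_diff_cancel_left' mdeg_plus subset_mset.add_diff_inverse)

lemma mdeg_mono: "N \<subseteq># M \<Longrightarrow> mdeg dg N \<le> mdeg dg M"
  by (metis le_add1 mdeg_plus subset_mset.add_diff_inverse)

lemma mdeg_replicate [simp]: "mdeg dg (replicate_mset r p) = r * dg p"
  by (induction r) auto

lemma mdeg_eq_sum: "mdeg dg M = (\<Sum>p\<in>set_mset M. count M p * dg p)"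
proof (induction M)
  case (add p M)
  show ?case
  proof (cases "p \<in># M")
    case True
    then have "(\<Sum>x\<in>set_mset (add_mset p M). count (add_mset p M) x * dg x)
      = (\<Sum>x\<in>set_mset M. count M x * dg x + (if x = p then dg x else 0))"
      by (auto intro!: sum.cong simp: insert_absorb)
    also have "\<dots> = mdeg dg M + dg p" using True add by (simp add: sum.distrib)
    finally show ?thesis by simp
  next
    case False
    then have "(\<Sum>x\<in>set_mset M. count (add_mset p M) x * dg x) = (\<Sum>x\<in>set_mset M. count M x * dg x)"
      by (intro sum.cong) auto
    with False add show ?thesis by (simp add: not_in_iff)
  qed
qed simp

lemma mangoldt_nonneg: "mangoldt dg M \<ge> 0"
  by (simp add: mangoldt_def)

lemma mangoldt_nz_iff:
  assumes "mangoldt dg M \<noteq> 0"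
  obtains p r where "M = replicate_mset r p" "r \<ge> 1"
proof -
  from assms have "card (set_mset M) = 1" by (auto simp: mangoldt_def split: if_splits)
  then obtain p where p: "set_mset M = {p}" by (metis card_1_singletonE)
  have "M = replicate_mset (count M p) p"
    by (rule multiset_eqI) (use p in \<open>auto simp: not_in_iff[symmetric]\<close>)
  moreover have "count M p \<ge> 1" using p by (simp add: Suc_leI count_greater_zero_iff)
  ultimately show ?thesis using that by blast
qed

lemma mangoldt_replicate: "r \<ge> 1 \<Longrightarrow> mangoldt dg (replicate_mset r p) = dg p"
  by (cases r) (auto simp: mangoldt_def)

lemma mangoldt_empty [simp]: "mangoldt dg {#} = 0"
  by (simp add: mangoldt_def)

lemma mangoldt_le: "mangoldt dg M \<le> mdeg dg M"
proof (cases "mangoldt dg M = 0")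
  case False
  then obtain p r where M: "M = replicate_mset r p" "r \<ge> 1" using mangoldt_nz_iff by metis
  then have "dg p \<le> r * dg p" by simp
  then show ?thesis using M by (simp add: mangoldt_replicate flip: of_nat_mult)
qed simp

text \<open>Only powers of a single prime contribute, and each prime \<open>p\<close> of
  \<open>M\<close> has \<open>count M p\<close> of them below \<open>M\<close>, each of weight
  \<open>dg p\<close>.\<close>

lemma sum_mangoldt: "(\<Sum>N\<in>submsets M. mangoldt dg N) = mdeg dg M"
proof -
  let ?S = "SIGMA p:set_mset M. {1..count M p}"
  let ?f = "\<lambda>(p, r). replicate_mset r p"
  have inj: "inj_on ?f ?S"
  proof (rule inj_onI, clarsimp)
    fix p r p' r' assume *: "Suc 0 \<le> r" "Suc 0 \<le> r'" "replicate_mset r p = replicate_mset r' p'"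
    then have "r = r'" by (metis size_replicate_mset)
    moreover have "p \<in># replicate_mset r' p'" using * by (metis in_replicate_mset One_nat_def less_eq_Suc_le)
    ultimately show "p = p' \<and> r = r'" by (auto split: if_splits)
  qed
  have sub: "?f ` ?S \<subseteq> submsets M"
    by (auto simp: submsets_def count_le_replicate_mset_subset_eq[symmetric])
  have "(\<Sum>N\<in>submsets M. mangoldt dg N) = (\<Sum>N\<in>?f ` ?S. mangoldt dg N)"
  proof (rule sum.mono_neutral_right)
    show "\<forall>N\<in>submsets M - ?f ` ?S. mangoldt dg N = 0"
    proof (rule ballI, rule ccontr)
      fix N assume N: "N \<in> submsets M - ?f ` ?S" "mangoldt dg N \<noteq> 0"
      then obtain p r where pr: "N = replicate_mset r p" "r \<ge> 1" using mangoldt_nz_iff by metis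
      with N have "r \<le> count M p" by (auto simp: submsets_def count_le_replicate_mset_subset_eq)
      with pr have "(p, r) \<in> ?S" by (auto simp: count_greater_zero_iff[symmetric] simp del: count_greater_zero_iff)
      with N pr show False by force
    qed
  qed (use sub in auto)
  also have "\<dots> = (\<Sum>x\<in>?S. mangoldt dg (?f x))"
    by (subst sum.reindex[OF inj]) (simp add: o_def)
  also have "\<dots> = (\<Sum>(p,r)\<in>?S. real (dg p))"
    by (rule sum.cong) (auto simp: mangoldt_replicate)
  also have "\<dots> = (\<Sum>p\<in>set_mset M. \<Sum>r\<in>{1..count M p}. real (dg p))"
    by (subst sum.Sigma) auto
  also have "\<dots> = real (mdeg dg M)" by (simp add: mdeg_eq_sum)
  finally show ?thesis .
qed

lemma moebius_abs_le: "\<bar>moebius M\<bar> \<le> 1"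
  by (simp add: moebius_def power_abs)

text \<open>Squarefree submultisets are subsets of the support; adding or removing one fixed prime
  pairs them with opposite signs.\<close>

lemma sum_moebius: "(\<Sum>N\<in>submsets M. moebius N) = (if M = {#} then 1 else 0)"
proof -
  let ?P = "Pow (set_mset M)"
  have fin: "finite X" if "X \<in> ?P" for X using that finite_subset by auto
  have inj: "inj_on mset_set ?P"
    by (rule inj_onI) (metis fin finite_set_mset_mset_set)
  have sub: "mset_set ` ?P \<subseteq> submsets M"
  proof clarsimp
    fix X assume X: "X \<subseteq> set_mset M"
    then have "finite X" using finite_subset by auto
    with X show "mset_set X \<subseteq># M"
      by (auto simp: subseteq_mset_def count_mset_set' Suc_le_eq)
  qed
  have "(\<Sum>N\<in>submsets M. moebius N) = (\<Sum>N\<in>mset_set ` ?P. moebius N)"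
  proof (rule sum.mono_neutral_right)
    show "\<forall>N\<in>submsets M - mset_set ` ?P. moebius N = 0"
    proof (rule ballI, rule ccontr)
      fix N assume N: "N \<in> submsets M - mset_set ` ?P" "moebius N \<noteq> 0"
      then have "\<forall>p. count N p \<le> 1" by (auto simp: moebius_def split: if_splits)
      then have "N = mset_set (set_mset N)"
        by (intro multiset_eqI) (metis One_nat_def count_eq_zero_iff count_mset_set(1,3)
            count_greater_zero_iff finite_set_mset le_antisym Suc_leI)
      moreover have "set_mset N \<in> ?P" using N by (auto dest: mset_subset_eqD)
      ultimately show False using N by blast
    qed
  qed (use sub in auto)
  also have "\<dots> = (\<Sum>X\<in>?P. moebius (mset_set X))"
    by (subst sum.reindex[OF inj]) (simp add: o_def)
  also have "\<dots> = (\<Sum>X\<in>?P. (-1) ^ card X)"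
    by (rule sum.cong) (auto simp: moebius_def fin count_mset_set')
  also have "\<dots> = (if M = {#} then 1 else 0)"
  proof (cases "M = {#}")
    case False
    then obtain p where p: "p \<in># M" by blast
    let ?S = "set_mset M - {p}"
    have S: "set_mset M = insert p ?S" using p by auto
    have "?P = Pow ?S \<union> insert p ` Pow ?S" by (subst S) (rule Pow_insert)
    then have "(\<Sum>X\<in>?P. (-1::real) ^ card X)
       = (\<Sum>X\<in>Pow ?S. (-1) ^ card X) + (\<Sum>X\<in>insert p ` Pow ?S. (-1) ^ card X)"
      by (simp add: sum.union_disjoint disjoint_iff) (subst sum.union_disjoint; auto)
    also have "(\<Sum>X\<in>insert p ` Pow ?S. (-1::real) ^ card X) = (\<Sum>X\<in>Pow ?S. (-1) ^ card (insert p X))"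
      by (subst sum.reindex) (auto simp: inj_on_def o_def)
    also have "\<dots> = (\<Sum>X\<in>Pow ?S. - ((-1) ^ card X))"
    proof (rule sum.cong[OF refl])
      fix X assume "X \<in> Pow ?S"
      then have "finite X" "p \<notin> X" using finite_subset[of X "set_mset M"] by auto
      then show "(-1::real) ^ card (insert p X) = - ((-1) ^ card X)" by simp
    qed
    finally show ?thesis using False by (simp add: sum_negf)
  qed simp
  finally show ?thesis .
qed

lemma moebius_trunc_empty [simp]: "moebius_trunc dg V {#} = 1"
  by (simp add: moebius_trunc_def submsets_def moebius_def)

lemma moebius_trunc_small:
  assumes "mdeg dg M \<le> V" "M \<noteq> {#}" shows "moebius_trunc dg V M = 0"
proof -
  have "moebius_trunc dg V M = (\<Sum>N\<in>submsets M. moebius N)"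
    unfolding moebius_trunc_def using assms(1) mdeg_mono[of _ M dg]
    by (intro sum.cong) (auto intro: order_trans)
  then show ?thesis using assms(2) by (simp add: sum_moebius)
qed

lemma moebius_trunc_abs_le: "\<bar>moebius_trunc dg V M\<bar> \<le> card (submsets M)"
proof -
  have "\<bar>moebius_trunc dg V M\<bar> \<le> (\<Sum>N\<in>submsets M. 1)"
    unfolding moebius_trunc_def
    by (intro order_trans[OF sum_abs] sum_mono) (simp add: moebius_abs_le)
  then show ?thesis by simp
qed

lemma card_submsets_le: "card (submsets M) \<le> (\<Prod>p\<in>set_mset M. count M p + 1)"
proof -
  have "card (submsets M) \<le> card (PiE (set_mset M) (\<lambda>p. {..count M p}))"
    by (rule card_inj_on_le[OF submsets_restrict_count]) (auto intro!: finite_PiE)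
  also have "\<dots> = (\<Prod>p\<in>set_mset M. count M p + 1)" by (simp add: card_PiE)
  finally show ?thesis .
qed

text \<open>A prime with \<open>B ^ dg p \<ge> 2\<close> satisfies
  \<open>c + 1 \<le> 2 ^ c \<le> B ^ (c * dg p)\<close> and costs nothing. Only finitely many primes
  are smaller, and each of them loses at most a constant factor.\<close>

lemma card_submsets_bound:
  fixes B :: real
  assumes B: "B > 1" and fin: "\<And>k. finite {p\<in>P. dg p \<le> k}" and pos: "\<And>p. p \<in> P \<Longrightarrow> dg p \<ge> 1"
  shows "\<exists>C\<ge>1. \<forall>M. set_mset M \<subseteq> P \<longrightarrow> card (submsets M) \<le> C * B ^ mdeg dg M"
proof -
  obtain k where k: "2 < B ^ k" using real_arch_pow[OF B] by blast
  define F where "F = {p\<in>P. dg p \<le> k}"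
  \<comment> \<open>Bernoulli's inequality yields \<open>c + 1 \<le> K * B ^ c\<close> as soon as
    \<open>K \<ge> 1\<close> and \<open>K * (B - 1) \<ge> 1\<close>.\<close>
  define K where "K = max 1 (1 / (B - 1))"
  have K1: "K \<ge> 1" by (simp add: K_def)
  have "K \<ge> 1 / (B - 1)" by (simp add: K_def)
  then have "K * (B - 1) \<ge> 1 / (B - 1) * (B - 1)" using B by (intro mult_right_mono) auto
  then have KB: "K * (B - 1) \<ge> 1" using B by simp
  have small: "real (c + 1) \<le> K * B ^ c" for c
  proof -
    have "1 + real c * (B - 1) \<le> B ^ c" using Bernoulli_inequality[of "B - 1" c] B by simp
    then have "K * (1 + real c * (B - 1)) \<le> K * B ^ c" using K1 by (intro mult_left_mono) auto
    moreover have "real c * 1 \<le> real c * (K * (B - 1))" using KB by (intro mult_left_mono) auto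
    ultimately show ?thesis using K1 by (simp add: algebra_simps)
  qed
  have fac: "real (c + 1) \<le> (if p \<in> F then K else 1) * B ^ (c * dg p)" if p: "p \<in> P" for c p
  proof (cases "p \<in> F")
    case True
    have "B ^ c \<le> B ^ (c * dg p)" using B pos[OF p] by (intro power_increasing) auto
    then have "K * B ^ c \<le> K * B ^ (c * dg p)" using K1 by simp
    then show ?thesis using small[of c] True by (simp del: of_nat_add of_nat_Suc)
  next
    case False
    then have "k \<le> dg p" using p by (simp add: F_def)
    then have "2 \<le> B ^ dg p" using k B by (meson less_eq_real_def order_trans power_increasing)
    then have "2 ^ c \<le> (B ^ dg p) ^ c" by (intro power_mono) auto
    moreover have "real (c + 1) \<le> 2 ^ c"
      by (metis Suc_eq_plus1 Suc_leI less_exp of_nat_le_iff of_nat_numeral of_nat_power)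
    ultimately show ?thesis using False by (simp add: power_mult[symmetric] mult.commute)
  qed
  have "real (card (submsets M)) \<le> K ^ card F * B ^ mdeg dg M" if M: "set_mset M \<subseteq> P" for M
  proof -
    have "real (card (submsets M)) \<le> real (\<Prod>p\<in>set_mset M. count M p + 1)"
      using card_submsets_le[of M] by (simp only: of_nat_le_iff)
    also have "\<dots> = (\<Prod>p\<in>set_mset M. real (count M p + 1))" by simp
    also have "\<dots> \<le> (\<Prod>p\<in>set_mset M. (if p \<in> F then K else 1) * B ^ (count M p * dg p))"
      using fac M by (intro prod_mono conjI) (simp_all del: of_nat_add of_nat_Suc add: subset_iff)
    also have "\<dots> = (\<Prod>p\<in>set_mset M. (if p \<in> F then K else 1)) * B ^ mdeg dg M"
      by (simp add: prod.distrib power_sum mdeg_eq_sum)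
    also have "(\<Prod>p\<in>set_mset M. (if p \<in> F then K else 1)) = K ^ card (set_mset M \<inter> F)"
      by (simp add: prod.If_cases)
    also have "\<dots> \<le> K ^ card F" using K1 fin unfolding F_def by (intro power_increasing card_mono) auto
    finally show ?thesis using B by (simp add: mult_right_mono)
  qed
  moreover have "K ^ card F \<ge> 1" using K1 by simp
  ultimately show ?thesis by blast
qed

section \<open>Vaughan's identity on multisets of primes\<close>

lemma sum_submsets_swap:
  "(\<Sum>b\<in>submsets M. \<Sum>m\<in>submsets (M - b). f b m) = (\<Sum>m\<in>submsets M. \<Sum>b\<in>submsets (M - m). f b m)"
proof -
  have *: "m \<subseteq># M \<and> b \<subseteq># M - m" if "b \<subseteq># M" "m \<subseteq># M - b" for b m
    using that subset_mset.order_trans[of m "M - b" M]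
    by (simp add: subset_mset.le_diff_conv2 add.commute)
  show ?thesis
    by (subst (1 2) sum.Sigma) (auto intro!: sum.reindex_bij_witness[of _ "\<lambda>(a,b). (b,a)" "\<lambda>(a,b). (b,a)"] dest: *)
qed

text \<open>The pairs \<open>b\<close>, \<open>m\<close> with \<open>b + m\<close> below
  \<open>M\<close> are regrouped by their sum \<open>N = b + m\<close>.\<close>

lemma sum_submsets_convol:
  "(\<Sum>b\<in>submsets M. \<Sum>m\<in>submsets (M - b). f b m) = (\<Sum>N\<in>submsets M. \<Sum>b\<in>submsets N. f b (N - b))"
proof -
  have 1: "b + m \<subseteq># M" if "b \<subseteq># M" "m \<subseteq># M - b" for b m
    using that by (metis subset_mset.add_le_cancel_left subset_mset.add_diff_inverse)
  have 2: "b \<subseteq># M \<and> N - b \<subseteq># M - b" if "N \<subseteq># M" "b \<subseteq># N" for b N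
    using that by (auto simp: subseteq_mset_def diff_le_mono intro: order_trans)
  show ?thesis
    by (subst (1 2) sum.Sigma)
       (auto intro!: sum.reindex_bij_witness[of _ "\<lambda>(N,b). (b,N - b)" "\<lambda>(b,m). (b + m, b)"] dest: 1 2)
qed

text \<open>The combined type I coefficient. Since only \<open>M\<close> of degree \<open>n\<close>
  occur, the logarithm of the cofactor of \<open>N\<close> is the constant
  \<open>n - mdeg dg N\<close>, so the two classical type I sums merge into one and no partial
  summation is needed.\<close>

definition vaughan_coeff :: "('p \<Rightarrow> nat) \<Rightarrow> nat \<Rightarrow> nat \<Rightarrow> nat \<Rightarrow> 'p multiset \<Rightarrow> real" where
  "vaughan_coeff dg U V n N = (if mdeg dg N \<le> V then moebius N * (real n - real (mdeg dg N)) else 0)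
     - (\<Sum>b\<in>submsets N. if mdeg dg b \<le> U \<and> mdeg dg (N - b) \<le> V then mangoldt dg b * moebius (N - b) else 0)"

lemma vaughan_coeff_support: "vaughan_coeff dg U V n N \<noteq> 0 \<Longrightarrow> mdeg dg N \<le> U + V"
proof (rule ccontr)
  assume nz: "vaughan_coeff dg U V n N \<noteq> 0" and big: "\<not> mdeg dg N \<le> U + V"
  have "\<not> (mdeg dg b \<le> U \<and> mdeg dg (N - b) \<le> V)" if "b \<in> submsets N" for b
    using that big by (auto simp: mdeg_diff)
  then have "(\<Sum>b\<in>submsets N. if mdeg dg b \<le> U \<and> mdeg dg (N - b) \<le> V
      then mangoldt dg b * moebius (N - b) else 0) = 0" by (intro sum.neutral) auto
  with nz big show False by (auto simp: vaughan_coeff_def split: if_splits)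
qed

text \<open>The convolution is dominated by the sum of \<open>mangoldt\<close> over all
  submultisets, which is just a degree; so it costs a factor \<open>n\<close> instead of a divisor
  function.\<close>

lemma vaughan_coeff_abs_le:
  assumes "mdeg dg N \<le> n" shows "\<bar>vaughan_coeff dg U V n N\<bar> \<le> 2 * n"
proof -
  have 1: "\<bar>if mdeg dg N \<le> V then moebius N * (real n - real (mdeg dg N)) else 0\<bar> \<le> n"
  proof -
    have "\<bar>moebius N\<bar> * \<bar>real n - real (mdeg dg N)\<bar> \<le> 1 * real n"
      by (intro mult_mono) (use assms moebius_abs_le in auto)
    then show ?thesis by (auto simp: abs_mult)
  qed
  have "\<bar>\<Sum>b\<in>submsets N. if mdeg dg b \<le> U \<and> mdeg dg (N - b) \<le> V
      then mangoldt dg b * moebius (N - b) else 0\<bar> \<le> (\<Sum>b\<in>submsets N. mangoldt dg b)"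
  proof (rule order_trans[OF sum_abs], rule sum_mono)
    fix b
    have "mangoldt dg b * \<bar>moebius (N - b)\<bar> \<le> mangoldt dg b * 1"
      by (intro mult_left_mono moebius_abs_le mangoldt_nonneg)
    then show "\<bar>if mdeg dg b \<le> U \<and> mdeg dg (N - b) \<le> V then mangoldt dg b * moebius (N - b) else 0\<bar>
       \<le> mangoldt dg b" by (auto simp: abs_mult mangoldt_nonneg)
  qed
  also have "\<dots> \<le> n" using assms by (simp add: sum_mangoldt)
  finally show ?thesis using 1 unfolding vaughan_coeff_def by linarith
qed

text \<open>Both forms come from expanding \<open>\<Sum> \<Lambda>(b) a(M - b)\<close> over \<open>deg b > U\<close>, where \<open>a\<close> is the truncated
  Moebius sum, which vanishes on nonempty multisets of degree at most \<open>V\<close>.\<close>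
lemma vaughan_identity:
  assumes n: "mdeg dg M = n" and U: "n > U"
  shows "mangoldt dg M = (\<Sum>N\<in>submsets M. vaughan_coeff dg U V n N)
    - (\<Sum>b\<in>submsets M. if mdeg dg b > U \<and> mdeg dg (M - b) > V
         then mangoldt dg b * moebius_trunc dg V (M - b) else 0)"
proof -
  let ?a = "moebius_trunc dg V" and ?L = "mangoldt dg"
  define R where "R = (\<Sum>b\<in>submsets M. if mdeg dg b > U \<and> mdeg dg (M - b) > V then ?L b * ?a (M - b) else 0)"
  \<comment> \<open>The term \<open>b = M\<close> lies in the range because \<open>n > U\<close>,
    and its other factor is \<open>?a {#} = 1\<close>. For any other \<open>b\<close> whose
    complement has degree at most \<open>V\<close>, that factor vanishes.\<close>
  have split: "(if mdeg dg b > U then ?L b * ?a (M - b) else 0) =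
       (if b = M then ?L M else 0) +
       (if mdeg dg b > U \<and> mdeg dg (M - b) > V then ?L b * ?a (M - b) else 0)"
    if b: "b \<in> submsets M" for b
  proof (cases "b = M")
    case True then show ?thesis using U n by simp
  next
    case False
    with b have "M - b \<noteq> {#}" by (metis Diff_eq_empty_iff_mset submsets_mem subset_mset.antisym)
    then show ?thesis using False moebius_trunc_small[of dg "M - b" V] by auto
  qed
  have 1: "(\<Sum>b\<in>submsets M. if mdeg dg b > U then ?L b * ?a (M - b) else 0) = ?L M + R"
  proof -
    have "(\<Sum>b\<in>submsets M. if b = M then ?L M else 0) = ?L M" by simp
    then show ?thesis unfolding R_def by (simp only: split sum.distrib cong: sum.cong)
  qed
  \<comment> \<open>Summing over \<open>b\<close> first turns \<open>mangoldt\<close> into the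
    degree of \<open>M - m\<close>, that is, into \<open>n - mdeg dg m\<close>.\<close>
  have 2: "(\<Sum>b\<in>submsets M. ?L b * ?a (M - b)) =
      (\<Sum>N\<in>submsets M. if mdeg dg N \<le> V then moebius N * (real n - real (mdeg dg N)) else 0)"
  proof -
    have "(\<Sum>b\<in>submsets M. ?L b * ?a (M - b)) =
      (\<Sum>b\<in>submsets M. \<Sum>m\<in>submsets (M - b). if mdeg dg m \<le> V then ?L b * moebius m else 0)"
      by (simp add: moebius_trunc_def sum_distrib_left if_distrib cong: if_cong)
    also have "\<dots> = (\<Sum>m\<in>submsets M. \<Sum>b\<in>submsets (M - m). if mdeg dg m \<le> V then ?L b * moebius m else 0)"
      by (rule sum_submsets_swap)
    also have "\<dots> = (\<Sum>m\<in>submsets M. if mdeg dg m \<le> V then (\<Sum>b\<in>submsets (M - m). ?L b) * moebius m else 0)"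
      by (intro sum.cong) (auto simp: sum_distrib_right)
    also have "\<dots> = (\<Sum>N\<in>submsets M. if mdeg dg N \<le> V then moebius N * (real n - real (mdeg dg N)) else 0)"
      using n by (intro sum.cong) (auto simp: sum_mangoldt mdeg_diff of_nat_diff mdeg_mono)
    finally show ?thesis .
  qed
  have 3: "(\<Sum>b\<in>submsets M. if mdeg dg b \<le> U then ?L b * ?a (M - b) else 0) =
     (\<Sum>N\<in>submsets M. \<Sum>b\<in>submsets N. if mdeg dg b \<le> U \<and> mdeg dg (N - b) \<le> V then ?L b * moebius (N - b) else 0)"
  proof -
    have "(\<Sum>b\<in>submsets M. if mdeg dg b \<le> U then ?L b * ?a (M - b) else 0) =
      (\<Sum>b\<in>submsets M. \<Sum>m\<in>submsets (M - b). if mdeg dg b \<le> U \<and> mdeg dg m \<le> V then ?L b * moebius m else 0)"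
      by (intro sum.cong) (auto simp: moebius_trunc_def sum_distrib_left if_distrib cong: if_cong)
    then show ?thesis by (simp only: sum_submsets_convol)
  qed
  have "(\<Sum>b\<in>submsets M. ?L b * ?a (M - b)) =
      (\<Sum>b\<in>submsets M. if mdeg dg b > U then ?L b * ?a (M - b) else 0)
    + (\<Sum>b\<in>submsets M. if mdeg dg b \<le> U then ?L b * ?a (M - b) else 0)"
    unfolding sum.distrib[symmetric] by (intro sum.cong) auto
  then have "?L M = (\<Sum>N\<in>submsets M. vaughan_coeff dg U V n N) - R"
    using 1 2 3 unfolding vaughan_coeff_def by (simp add: sum_subtractf)
  then show ?thesis unfolding R_def .
qed

section \<open>Additive functionals on finite groups\<close>

definition add_subgroup :: "'g::ab_group_add set \<Rightarrow> bool" where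
  "add_subgroup W \<longleftrightarrow> 0 \<in> W \<and> (\<forall>x\<in>W. \<forall>y\<in>W. x - y \<in> W)"

definition additive_on :: "'g::ab_group_add set \<Rightarrow> ('g \<Rightarrow> 'b::ab_group_add) \<Rightarrow> bool" where
  "additive_on W f \<longleftrightarrow> (\<forall>x\<in>W. \<forall>y\<in>W. f (x - y) = f x - f y)"

text \<open>The counting form of rank-nullity: subtracting one of its points maps each fibre of the
  joint evaluation injectively into the common kernel, and there are at most
  \<open>CARD('b) ^ card G\<close> fibres.\<close>

lemma card_le_kernel:
  fixes W :: "'g::ab_group_add set" and G :: "('g \<Rightarrow> 'b::{ab_group_add,finite}) set"
  assumes fin: "finite W" and W: "add_subgroup W" and G: "finite G" "\<And>g. g \<in> G \<Longrightarrow> additive_on W g"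
  shows "card W \<le> CARD('b) ^ card G * card {w\<in>W. \<forall>g\<in>G. g w = 0}"
proof -
  let ?f = "\<lambda>w. restrict (\<lambda>g. g w) G" and ?K = "{w\<in>W. \<forall>g\<in>G. g w = 0}"
  have fibre: "card {w\<in>W. ?f w = y} \<le> card ?K" if "y \<in> ?f ` W" for y
  proof -
    from that obtain w0 where w0: "w0 \<in> W" "y = ?f w0" by auto
    have "(\<lambda>w. w - w0) ` {w \<in> W. ?f w = y} \<subseteq> ?K"
    proof (rule image_subsetI)
      fix w assume "w \<in> {w \<in> W. ?f w = y}"
      then have w: "w \<in> W" "?f w = y" by auto
      have "g (w - w0) = 0" if "g \<in> G" for g
      proof -
        have "?f w g = ?f w0 g" using w w0 by simp
        then have "g w = g w0" using that by simp
        then show ?thesis using G(2)[OF that] w w0 unfolding additive_on_def by simp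
      qed
      then show "w - w0 \<in> ?K" using W w w0 unfolding add_subgroup_def by blast
    qed
    then show ?thesis by (rule card_inj_on_le[rotated]) (use fin in \<open>auto simp: inj_on_def\<close>)
  qed
  have im: "?f ` W \<subseteq> PiE G (\<lambda>_. UNIV)" by auto
  have "card W = (\<Sum>y\<in>?f ` W. card {w\<in>W. ?f w = y})"
    using sum.image_gen[OF fin, of "\<lambda>_. 1::nat" ?f] by simp
  also have "\<dots> \<le> card (?f ` W) * card ?K" using sum_bounded_above[OF fibre] by simp
  also have "\<dots> \<le> card (PiE G (\<lambda>_. UNIV :: 'b set)) * card ?K"
    by (intro mult_right_mono card_mono im finite_PiE G) auto
  also have "card (PiE G (\<lambda>_. UNIV :: 'b set)) = CARD('b) ^ card G" using G by (simp add: card_PiE)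
  finally show ?thesis .
qed

definition delta_dev :: "'a::{zero,finite} \<Rightarrow> real" where
  "delta_dev t = of_bool (t = 0) - 1 / CARD('a)"

lemma card_UNIV_pos [simp]: "CARD('a::finite) > 0"
  by (simp add: finite_UNIV_card_ge_0)

lemma delta_dev_abs_le: "\<bar>delta_dev (t :: 'a::{zero,finite})\<bar> \<le> 1"
proof -
  have "1 / real CARD('a) \<le> 1" "1 / real CARD('a) \<ge> 0" using card_UNIV_pos[where 'a='a] by (auto simp: field_simps Suc_leI)
  then show ?thesis by (auto simp: delta_dev_def)
qed

text \<open>If \<open>L\<close> is not zero on \<open>W\<close>, closure under scaling makes it
  surjective, and translation shows that all its fibres have the same size; the mean of
  \<open>delta_dev\<close> over the field is 0.\<close>

lemma sum_delta_dev:
  fixes W :: "'a::{field,finite} fls set"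
  assumes fin: "finite W" and W: "add_subgroup W" and L: "additive_on W L"
    and sc: "\<And>c w. w \<in> W \<Longrightarrow> fls_const c * w \<in> W \<and> L (fls_const c * w) = c * L w"
  shows "(\<Sum>w\<in>W. delta_dev (L w :: 'a)) = (if \<forall>w\<in>W. L w = 0 then card W * (1 - 1 / CARD('a)) else 0)"
proof (cases "\<forall>w\<in>W. L w = 0")
  case True
  then show ?thesis by (simp add: delta_dev_def)
next
  case False
  then obtain w0 where w0: "w0 \<in> W" "L w0 \<noteq> 0" by blast
  let ?F = "\<lambda>t. {w\<in>W. L w = t}"
  have le: "card (?F t) \<le> card (?F t')" for t t'
  proof (rule card_inj_on_le)
    let ?v = "fls_const ((t - t') / L w0) * w0"
    have v: "?v \<in> W" "L ?v = t - t'" using sc[OF w0(1)] w0(2) by auto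
    show "inj_on (\<lambda>w. w - ?v) (?F t)" by (simp add: inj_on_def)
    show "(\<lambda>w. w - ?v) ` ?F t \<subseteq> ?F t'"
      using v W L unfolding add_subgroup_def additive_on_def by auto
    show "finite (?F t')" using fin by simp
  qed
  have "card W = (\<Sum>t\<in>L ` W. card (?F t))"
    using sum.image_gen[OF fin, of "\<lambda>_. 1::nat" L] by simp
  also have "\<dots> = (\<Sum>t\<in>UNIV. card (?F t))"
    by (rule sum.mono_neutral_left) (auto simp: card_eq_0_iff)
  also have "\<dots> = (\<Sum>t\<in>(UNIV::'a set). card (?F 0))"
    by (rule sum.cong) (auto intro: antisym le)
  finally have "card W = CARD('a) * card (?F 0)" by simp
  moreover have "(\<Sum>w\<in>W. delta_dev (L w)) = card (?F 0) - card W / CARD('a)"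
    using fin by (simp add: delta_dev_def sum_subtractf of_bool_def flip: sum.inter_filter)
  ultimately show ?thesis using False by (simp only: if_False) simp
qed

text \<open>Let \<open>c x\<close> be the total weight of the \<open>k\<close> with
  \<open>t k = x\<close>. The right side is the sum over all \<open>x\<close> of the squared
  deviations of \<open>c x\<close> from the mean, and the left side is its single term at
  \<open>x = 0\<close>.\<close>

lemma delta_dev_posdef:
  fixes t :: "'k \<Rightarrow> 'a::{field,finite}" and b :: "'k \<Rightarrow> real"
  assumes fin: "finite K"
  shows "(\<Sum>k\<in>K. b k * delta_dev (t k))\<^sup>2 \<le> (\<Sum>k\<in>K. \<Sum>k'\<in>K. b k * b k' * delta_dev (t k - t k'))"
proof -
  define q where "q = real CARD('a)"
  define B where "B = (\<Sum>k\<in>K. b k)"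
  define c where "c = (\<lambda>x. \<Sum>k\<in>K. b k * of_bool (t k = x))"
  have q: "q > 0" by (simp add: q_def)
  have cB: "(\<Sum>x\<in>UNIV. c x) = B"
    unfolding c_def B_def by (subst sum.swap) (simp add: of_bool_def sum.delta if_distrib cong: if_cong)
  have "(\<Sum>k\<in>K. b k * delta_dev (t k)) = c 0 - B / q"
    by (simp add: delta_dev_def c_def B_def q_def right_diff_distrib sum_subtractf sum_divide_distrib)
  then have "(\<Sum>k\<in>K. b k * delta_dev (t k))\<^sup>2 = (c 0 - B / q)\<^sup>2" by simp
  also have "\<dots> \<le> (\<Sum>x\<in>UNIV. (c x - B / q)\<^sup>2)"
    by (rule member_le_sum) auto
  also have "\<dots> = (\<Sum>x\<in>UNIV. (c x)\<^sup>2) - 2 * B / q * (\<Sum>x\<in>UNIV. c x) + q * (B / q)\<^sup>2"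
  proof -
    have "(\<Sum>x\<in>UNIV. (c x - B / q)\<^sup>2) = (\<Sum>x\<in>UNIV. (c x)\<^sup>2 - 2 * B / q * c x + (B / q)\<^sup>2)"
      by (intro sum.cong) (simp_all add: power2_diff)
    then show ?thesis by (simp only: sum.distrib sum_subtractf sum_distrib_left[symmetric]) (simp add: q_def)
  qed
  also have "\<dots> = (\<Sum>x\<in>UNIV. (c x)\<^sup>2) - B\<^sup>2 / q"
    using q by (simp add: cB power2_eq_square field_simps)
  also have "(\<Sum>x\<in>UNIV. (c x)\<^sup>2) = (\<Sum>k\<in>K. \<Sum>k'\<in>K. b k * b k' * of_bool (t k = t k'))"
  proof -
    have "(\<Sum>x\<in>UNIV. (c x)\<^sup>2) = (\<Sum>x\<in>UNIV. \<Sum>k\<in>K. \<Sum>k'\<in>K. (b k * of_bool (t k = x)) * (b k' * of_bool (t k' = x)))"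
      by (simp add: c_def power2_eq_square sum_product)
    also have "\<dots> = (\<Sum>k\<in>K. \<Sum>k'\<in>K. \<Sum>x\<in>UNIV. (b k * of_bool (t k = x)) * (b k' * of_bool (t k' = x)))"
      by (subst sum.swap, rule sum.cong[OF refl], rule sum.swap)
    also have "\<dots> = (\<Sum>k\<in>K. \<Sum>k'\<in>K. \<Sum>x\<in>UNIV. if x = t k then b k * b k' * of_bool (t k = t k') else 0)"
      by (intro sum.cong) auto
    finally show ?thesis by simp
  qed
  also have "\<dots> - B\<^sup>2 / q = (\<Sum>k\<in>K. \<Sum>k'\<in>K. b k * b k' * delta_dev (t k - t k'))"
    by (simp add: delta_dev_def B_def q_def power2_eq_square sum_product right_diff_distrib
        sum_subtractf sum_divide_distrib)
  finally show ?thesis .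
qed

section \<open>The ring inside its completion\<close>

unbundle fps_syntax

text \<open>A degree bound phrased by coefficients, so that 0 satisfies every bound and closure
  under addition needs no cases. By contrast, \<open>dg 0\<close> is the default value 0.\<close>

definition dle :: "int \<Rightarrow> 'a::zero fls \<Rightarrow> bool" where
  "dle u y \<longleftrightarrow> (\<forall>n < - u. y $$ n = 0)"

definition dg :: "'a::zero fls \<Rightarrow> int" where
  "dg y = - fls_subdegree y"

lemma dle_iff: "dle u y \<longleftrightarrow> y = 0 \<or> dg y \<le> u"
proof
  assume "dle u y"
  then show "y = 0 \<or> dg y \<le> u" unfolding dle_def dg_def
    using fls_subdegree_geI[of y "-u"] by fastforce
next
  assume "y = 0 \<or> dg y \<le> u"
  then show "dle u y" unfolding dle_def dg_def by auto
qed

lemma dle_0 [simp]: "dle u 0" by (simp add: dle_def)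

lemma dle_add: "dle u y \<Longrightarrow> dle u z \<Longrightarrow> dle u (y + z)"
  by (simp add: dle_def)

lemma dle_diff: "dle u y \<Longrightarrow> dle u z \<Longrightarrow> dle u (y - z :: 'a::ab_group_add fls)"
  by (simp add: dle_def)

lemma dle_mono: "dle u y \<Longrightarrow> u \<le> v \<Longrightarrow> dle v y"
  by (simp add: dle_def)

lemma dg_mult: "y \<noteq> 0 \<Longrightarrow> z \<noteq> 0 \<Longrightarrow> dg (y * z) = dg y + dg (z :: 'a::field fls)"
  by (simp add: dg_def)

lemma dg_divide: "y \<noteq> 0 \<Longrightarrow> z \<noteq> 0 \<Longrightarrow> dg (y / z) = dg y - dg (z :: 'a::field fls)"
  by (simp add: dg_def fls_divide_subdegree)

lemma dg_inverse: "dg (inverse (z :: 'a::field fls)) = - dg z"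
  by (simp add: dg_def)

lemma dle_mult: "dle u y \<Longrightarrow> dle v z \<Longrightarrow> dle (u + v) (y * z :: 'a::field fls)"
  unfolding dle_iff by (metis add_mono dg_mult mult_eq_0_iff)

lemma dle_const_mult [simp]: "dle u y \<Longrightarrow> dle u (fls_const (c::'a::field) * y)"
  by (simp add: dle_def)

section \<open>Polynomials inside the completion\<close>

lemma kinf_nth: "kinf_of_poly p $$ n = (if n \<le> 0 then Polynomial.coeff p (nat (- n)) else 0)"
proof -
  have "kinf_of_poly p $$ n = (\<Sum>i\<le>Polynomial.degree p. if n = - int i then Polynomial.coeff p i else 0)"
    unfolding kinf_of_poly_def by (subst fls_nth_sum) (auto intro!: sum.cong)
  also have "\<dots> = (if n \<le> 0 then Polynomial.coeff p (nat (- n)) else 0)"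
  proof (cases "n \<le> 0")
    case True
    then have "(\<Sum>i\<le>Polynomial.degree p. if n = - int i then Polynomial.coeff p i else 0)
      = (\<Sum>i\<le>Polynomial.degree p. if i = nat (- n) then Polynomial.coeff p i else 0)"
      by (intro sum.cong) auto
    then show ?thesis using True by (simp add: coeff_eq_0)
  qed (auto intro!: sum.neutral)
  finally show ?thesis .
qed

lemma kinf_add: "kinf_of_poly (p + r) = kinf_of_poly p + kinf_of_poly r"
  by (rule fls_eqI) (simp add: kinf_nth)

lemma kinf_diff: "kinf_of_poly (p - r) = kinf_of_poly p - kinf_of_poly r"
  by (rule fls_eqI) (simp add: kinf_nth)

lemma kinf_0 [simp]: "kinf_of_poly 0 = 0"
  by (rule fls_eqI) (simp add: kinf_nth)

lemma kinf_smult: "kinf_of_poly (Polynomial.smult c p) = fls_const c * kinf_of_poly p"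
  by (rule fls_eqI) (simp add: kinf_nth)

lemma kinf_pCons: "kinf_of_poly (pCons a p) = fls_const a + fls_X_inv * kinf_of_poly p"
proof (rule fls_eqI)
  fix n :: int
  show "kinf_of_poly (pCons a p) $$ n = (fls_const a + fls_X_inv * kinf_of_poly p) $$ n"
  proof (cases "n < 0")
    case True
    then have "nat (- n) = Suc (nat (- (n + 1)))" by simp
    with True show ?thesis by (simp add: kinf_nth fls_X_inv_times_conv_shift)
  qed (auto simp: kinf_nth fls_X_inv_times_conv_shift)
qed

lemma kinf_mult: "kinf_of_poly (p * r) = kinf_of_poly p * kinf_of_poly r"
  by (induction p) (simp_all add: kinf_add kinf_pCons kinf_smult algebra_simps)

lemma kinf_1 [simp]: "kinf_of_poly 1 = 1"
  by (rule fls_eqI) (auto simp: kinf_nth)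

lemma kinf_const: "kinf_of_poly [:c:] = fls_const c"
  by (simp add: kinf_pCons)

lemma kinf_eq_0_iff [simp]: "kinf_of_poly p = 0 \<longleftrightarrow> p = 0"
proof
  assume *: "kinf_of_poly p = 0"
  have "kinf_of_poly p $$ (- int i) = 0" for i by (simp add: *)
  then show "p = 0" by (simp add: kinf_nth poly_eq_iff)
qed simp

lemma kinf_inj: "kinf_of_poly p = kinf_of_poly r \<longleftrightarrow> p = r"
  by (metis kinf_diff kinf_eq_0_iff right_minus_eq)

lemma dg_kinf: "p \<noteq> 0 \<Longrightarrow> dg (kinf_of_poly p) = int (Polynomial.degree p)"
  unfolding dg_def by (subst fls_subdegree_eqI[of _ "- int (Polynomial.degree p)"])
    (auto simp: kinf_nth coeff_eq_0)

lemma dle_kinf: "dle u (kinf_of_poly p) \<longleftrightarrow> (\<forall>i. int i > u \<longrightarrow> Polynomial.coeff p i = 0)"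
proof
  assume *: "dle u (kinf_of_poly p)"
  show "\<forall>i. int i > u \<longrightarrow> Polynomial.coeff p i = 0"
  proof (intro allI impI)
    fix i assume "int i > u"
    then have "kinf_of_poly p $$ (- int i) = 0" using * by (simp add: dle_def)
    then show "Polynomial.coeff p i = 0" by (simp add: kinf_nth)
  qed
qed (auto simp: dle_def kinf_nth)

lemma kinf_polypart:
  fixes y :: "'a::field fls"
  obtains p where "\<forall>n\<le>0. (y - kinf_of_poly p) $$ n = 0"
proof -
  define N where "N = nat (dg y)"
  define p where "p = Poly (map (\<lambda>i. y $$ (- int i)) [0..<Suc N])"
  have "(y - kinf_of_poly p) $$ n = 0" if "n \<le> 0" for n
  proof -
    have "y $$ n = 0" if "nat (- n) > N"
      using that unfolding N_def dg_def by (intro fls_eq0_below_subdegree) linarith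
    then show ?thesis using \<open>n \<le> 0\<close> by (auto simp: kinf_nth p_def nth_default_def simp del: upt_Suc)
  qed
  then show ?thesis using that by blast
qed

lemma card_poly_coeff_zero_above: "card {p :: 'a::{field,finite} poly. \<forall>i\<ge>n. Polynomial.coeff p i = 0} = CARD('a) ^ n"
  and finite_poly_coeff_zero_above: "finite {p :: 'a poly. \<forall>i\<ge>n. Polynomial.coeff p i = 0}"
proof -
  let ?P = "{p :: 'a poly. \<forall>i\<ge>n. Polynomial.coeff p i = 0}"
  let ?f = "\<lambda>p :: 'a poly. restrict (Polynomial.coeff p) {..<n}"
  have bij: "bij_betw ?f ?P (PiE {..<n} (\<lambda>_. UNIV))"
  proof (rule bij_betw_byWitness[where f' = "\<lambda>g. Poly (map g [0..<n])"])
    show "\<forall>p\<in>?P. Poly (map (?f p) [0..<n]) = p"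
      by (auto simp: poly_eq_iff nth_default_def)
    show "\<forall>g\<in>PiE {..<n} (\<lambda>_. UNIV). ?f (Poly (map g [0..<n])) = g"
      by (auto simp: fun_eq_iff nth_default_def PiE_def extensional_def restrict_def)
    show "?f ` ?P \<subseteq> PiE {..<n} (\<lambda>_. UNIV)" by (rule image_subsetI) simp
    show "(\<lambda>g. Poly (map g [0..<n])) ` PiE {..<n} (\<lambda>_. UNIV) \<subseteq> ?P"
      by (rule image_subsetI) (simp add: nth_default_def)
  qed
  have "card ?P = card (PiE {..<n} (\<lambda>_. UNIV :: 'a set))" by (rule bij_betw_same_card[OF bij])
  also have "\<dots> = CARD('a) ^ n" by (subst card_PiE) simp_all
  finally show "card ?P = CARD('a) ^ n" .
  have "finite (PiE {..<n} (\<lambda>_. UNIV :: 'a set))" by (intro finite_PiE) auto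
  then show "finite ?P" using bij_betw_finite[OF bij] by blast
qed

locale real_quadratic =
  fixes d :: "'a::{field,finite} poly" and s :: "'a fls"
  assumes odd_card: "odd CARD('a)"
    and monic: "lead_coeff d = 1"
    and even_deg: "even (Polynomial.degree d)"
    and sqrt_d: "s * s = kinf_of_poly d"
    and fact: "factorial_domain (ringA d)"
begin

sublocale R: factorial_domain "ringA d" by (rule fact)

definition q :: nat where "q = CARD('a)"

definition D :: int where "D = int (Polynomial.degree d div 2)"

section \<open>The ring A inside the completion, and its conjugation\<close>

definition A :: "'a fls set" where "A = range (sigma1 s)"

text \<open>Translation by 1 permutes the field, so comparing sums shows that
  \<open>CARD('a)\<close> is 0 in it. If 2 were 0 there, the odd number \<open>CARD('a)\<close>
  would be 1 in the field.\<close>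

lemma two_neq_0: "(2::'a) \<noteq> 0"
proof
  assume two: "(2::'a) = 0"
  obtain k where k: "CARD('a) = 2 * k + 1" using odd_card by (auto elim!: oddE)
  have "(\<Sum>x\<in>UNIV. x + 1 :: 'a) = (\<Sum>x\<in>UNIV. x)"
    by (rule sum.reindex_bij_witness[of _ "\<lambda>x. x - 1" "\<lambda>x. x + 1"]) auto
  then have "of_nat CARD('a) = (0 :: 'a)" by (simp add: sum.distrib)
  then show False using k two by simp
qed

lemma q_ge_3: "q \<ge> 3"
proof -
  have "card {0, 1::'a} \<le> CARD('a)" by (rule card_mono) auto
  then have "CARD('a) \<ge> 2" by simp
  then show ?thesis using odd_card unfolding q_def by (cases "CARD('a) = 2") auto
qed

text \<open>The source of the fact that \<open>d\<close> is not a square: the product of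
  \<open>(a, b)\<close> and \<open>(a, - b)\<close> is the norm, and \<open>ringA d\<close> is an
  integral domain.\<close>

lemma ringA_no_zero_div:
  assumes "a * a = b * b * d" shows "a = 0 \<and> b = 0"
proof -
  have "mult (ringA d) (a, b) (a, - b) = zero (ringA d)" using assms by (simp add: ringA_def)
  then have "(a, b) = zero (ringA d) \<or> (a, - b) = zero (ringA d)"
    using R.integral[of "(a,b)" "(a,-b)"] by (simp add: ringA_def)
  then show ?thesis by (auto simp: ringA_def)
qed

lemma D_ge_1: "D \<ge> 1"
proof (rule ccontr)
  assume "\<not> D \<ge> 1"
  then have "Polynomial.degree d = 0" using even_deg unfolding D_def by presburger
  then obtain a where "d = [:a:]" by (rule degree_eq_zeroE)
  with monic have "d = 1" by (simp add: one_pCons)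
  then show False using ringA_no_zero_div[of 1 1] by simp
qed

lemma d_nz [simp]: "d \<noteq> 0" using monic by auto

lemma s_nz [simp]: "s \<noteq> 0"
  using sqrt_d by (metis d_nz kinf_eq_0_iff mult_zero_left)

lemma dg_s: "dg s = D"
proof -
  have "dg s + dg s = int (Polynomial.degree d)"
    using dg_mult[of s s] sqrt_d dg_kinf[OF d_nz] by simp
  then show ?thesis using even_deg unfolding D_def by presburger
qed

lemma sigma_inj:
  assumes "kinf_of_poly a + kinf_of_poly b * s = kinf_of_poly a' + kinf_of_poly b' * s"
  shows "a = a' \<and> b = b'"
proof -
  have "kinf_of_poly (a - a') = kinf_of_poly (b' - b) * s"
    using assms by (simp add: kinf_diff algebra_simps)
  then have "kinf_of_poly (a - a') * kinf_of_poly (a - a') = (kinf_of_poly (b' - b) * s) * (kinf_of_poly (b' - b) * s)"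
    by simp
  also have "\<dots> = kinf_of_poly (b' - b) * kinf_of_poly (b' - b) * kinf_of_poly d"
    by (simp add: sqrt_d[symmetric] ac_simps)
  finally have "(a - a') * (a - a') = (b' - b) * (b' - b) * d"
    by (simp only: kinf_mult[symmetric] kinf_inj)
  from ringA_no_zero_div[OF this] show ?thesis by simp
qed

lemma inj_sigma1: "inj (sigma1 s)"
  by (rule injI) (auto simp: sigma1_def dest: sigma_inj intro: prod_eqI)

text \<open>Elements of the ring are identified with their first embedding, so the second embedding
  becomes a conjugation on series, meaningful only on \<open>A\<close>.\<close>

definition cj :: "'a fls \<Rightarrow> 'a fls" where "cj y = sigma2 s (inv_into UNIV (sigma1 s) y)"

lemma cj_sigma1 [simp]: "cj (sigma1 s p) = sigma2 s p"
  by (simp add: cj_def inv_f_f[OF inj_sigma1])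

lemma A_cases:
  assumes "c \<in> A"
  obtains a b where "c = kinf_of_poly a + kinf_of_poly b * s" "cj c = kinf_of_poly a - kinf_of_poly b * s"
proof -
  from assms obtain p where p: "c = sigma1 s p" by (auto simp: A_def)
  with that[of "fst p" "snd p"] show ?thesis using cj_sigma1[of p] by (simp add: sigma1_def sigma2_def)
qed

lemma A_I [simp, intro]: "kinf_of_poly a + kinf_of_poly b * s \<in> A"
  and cj_I [simp]: "cj (kinf_of_poly a + kinf_of_poly b * s) = kinf_of_poly a - kinf_of_poly b * s"
proof -
  have *: "kinf_of_poly a + kinf_of_poly b * s = sigma1 s (a, b)" by (simp add: sigma1_def)
  show "kinf_of_poly a + kinf_of_poly b * s \<in> A" unfolding * by (simp add: A_def)
  show "cj (kinf_of_poly a + kinf_of_poly b * s) = kinf_of_poly a - kinf_of_poly b * s"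
    unfolding * by (simp add: sigma2_def)
qed

lemma kinf_in_A [simp, intro]: "kinf_of_poly a \<in> A" and cj_kinf [simp]: "cj (kinf_of_poly a) = kinf_of_poly a"
  using A_I[of a 0] cj_I[of a 0] by simp_all

lemma kinf_s_in_A [simp, intro]: "kinf_of_poly b * s \<in> A" and cj_kinf_s [simp]: "cj (kinf_of_poly b * s) = - (kinf_of_poly b * s)"
  using A_I[of 0 b] cj_I[of 0 b] by simp_all

lemma A_0 [simp, intro]: "0 \<in> A" and cj_0 [simp]: "cj 0 = 0"
  using kinf_in_A[of 0] cj_kinf[of 0] by simp_all

lemma A_1 [simp, intro]: "1 \<in> A" and cj_1 [simp]: "cj 1 = 1"
  using kinf_in_A[of 1] cj_kinf[of 1] by simp_all

lemma A_const [simp, intro]: "fls_const c \<in> A" and cj_const [simp]: "cj (fls_const c) = fls_const c"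
  using kinf_in_A[of "[:c:]"] cj_kinf[of "[:c:]"] by (simp_all add: kinf_const)

lemma add_aux: "x \<in> A \<Longrightarrow> y \<in> A \<Longrightarrow> x + y \<in> A \<and> cj (x + y) = cj x + cj y"
proof -
  assume "x \<in> A" "y \<in> A"
  then obtain a b a' b' where *:
    "x = kinf_of_poly a + kinf_of_poly b * s" "cj x = kinf_of_poly a - kinf_of_poly b * s"
    "y = kinf_of_poly a' + kinf_of_poly b' * s" "cj y = kinf_of_poly a' - kinf_of_poly b' * s"
    by (metis A_cases)
  have "x + y = kinf_of_poly (a + a') + kinf_of_poly (b + b') * s"
    by (simp add: * kinf_add algebra_simps)
  then have "x + y \<in> A" "cj (x + y) = kinf_of_poly (a + a') - kinf_of_poly (b + b') * s"
    by (simp_all only: A_I cj_I)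
  moreover have "\<dots> = cj x + cj y"
    by (simp only: *(2,4) kinf_add) (simp add: algebra_simps)
  ultimately show ?thesis by simp
qed

lemma mult_aux: "x \<in> A \<Longrightarrow> y \<in> A \<Longrightarrow> x * y \<in> A \<and> cj (x * y) = cj x * cj y"
proof -
  assume "x \<in> A" "y \<in> A"
  then obtain a b a' b' where *:
    "x = kinf_of_poly a + kinf_of_poly b * s" "cj x = kinf_of_poly a - kinf_of_poly b * s"
    "y = kinf_of_poly a' + kinf_of_poly b' * s" "cj y = kinf_of_poly a' - kinf_of_poly b' * s"
    by (metis A_cases)
  have "x * y = kinf_of_poly (a * a' + b * b' * d) + kinf_of_poly (a * b' + b * a') * s"
    by (simp add: * kinf_add kinf_mult sqrt_d[symmetric] algebra_simps)
  then have "x * y \<in> A"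
    "cj (x * y) = kinf_of_poly (a * a' + b * b' * d) - kinf_of_poly (a * b' + b * a') * s"
    by (simp_all only: A_I cj_I)
  moreover have "\<dots> = cj x * cj y"
    by (simp only: *(2,4) kinf_add kinf_mult sqrt_d[symmetric]) (simp add: algebra_simps)
  ultimately show ?thesis by simp
qed

lemmas A_add [simp, intro] = conjunct1[OF add_aux] and cj_add = conjunct2[OF add_aux]
lemmas A_mult [simp, intro] = conjunct1[OF mult_aux] and cj_mult = conjunct2[OF mult_aux]

lemma A_uminus [simp, intro]: "x \<in> A \<Longrightarrow> - x \<in> A" and cj_uminus: "x \<in> A \<Longrightarrow> cj (- x) = - cj x"
proof -
  have *: "- x = fls_const (-1) * x" by (rule fls_eqI) simp
  show "x \<in> A \<Longrightarrow> - x \<in> A" unfolding * by (simp only: A_mult A_const)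
  assume "x \<in> A"
  then have "cj (- x) = fls_const (-1) * cj x" unfolding * by (simp only: cj_mult A_const cj_const)
  also have "\<dots> = - cj x" by (rule fls_eqI) simp
  finally show "cj (- x) = - cj x" .
qed

lemma A_diff [simp, intro]: "x \<in> A \<Longrightarrow> y \<in> A \<Longrightarrow> x - y \<in> A"
  and cj_diff: "x \<in> A \<Longrightarrow> y \<in> A \<Longrightarrow> cj (x - y) = cj x - cj y"
  using add_aux[of x "- y"] by (simp_all add: cj_uminus)

lemma cj_in_A [simp, intro]: "x \<in> A \<Longrightarrow> cj x \<in> A" and cj_cj: "x \<in> A \<Longrightarrow> cj (cj x) = x"
  by (auto elim!: A_cases simp: cj_diff)

lemma cj_eq_0_iff [simp]: "x \<in> A \<Longrightarrow> cj x = 0 \<longleftrightarrow> x = 0"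
  by (metis cj_0 cj_cj)

lemma norm_poly:
  assumes "x \<in> A" "x \<noteq> 0" obtains \<nu> where "x * cj x = kinf_of_poly \<nu>" "\<nu> \<noteq> 0"
proof -
  from assms obtain a b where *: "x = kinf_of_poly a + kinf_of_poly b * s" "cj x = kinf_of_poly a - kinf_of_poly b * s"
    by (metis A_cases)
  have "x * cj x = (kinf_of_poly a + kinf_of_poly b * s) * (kinf_of_poly a - kinf_of_poly b * s)"
    by (simp only: *(2)) (simp only: *(1))
  then have "x * cj x = kinf_of_poly (a * a - b * b * d)"
    by (simp add: kinf_diff kinf_mult sqrt_d[symmetric] algebra_simps)
  moreover have "x * cj x \<noteq> 0" using assms by simp
  ultimately show ?thesis using that by (metis kinf_eq_0_iff)
qed

section \<open>Norm degrees, boxes and their cardinalities\<close>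

definition dN :: "'a fls \<Rightarrow> nat" where "dN x = nat (dg x + dg (cj x))"

lemma dg_norm_nonneg: "x \<in> A \<Longrightarrow> x \<noteq> 0 \<Longrightarrow> dg x + dg (cj x) \<ge> 0"
  by (metis cj_eq_0_iff dg_kinf dg_mult norm_poly of_nat_0_le_iff)

lemma int_dN: "x \<in> A \<Longrightarrow> x \<noteq> 0 \<Longrightarrow> int (dN x) = dg x + dg (cj x)"
  using dg_norm_nonneg by (simp add: dN_def)

lemma dN_mult: "x \<in> A \<Longrightarrow> y \<in> A \<Longrightarrow> x \<noteq> 0 \<Longrightarrow> y \<noteq> 0 \<Longrightarrow> dN (x * y) = dN x + dN y"
  using int_dN[of x] int_dN[of y] int_dN[of "x * y"] by (simp add: dg_mult cj_mult)

text \<open>The Riemann-Roch space for the divisor with multiplicities \<open>u\<close> and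
  \<open>v\<close> at the two infinite places. With genus \<open>D - 1\<close>, the exponent
  \<open>u + v + 2 - D\<close> of its cardinality is degree plus 1 minus genus.\<close>

definition Bx :: "int \<Rightarrow> int \<Rightarrow> 'a fls set" where
  "Bx u v = {c\<in>A. dle u c \<and> dle v (cj c)}"

lemma Bx_mono: "u \<le> u' \<Longrightarrow> v \<le> v' \<Longrightarrow> Bx u v \<subseteq> Bx u' v'"
  by (auto simp: Bx_def dle_mono)

text \<open>The norm of a nonzero element is a nonzero polynomial, so its two degrees cannot have a
  negative sum. This is what forces small determinants to vanish.\<close>

lemma Bx_trivial: "u + v < 0 \<Longrightarrow> Bx u v = {0}"
  unfolding Bx_def dle_iff using dg_norm_nonneg by fastforce

lemma subgroup_Bx: "add_subgroup (Bx u v)"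
  by (auto simp: add_subgroup_def Bx_def cj_diff dle_diff)

lemma Bx_0 [simp, intro]: "0 \<in> Bx u v" by (simp add: Bx_def)

lemma Bx_A: "c \<in> Bx u v \<Longrightarrow> c \<in> A" by (simp add: Bx_def)

lemma Bx_scale: "c \<in> Bx u v \<Longrightarrow> fls_const t * c \<in> Bx u v"
  by (simp add: Bx_def cj_mult)

lemma Bx_mult: "x \<in> Bx u v \<Longrightarrow> y \<in> Bx u' v' \<Longrightarrow> x * y \<in> Bx (u + u') (v + v')"
  by (auto simp: Bx_def cj_mult dle_mult)

lemma dle_two: "dle u (2 * y) \<longleftrightarrow> dle u (y :: 'a fls)"
  using two_neq_0 by (simp add: dle_def)

lemma dle_sum_diff_iff: "dle u x \<and> dle u y \<longleftrightarrow> dle u (x + y) \<and> dle u (x - y :: 'a fls)"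
proof
  assume "dle u x \<and> dle u y" then show "dle u (x + y) \<and> dle u (x - y)" by (simp add: dle_add dle_diff)
next
  assume *: "dle u (x + y) \<and> dle u (x - y)"
  have "dle u (2 * x)" using dle_add[of u "x + y" "x - y"] * by simp
  moreover have "dle u (2 * y)" using dle_diff[of u "x + y" "x - y"] * by simp
  ultimately show "dle u x \<and> dle u y" by (simp add: dle_two)
qed

lemma dle_times_s: "dle u (y * s) \<longleftrightarrow> dle (u - D) y"
  by (cases "y = 0") (auto simp: dle_iff dg_mult dg_s)

text \<open>As 2 is invertible, bounding both \<open>x + y\<close> and \<open>x - y\<close> by the
  same degree amounts to bounding \<open>x\<close> and \<open>y\<close>. Hence square boxes split
  into independent conditions on the two polynomials and can be counted directly.\<close>

lemma Bx_diag_iff: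
  "kinf_of_poly a + kinf_of_poly b * s \<in> Bx t t \<longleftrightarrow> dle t (kinf_of_poly a) \<and> dle (t - D) (kinf_of_poly b)"
proof -
  let ?x = "kinf_of_poly a" and ?y = "kinf_of_poly b * s"
  have "?x + ?y \<in> Bx t t \<longleftrightarrow> dle t (?x + ?y) \<and> dle t (?x - ?y)"
    unfolding Bx_def by simp
  also have "\<dots> \<longleftrightarrow> dle t ?x \<and> dle t ?y" by (rule dle_sum_diff_iff[symmetric])
  finally show ?thesis by (simp only: dle_times_s)
qed

lemma Bx_diag_image:
  "Bx t t = sigma1 s ` ({p. \<forall>i\<ge>nat (t + 1). Polynomial.coeff p i = 0} \<times>
      {p. \<forall>i\<ge>nat (t - D + 1). Polynomial.coeff p i = 0})" (is "_ = sigma1 s ` (?P \<times> ?Q)")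
proof -
  have *: "sigma1 s (a, b) \<in> Bx t t \<longleftrightarrow> (a, b) \<in> ?P \<times> ?Q" for a b
  proof -
    have "(\<forall>i. int i > u \<longrightarrow> Polynomial.coeff p i = 0) \<longleftrightarrow> (\<forall>i\<ge>nat (u + 1). Polynomial.coeff p i = 0)"
      for u and p :: "'a poly" by (auto simp: nat_le_iff)
    then show ?thesis using Bx_diag_iff[of a b t] by (simp add: sigma1_def dle_kinf)
  qed
  show ?thesis
  proof (rule equalityI; rule subsetI)
    fix c assume c: "c \<in> Bx t t"
    then obtain p where "c = sigma1 s p" by (auto simp: Bx_def A_def)
    then show "c \<in> sigma1 s ` (?P \<times> ?Q)" using c *[of "fst p" "snd p"] by auto
  next
    fix c assume "c \<in> sigma1 s ` (?P \<times> ?Q)"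
    then show "c \<in> Bx t t" using * by auto
  qed
qed

lemma finite_Bx [simp, intro]: "finite (Bx u v)"
proof (rule finite_subset)
  show "Bx u v \<subseteq> Bx (max u v) (max u v)" by (rule Bx_mono) auto
  show "finite (Bx (max u v) (max u v))" unfolding Bx_diag_image
    by (intro finite_imageI finite_cartesian_product finite_poly_coeff_zero_above)
qed

lemma card_Bx_pos: "card (Bx u v) \<ge> 1"
  by (metis Bx_0 One_nat_def Suc_leI card_gt_0_iff empty_iff finite_Bx)

lemma card_Bx_diag: "t \<ge> D - 1 \<Longrightarrow> card (Bx t t) = q ^ nat (2 * t + 2 - D)"
proof -
  assume t: "t \<ge> D - 1"
  have "card (Bx t t) = q ^ nat (t + 1) * q ^ nat (t - D + 1)"
    unfolding Bx_diag_image using inj_sigma1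
    by (subst card_image) (auto simp: card_cartesian_product card_poly_coeff_zero_above q_def intro: inj_on_subset)
  moreover have "nat (t + 1) + nat (t - D + 1) = nat (2 * t + 2 - D)" using t D_ge_1 by linarith
  ultimately show ?thesis by (metis power_add)
qed

lemma additive_nth: "additive_on W (\<lambda>y. y $$ k)"
  by (simp add: additive_on_def)

lemma additive_cj_nth: "W \<subseteq> A \<Longrightarrow> additive_on W (\<lambda>y. cj y $$ k)"
  by (auto simp: additive_on_def cj_diff subset_iff)

text \<open>The smaller box is the common kernel of \<open>k\<close> coefficient functionals of
  \<open>c\<close> and \<open>l\<close> of its conjugate.\<close>

lemma card_Bx_step: "card (Bx (u + int k) (v + int l)) \<le> q ^ (k + l) * card (Bx u v)"
proof -
  let ?G1 = "(\<lambda>i (y::'a fls). y $$ i) ` {- u - int k..<- u}" and ?G2 = "(\<lambda>i y. cj y $$ i) ` {- v - int l..<- v}"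
  have fin: "finite (?G1 \<union> ?G2)" by simp
  have "card (?G1 \<union> ?G2) \<le> card ?G1 + card ?G2" by (rule card_Un_le)
  also have "\<dots> \<le> card {- u - int k..<- u} + card {- v - int l..<- v}"
    by (intro add_mono card_image_le) auto
  finally have card: "card (?G1 \<union> ?G2) \<le> k + l" by simp
  have sub: "{c \<in> Bx (u + int k) (v + int l). \<forall>g\<in>?G1 \<union> ?G2. g c = 0} \<subseteq> Bx u v"
  proof (rule subsetI)
    fix c assume c: "c \<in> {c \<in> Bx (u + int k) (v + int l). \<forall>g\<in>?G1 \<union> ?G2. g c = 0}"
    then have c': "c \<in> Bx (u + int k) (v + int l) \<and> (\<forall>g\<in>?G1 \<union> ?G2. g c = 0)"
      by (rule CollectD)
    then have "c \<in> Bx (u + int k) (v + int l)" by (rule conjunct1)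
    then have B: "c \<in> A" "dle (u + int k) c" "dle (v + int l) (cj c)"
      by (simp_all add: Bx_def)
    note G = conjunct2[OF c']
    have "c $$ n = 0" if "n < - u" for n
    proof (cases "n < - (u + int k)")
      case False
      then have "(\<lambda>y. y $$ n) \<in> ?G1 \<union> ?G2" using that by (intro UnI1 imageI) simp
      from bspec[OF G this] show ?thesis .
    qed (use B(2) in \<open>auto simp: dle_def\<close>)
    moreover have "cj c $$ n = 0" if "n < - v" for n
    proof (cases "n < - (v + int l)")
      case False
      then have "(\<lambda>y. cj y $$ n) \<in> ?G1 \<union> ?G2" using that by (intro UnI2 imageI) simp
      from bspec[OF G this] show ?thesis .
    qed (use B(3) in \<open>auto simp: dle_def\<close>)
    ultimately show "c \<in> Bx u v" using B by (simp add: Bx_def dle_def)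
  qed
  have "card (Bx (u + int k) (v + int l)) \<le> CARD('a) ^ card (?G1 \<union> ?G2) *
      card {c \<in> Bx (u + int k) (v + int l). \<forall>g\<in>?G1 \<union> ?G2. g c = 0}"
    by (rule card_le_kernel[OF finite_Bx subgroup_Bx fin])
       (auto intro!: additive_nth additive_cj_nth simp: Bx_A subset_iff)
  also have "\<dots> \<le> q ^ (k + l) * card (Bx u v)"
    using q_ge_3 card unfolding q_def by (intro mult_mono power_increasing card_mono sub) auto
  finally show ?thesis .
qed

text \<open>Between two diagonal boxes every unit step multiplies the cardinality by at most \<open>q\<close>, and the
  total growth is known, so each step multiplies by exactly \<open>q\<close>.\<close>
lemma card_Bx:
  assumes "u \<ge> D - 1" "v \<ge> D - 1" shows "card (Bx u v) = q ^ nat (u + v + 2 - D)"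
proof -
  define t m where "t = min u v" and "m = max u v"
  have q: "q > 0" using q_ge_3 by simp
  have up: "card (Bx u v) \<le> q ^ nat (u + v + 2 - D)"
  proof -
    have "card (Bx u v) \<le> q ^ (nat (u - t) + nat (v - t)) * card (Bx t t)"
      using card_Bx_step[of t "nat (u - t)" t "nat (v - t)"] by (simp add: t_def)
    also have "card (Bx t t) = q ^ nat (2 * t + 2 - D)"
      using assms by (intro card_Bx_diag) (auto simp: t_def)
    also have "q ^ (nat (u - t) + nat (v - t)) * q ^ nat (2 * t + 2 - D) = q ^ (nat (u - t) + nat (v - t) + nat (2 * t + 2 - D))"
      by (simp add: power_add)
    also have "nat (u - t) + nat (v - t) + nat (2 * t + 2 - D) = nat (u + v + 2 - D)"
      using assms D_ge_1 unfolding t_def by linarith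
    finally show ?thesis .
  qed
  have "q ^ nat (2 * m + 2 - D) = card (Bx m m)"
    using assms by (subst card_Bx_diag) (auto simp: m_def)
  also have "\<dots> \<le> q ^ (nat (m - u) + nat (m - v)) * card (Bx u v)"
    using card_Bx_step[of u "nat (m - u)" v "nat (m - v)"] by (simp add: m_def)
  finally have "q ^ nat (2 * m + 2 - D) \<le> q ^ (nat (m - u) + nat (m - v)) * card (Bx u v)" .
  then have "q ^ (nat (m - u) + nat (m - v)) * q ^ nat (u + v + 2 - D)
     \<le> q ^ (nat (m - u) + nat (m - v)) * card (Bx u v)"
  proof -
    have "nat (m - u) + nat (m - v) + nat (u + v + 2 - D) = nat (2 * m + 2 - D)"
      using assms D_ge_1 unfolding m_def by linarith
    then show ?thesis using \<open>q ^ nat (2 * m + 2 - D) \<le> _\<close> by (metis power_add)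
  qed
  then show ?thesis using up q by simp
qed

end

context real_quadratic
begin

section \<open>Units and unique factorization\<close>

definition unitA :: "'a fls \<Rightarrow> bool" where
  "unitA u \<longleftrightarrow> u \<in> A \<and> u \<noteq> 0 \<and> inverse u \<in> A"

definition dvdA :: "'a fls \<Rightarrow> 'a fls \<Rightarrow> bool" where
  "dvdA b c \<longleftrightarrow> (\<exists>k\<in>A. c = b * k)"

definition assocA :: "'a fls \<Rightarrow> 'a fls \<Rightarrow> bool" where
  "assocA b c \<longleftrightarrow> (\<exists>u. unitA u \<and> c = b * u)"

definition primeA :: "'a fls \<Rightarrow> bool" where
  "primeA p \<longleftrightarrow> p \<in> A \<and> p \<noteq> 0 \<and> \<not> unitA p \<and> (\<forall>a\<in>A. \<forall>b\<in>A. dvdA p (a * b) \<longrightarrow> dvdA p a \<or> dvdA p b)"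

lemma unitA_1 [simp]: "unitA 1" by (simp add: unitA_def)

lemma unitA_mult: "unitA u \<Longrightarrow> unitA v \<Longrightarrow> unitA (u * v)"
  by (simp add: unitA_def)

lemma unitA_inverse: "unitA u \<Longrightarrow> unitA (inverse u)"
  by (simp add: unitA_def)

lemma unitA_factor: "a \<in> A \<Longrightarrow> b \<in> A \<Longrightarrow> a * b = 1 \<Longrightarrow> unitA a"
  by (metis inverse_unique mult_zero_left unitA_def zero_neq_one)

lemma dN_1 [simp]: "dN 1 = 0" by (simp add: dN_def dg_def)

text \<open>Norm degree 0 makes the norm a nonzero constant, so the inverse is a constant multiple
  of the conjugate.\<close>

lemma unitA_iff: "unitA u \<longleftrightarrow> u \<in> A \<and> u \<noteq> 0 \<and> dN u = 0"
proof
  assume u: "unitA u"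
  then have "dN u + dN (inverse u) = dN (u * inverse u)"
    by (intro dN_mult[symmetric]) (auto simp: unitA_def)
  then show "u \<in> A \<and> u \<noteq> 0 \<and> dN u = 0" using u by (simp add: unitA_def)
next
  assume u: "u \<in> A \<and> u \<noteq> 0 \<and> dN u = 0"
  then obtain \<nu> where \<nu>: "u * cj u = kinf_of_poly \<nu>" "\<nu> \<noteq> 0" using norm_poly by blast
  have "dg (u * cj u) = dg u + dg (cj u)" using u by (intro dg_mult) auto
  then have "Polynomial.degree \<nu> = 0" using dg_kinf[OF \<nu>(2)] \<nu>(1) int_dN[of u] u by simp
  then obtain c where c: "\<nu> = [:c:]" by (rule degree_eq_zeroE)
  with \<nu>(2) have "c \<noteq> 0" by auto
  have "fls_const c * fls_const (inverse c) = 1" using \<open>c \<noteq> 0\<close>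
    by (intro fls_eqI) simp
  then have "u * (cj u * fls_const (inverse c)) = 1"
    using \<nu>(1) c by (simp add: kinf_const mult.assoc[symmetric])
  then show "unitA u" using u by (intro unitA_factor) auto
qed

lemma dg_unit: "unitA u \<Longrightarrow> dg (cj u) = - dg u"
  using int_dN[of u] by (simp add: unitA_iff)

lemma assocA_refl [simp]: "assocA a a" by (auto simp: assocA_def intro: exI[of _ 1])

lemma assocA_sym: "assocA a b \<Longrightarrow> assocA b a"
  unfolding assocA_def by (metis (no_types, lifting) mult.assoc mult.right_neutral right_inverse unitA_def unitA_inverse)

lemma assocA_trans: "assocA a b \<Longrightarrow> assocA b c \<Longrightarrow> assocA a c"
  unfolding assocA_def by (metis mult.assoc unitA_mult)

lemma assocA_mult: "assocA a b \<Longrightarrow> assocA c d' \<Longrightarrow> assocA (a * c) (b * d')"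
  unfolding assocA_def by (metis (no_types, opaque_lifting) mult.assoc mult.left_commute unitA_mult)

lemma assocA_in: "assocA a b \<Longrightarrow> a \<in> A \<Longrightarrow> b \<in> A"
  by (auto simp: assocA_def unitA_def)

lemma assocA_nz: "assocA a b \<Longrightarrow> a \<noteq> 0 \<Longrightarrow> b \<noteq> 0"
  by (auto simp: assocA_def unitA_def)

lemma assocA_cancel: "c \<noteq> 0 \<Longrightarrow> assocA (c * a) (c * b) \<Longrightarrow> assocA a b"
  unfolding assocA_def by (metis mult.assoc mult_left_cancel)

lemma assocA_dN: "assocA a b \<Longrightarrow> a \<in> A \<Longrightarrow> a \<noteq> 0 \<Longrightarrow> dN b = dN a"
  by (auto simp: assocA_def dN_mult unitA_iff)

lemma dvdA_assoc: "dvdA p a \<Longrightarrow> assocA a b \<Longrightarrow> dvdA p b"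
  unfolding dvdA_def assocA_def unitA_def by (metis A_mult mult.assoc)

lemma primeA_assoc: 
  assumes "primeA p" "assocA p r" shows "primeA r"
proof -
  obtain u where u: "unitA u" "r = p * u" using assms by (auto simp: assocA_def)
  have dvd: "dvdA r c \<longleftrightarrow> dvdA p c" for c
  proof -
    have "p * k = r * (inverse u * k)" for k using u by (simp add: unitA_def)
    moreover have "r * k = p * (u * k)" for k using u by simp
    ultimately show ?thesis unfolding dvdA_def using u by (metis A_mult unitA_def)
  qed
  have "\<not> unitA r"
  proof
    assume "unitA r"
    then have "unitA (r * inverse u)" using u unitA_mult unitA_inverse by blast
    moreover have "r * inverse u = p" using u by (simp add: unitA_def)
    ultimately show False using assms(1) by (simp add: primeA_def)
  qed
  then show ?thesis using assms(1) u unfolding primeA_def dvd by (auto simp: unitA_def)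
qed

lemma primeA_irreducible:
  assumes "primeA p" "p = a * b" "a \<in> A" "b \<in> A" shows "unitA a \<or> unitA b"
proof -
  have "dvdA p (a * b)" using assms(2) by (auto simp: dvdA_def intro: bexI[of _ 1])
  then consider "dvdA p a" | "dvdA p b" using assms by (auto simp: primeA_def)
  then show ?thesis
  proof cases
    case 1
    then obtain k where k: "k \<in> A" "a = p * k" by (auto simp: dvdA_def)
    have "p * (k * b) = p * 1" using k(2) assms(2) by (metis mult.assoc mult.right_neutral)
    then have "b * k = 1" using assms(1) by (simp add: primeA_def mult.commute)
    then show ?thesis using unitA_factor assms k by blast
  next
    case 2
    then obtain k where k: "k \<in> A" "b = p * k" by (auto simp: dvdA_def)
    have "p * (a * k) = p * 1" using k(2) assms(2) by (metis mult.left_commute mult.right_neutral)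
    then have "a * k = 1" using assms(1) by (simp add: primeA_def)
    then show ?thesis using unitA_factor assms k by blast
  qed
qed

lemma primeA_dvd_prod_mset:
  "primeA p \<Longrightarrow> set_mset N \<subseteq> A \<Longrightarrow> dvdA p (prod_mset N) \<Longrightarrow> \<exists>r\<in>#N. dvdA p r"
proof (induction N)
  case empty
  then show ?case using unitA_factor[of p] by (auto simp: dvdA_def primeA_def)
next
  case (add r N)
  have "prod_mset N \<in> A" using add.prems(2) by (induction N) auto
  then show ?case using add by (auto simp: primeA_def)
qed

section \<open>Transfer of factoriality from \<open>ringA d\<close>\<close>

lemma sigma1_mult: "sigma1 s (x \<otimes>\<^bsub>ringA d\<^esub> y) = sigma1 s x * sigma1 s y"
  by (simp add: ringA_def sigma1_def kinf_add kinf_mult sqrt_d[symmetric] algebra_simps)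

lemma sigma1_eq_iff: "sigma1 s x = sigma1 s y \<longleftrightarrow> x = y"
  using inj_sigma1 by (auto dest: injD)

lemma sigma1_one: "sigma1 s \<one>\<^bsub>ringA d\<^esub> = 1"
  by (simp add: ringA_def sigma1_def)

lemma sigma1_zero: "sigma1 s \<zero>\<^bsub>ringA d\<^esub> = 0"
  by (simp add: ringA_def sigma1_def)

lemma carrier_ringA: "carrier (ringA d) = UNIV"
  by (simp add: ringA_def)

lemma sigma1_A [simp]: "sigma1 s x \<in> A" by (simp add: A_def)

lemma sigma1_divides: "x divides\<^bsub>ringA d\<^esub> y \<longleftrightarrow> dvdA (sigma1 s x) (sigma1 s y)"
proof -
  have "x divides\<^bsub>ringA d\<^esub> y \<longleftrightarrow> (\<exists>k. sigma1 s y = sigma1 s (x \<otimes>\<^bsub>ringA d\<^esub> k))"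
    by (simp add: factor_def carrier_ringA sigma1_eq_iff)
  then show ?thesis unfolding dvdA_def sigma1_mult by (auto simp: A_def)
qed

lemma sigma1_unit: "x \<in> Units (ringA d) \<longleftrightarrow> unitA (sigma1 s x)"
proof -
  have "x \<in> Units (ringA d) \<longleftrightarrow> (\<exists>k. sigma1 s x * sigma1 s k = 1)"
    unfolding Units_def carrier_ringA sigma1_eq_iff[symmetric] sigma1_mult sigma1_one
    by (auto simp: mult.commute)
  also have "\<dots> \<longleftrightarrow> (\<exists>k\<in>A. sigma1 s x * k = 1)" by (auto simp: A_def)
  also have "\<dots> \<longleftrightarrow> unitA (sigma1 s x)"
    using unitA_factor[of "sigma1 s x"]
    by (auto simp: unitA_def intro!: bexI[of _ "inverse (sigma1 s x)"])
  finally show ?thesis .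
qed

lemma primeA_ring_prime: "primeA (sigma1 s x) \<Longrightarrow> ring_prime\<^bsub>ringA d\<^esub> x"
  unfolding ring_prime_def prime_def sigma1_unit sigma1_divides carrier_ringA sigma1_mult primeA_def
  by (auto simp: sigma1_zero simp flip: sigma1_eq_iff)

text \<open>Factoriality of \<open>ringA d\<close> is a property of the monoid
  \<open>mult_of\<close> of its nonzero elements, so irreducibility is translated into that monoid
  and primality back, with products having a zero factor treated apart.\<close>

lemma irreducible_primeA:
  assumes p: "p \<in> A" "p \<noteq> 0" "\<not> unitA p" and irr: "\<And>a b. a \<in> A \<Longrightarrow> b \<in> A \<Longrightarrow> p = a * b \<Longrightarrow> unitA a \<or> unitA b"
  shows "primeA p"
proof -
  let ?R = "ringA d" and ?M = "mult_of (ringA d)"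
  obtain x where x: "p = sigma1 s x" using p by (auto simp: A_def)
  have x0: "x \<noteq> \<zero>\<^bsub>?R\<^esub>" using p x sigma1_zero by auto
  have units: "Units ?M = Units ?R" by (rule R.Units_mult_eq_Units)
  have "irreducible ?M x" unfolding irreducible_def
  proof (intro conjI ballI impI)
    show "x \<notin> Units ?M" using p x sigma1_unit units by simp
    fix y assume y: "y \<in> carrier ?M" "properfactor ?M y x"
    then obtain z where z: "x = y \<otimes>\<^bsub>?R\<^esub> z" "\<not> x divides\<^bsub>?M\<^esub> y"
      by (auto simp: properfactor_def factor_def)
    have "unitA (sigma1 s y) \<or> unitA (sigma1 s z)"
      using irr[of "sigma1 s y" "sigma1 s z"] x z sigma1_mult by simp
    \<comment> \<open>If \<open>z\<close> were a unit, \<open>x\<close> would divide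
      \<open>y\<close>, contradicting that \<open>y\<close> is a proper factor.\<close>
    moreover have "\<not> unitA (sigma1 s z)"
    proof
      assume u: "unitA (sigma1 s z)"
      then obtain w where w: "inverse (sigma1 s z) = sigma1 s w" by (auto simp: unitA_def A_def)
      have "sigma1 s y = sigma1 s (x \<otimes>\<^bsub>?R\<^esub> w)"
        using u by (simp add: z(1) sigma1_mult w[symmetric] unitA_def)
      then have "y = x \<otimes>\<^bsub>?R\<^esub> w" by (simp add: sigma1_eq_iff)
      moreover have "w \<noteq> \<zero>\<^bsub>?R\<^esub>" using w u by (auto simp: sigma1_zero unitA_def)
      ultimately show False using z(2) by (auto simp: factor_def carrier_ringA)
    qed
    ultimately show "y \<in> Units ?M" using sigma1_unit units by simp
  qed
  moreover have "factorial_monoid ?M" using fact by (simp add: factorial_domain_def)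
  ultimately have prime: "prime ?M x"
    using factorial_monoid.irreducible_prime[of ?M x] x0 by (simp add: carrier_ringA)
  have "dvdA p a \<or> dvdA p b" if ab: "a \<in> A" "b \<in> A" "dvdA p (a * b)" for a b
  proof (cases "a = 0 \<or> b = 0")
    case True
    then show ?thesis by (auto simp: dvdA_def intro: bexI[of _ 0])
  next
    case False
    obtain y z where yz: "a = sigma1 s y" "b = sigma1 s z" using ab by (auto simp: A_def)
    have nz: "y \<noteq> \<zero>\<^bsub>?R\<^esub>" "z \<noteq> \<zero>\<^bsub>?R\<^esub>" using False yz sigma1_zero by auto
    have div: "x divides\<^bsub>?M\<^esub> w \<longleftrightarrow> dvdA p (sigma1 s w)" if "w \<noteq> \<zero>\<^bsub>?R\<^esub>" for w
    proof -
      have "x divides\<^bsub>?M\<^esub> w \<longleftrightarrow> x divides\<^bsub>?R\<^esub> w"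
      proof
        assume "x divides\<^bsub>?R\<^esub> w"
        then obtain k where k: "w = x \<otimes>\<^bsub>?R\<^esub> k" by (auto simp: factor_def)
        then have "k \<noteq> \<zero>\<^bsub>?R\<^esub>" using that R.r_null[of x] by (auto simp: carrier_ringA)
        then show "x divides\<^bsub>?M\<^esub> w" using k by (auto simp: factor_def carrier_ringA)
      qed simp
      then show ?thesis by (simp add: sigma1_divides x)
    qed
    have "y \<otimes>\<^bsub>?R\<^esub> z \<noteq> \<zero>\<^bsub>?R\<^esub>"
      using False yz sigma1_mult[of y z] sigma1_zero by auto
    then have "x divides\<^bsub>?M\<^esub> (y \<otimes>\<^bsub>?R\<^esub> z)" using div ab(3) by (simp add: sigma1_mult yz)
    then have "x divides\<^bsub>?M\<^esub> y \<or> x divides\<^bsub>?M\<^esub> z"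
      using prime nz by (simp add: prime_def carrier_ringA)
    then show ?thesis using div nz yz by simp
  qed
  then show ?thesis using p by (simp add: primeA_def)
qed

section \<open>Prime representatives and factorization into multisets\<close>

definition prime_rep :: "'a fls \<Rightarrow> 'a fls" where
  "prime_rep p = (SOME r. assocA p r)"

definition PR :: "'a fls set" where
  "PR = prime_rep ` {p. primeA p}"

lemma prime_rep_assoc: "assocA p (prime_rep p)"
  unfolding prime_rep_def by (rule someI[of _ p]) simp

text \<open>Associated elements have literally the same predicate of associates, so the choice
  operator returns the same element for both.\<close>

lemma prime_rep_eq: "assocA p r \<Longrightarrow> prime_rep p = prime_rep r"
proof -
  assume *: "assocA p r"
  have "assocA p = assocA r" using assocA_trans[OF *] assocA_trans[OF assocA_sym[OF *]] by blast
  then show ?thesis by (simp add: prime_rep_def)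
qed

lemma PR_prime: "p \<in> PR \<Longrightarrow> primeA p"
  unfolding PR_def using prime_rep_assoc primeA_assoc by blast

lemma PR_assoc_eq: "p \<in> PR \<Longrightarrow> r \<in> PR \<Longrightarrow> assocA p r \<Longrightarrow> p = r"
proof -
  assume "p \<in> PR" "r \<in> PR" and *: "assocA p r"
  then obtain p' r' where pr: "p = prime_rep p'" "r = prime_rep r'" by (auto simp: PR_def)
  have "assocA p' r" using prime_rep_assoc[of p'] * assocA_trans unfolding pr(1) by blast
  then have "assocA p' r'" using prime_rep_assoc[of r'] assocA_trans assocA_sym unfolding pr(2) by blast
  then show "p = r" unfolding pr by (rule prime_rep_eq)
qed

lemma PR_A: "p \<in> PR \<Longrightarrow> p \<in> A" and PR_nz: "p \<in> PR \<Longrightarrow> p \<noteq> 0"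
  using PR_prime by (auto simp: primeA_def)

lemma PR_dN: "p \<in> PR \<Longrightarrow> dN p \<ge> 1"
  using PR_prime[of p] unitA_iff[of p] by (auto simp: primeA_def Suc_le_eq)

lemma prod_PR: "set_mset M \<subseteq> PR \<Longrightarrow> prod_mset M \<in> A \<and> prod_mset M \<noteq> 0 \<and> dN (prod_mset M) = mdeg dN M"
  by (induction M) (auto simp: PR_A PR_nz dN_mult)

text \<open>Nonunits have positive norm degree, so in a product of two nonunits both factors have
  smaller \<open>dN\<close>.\<close>

lemma factorization_exists:
  "c \<in> A \<Longrightarrow> c \<noteq> 0 \<Longrightarrow> \<exists>M. set_mset M \<subseteq> PR \<and> assocA c (prod_mset M)"
proof (induction "dN c" arbitrary: c rule: less_induct)
  case less
  show ?case
  proof (cases "unitA c")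
    case True
    then have "assocA c 1" unfolding assocA_def
      by (intro exI[of _ "inverse c"]) (auto simp: unitA_inverse unitA_def)
    then show ?thesis by (intro exI[of _ "{#}"]) simp
  next
    case nu: False
    show ?thesis
    proof (cases "primeA c")
      case True
      then have "prime_rep c \<in> PR" by (simp add: PR_def)
      then show ?thesis using prime_rep_assoc by (intro exI[of _ "{#prime_rep c#}"]) simp
    next
      case False
      then obtain a b where ab: "a \<in> A" "b \<in> A" "c = a * b" "\<not> unitA a" "\<not> unitA b"
        using irreducible_primeA nu less by metis
      have nz: "a \<noteq> 0" "b \<noteq> 0" using ab less by auto
      have "dN c = dN a + dN b" using ab nz by (simp add: dN_mult)
      moreover have "dN a > 0" "dN b > 0" using ab nz unitA_iff by auto
      ultimately obtain M N where "set_mset M \<subseteq> PR" "assocA a (prod_mset M)" "set_mset N \<subseteq> PR" "assocA b (prod_mset N)"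
        using less.hyps[of a] less.hyps[of b] ab nz by auto
      then show ?thesis using ab by (intro exI[of _ "M + N"]) (auto simp: assocA_mult)
    qed
  qed
qed

lemma factorization_unique:
  "set_mset M \<subseteq> PR \<Longrightarrow> set_mset N \<subseteq> PR \<Longrightarrow> assocA (prod_mset M) (prod_mset N) \<Longrightarrow> M = N"
proof (induction M arbitrary: N)
  case empty
  show ?case
  proof (rule ccontr)
    assume "{#} \<noteq> N"
    then obtain p where p: "p \<in># N" by (metis multiset_nonemptyE)
    have "unitA (prod_mset N)" using empty by (auto simp: assocA_def)
    then have "mdeg dN N = 0" using unitA_iff prod_PR empty by auto
    moreover have "mdeg dN N \<ge> dN p" using p by (metis insert_DiffM le_add1 mdeg_add_mset)
    ultimately show False using PR_dN[of p] p empty by auto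
  qed
next
  case (add p M)
  have p: "p \<in> PR" using add by auto
  have "dvdA p (prod_mset (add_mset p M))" using prod_PR[of M] add by (auto simp: dvdA_def)
  then have "dvdA p (prod_mset N)" using add dvdA_assoc by blast
  then obtain r where r: "r \<in># N" "dvdA p r"
    using primeA_dvd_prod_mset[OF PR_prime[OF p]] add.prems PR_A by (metis subset_iff)
  then obtain k where k: "k \<in> A" "r = p * k" by (auto simp: dvdA_def)
  have "r \<in> PR" using r add by auto
  then have "unitA k" using primeA_irreducible[OF PR_prime k(2)] p PR_A k PR_prime
    by (auto simp: primeA_def)
  then have "p = r" using PR_assoc_eq[OF p \<open>r \<in> PR\<close>] k by (auto simp: assocA_def)
  then obtain N' where N': "N = add_mset p N'" using r by (meson multi_member_split)
  have "assocA (prod_mset M) (prod_mset N')" using add.prems N' PR_nz[OF p] by (auto intro: assocA_cancel)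
  then have "M = N'" using add N' by auto
  then show ?case using N' by simp
qed

definition fac :: "'a fls \<Rightarrow> 'a fls multiset" where
  "fac c = (THE M. set_mset M \<subseteq> PR \<and> assocA c (prod_mset M))"

lemma fac_unique:
  assumes "set_mset M \<subseteq> PR" "assocA c (prod_mset M)" shows "fac c = M"
  unfolding fac_def using assms
  by (intro the_equality conjI) (metis assocA_sym assocA_trans factorization_unique)+

lemma fac_props: "c \<in> A \<Longrightarrow> c \<noteq> 0 \<Longrightarrow> set_mset (fac c) \<subseteq> PR \<and> assocA c (prod_mset (fac c))"
  using factorization_exists fac_unique by metis

lemma fac_PR: "c \<in> A \<Longrightarrow> c \<noteq> 0 \<Longrightarrow> set_mset (fac c) \<subseteq> PR"
  using fac_props by blast

lemma fac_mult: "b \<in> A \<Longrightarrow> b \<noteq> 0 \<Longrightarrow> c \<in> A \<Longrightarrow> c \<noteq> 0 \<Longrightarrow> fac (b * c) = fac b + fac c"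
  using fac_props[of b] fac_props[of c] by (intro fac_unique) (auto simp: assocA_mult)

lemma fac_assoc: "assocA b c \<Longrightarrow> b \<in> A \<Longrightarrow> b \<noteq> 0 \<Longrightarrow> fac c = fac b"
  using fac_props[of b] by (intro fac_unique) (auto intro: assocA_trans assocA_sym)

lemma fac_eq_assoc: "b \<in> A \<Longrightarrow> b \<noteq> 0 \<Longrightarrow> c \<in> A \<Longrightarrow> c \<noteq> 0 \<Longrightarrow> fac b = fac c \<Longrightarrow> assocA b c"
  by (metis assocA_sym assocA_trans fac_props)

lemma fac_prod: "set_mset M \<subseteq> PR \<Longrightarrow> fac (prod_mset M) = M"
  by (rule fac_unique) auto

lemma mdeg_fac: "c \<in> A \<Longrightarrow> c \<noteq> 0 \<Longrightarrow> mdeg dN (fac c) = dN c"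
  using fac_props[of c] prod_PR[of "fac c"] assocA_dN by auto

lemma fac_subset_dvd:
  assumes "b \<in> A" "b \<noteq> 0" "c \<in> A" "c \<noteq> 0"
  shows "fac b \<subseteq># fac c \<longleftrightarrow> (\<exists>k\<in>A. c = b * k)"
proof
  assume sub: "fac b \<subseteq># fac c"
  let ?k = "prod_mset (fac c - fac b)"
  have PR: "set_mset (fac c - fac b) \<subseteq> PR" using fac_PR[of c] assms in_diffD by fastforce
  have k: "?k \<in> A" "?k \<noteq> 0" using prod_PR[OF PR] by auto
  have "fac (b * ?k) = fac c" using assms k sub by (simp add: fac_mult fac_prod[OF PR])
  then have "assocA (b * ?k) c" using fac_eq_assoc assms k by simp
  then show "\<exists>k\<in>A. c = b * k" using k by (auto simp: assocA_def unitA_def mult.assoc)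
qed (use assms in \<open>auto simp: fac_mult\<close>)

lemma fac_prime: "p \<in> A \<Longrightarrow> p \<noteq> 0 \<Longrightarrow> fac p = {#r#} \<Longrightarrow> primeA p"
  using fac_props[of p] PR_prime[of r] primeA_assoc[of r p] assocA_sym[of p r] by simp

text \<open>A box of bounded volume contains a nonzero element, so there are infinitely many elements of bounded
  norm; two of them congruent modulo their common norm differ by a unit factor.\<close>
lemma small_norm_elements:
  assumes "t \<ge> D" obtains y where "y \<in> A" "y \<noteq> 0" "dg y \<le> t" "dg (cj y) \<le> D - t"
proof -
  \<comment> \<open>Killing \<open>2 * t - D\<close> coefficients of the conjugate in a box with
    \<open>q ^ (2 * t + 2 - D)\<close> elements leaves at least \<open>q ^ 2\<close> of them, hence
    a nonzero one.\<close>
  let ?G = "(\<lambda>i y. cj y $$ i) ` {- t..<t - D}"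
  have "card ?G \<le> card {- t..<t - D}" by (rule card_image_le) simp
  then have cG: "card ?G \<le> nat (2 * t - D)" by simp
  have "card (Bx t t) \<le> q ^ card ?G * card {c \<in> Bx t t. \<forall>g\<in>?G. g c = 0}" unfolding q_def
    by (rule card_le_kernel[OF finite_Bx subgroup_Bx]) (auto intro!: additive_cj_nth simp: Bx_A subset_iff)
  also have "\<dots> \<le> q ^ nat (2 * t - D) * card {c \<in> Bx t t. \<forall>g\<in>?G. g c = 0}"
    using q_ge_3 cG by (intro mult_right_mono power_increasing) auto
  finally have "q ^ nat (2 * t + 2 - D) \<le> q ^ nat (2 * t - D) * card {c \<in> Bx t t. \<forall>g\<in>?G. g c = 0}"
    using assms by (simp add: card_Bx_diag)
  moreover have "nat (2 * t + 2 - D) = nat (2 * t - D) + 2" using assms D_ge_1 by simp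
  ultimately have "q ^ 2 \<le> card {c \<in> Bx t t. \<forall>g\<in>?G. g c = 0}"
    using q_ge_3 by (simp add: power_add power2_eq_square)
  moreover have "q ^ 2 > 1" using q_ge_3 one_less_power[of q 2] by linarith
  ultimately have big: "card {c \<in> Bx t t. \<forall>g\<in>?G. g c = 0} > 1" by linarith
  have "\<not> {c \<in> Bx t t. \<forall>g\<in>?G. g c = 0} \<subseteq> {0}"
  proof
    assume "{c \<in> Bx t t. \<forall>g\<in>?G. g c = 0} \<subseteq> {0}"
    from card_mono[OF _ this] big show False by simp
  qed
  then obtain y where y: "y \<in> {c \<in> Bx t t. \<forall>g\<in>?G. g c = 0}" "y \<noteq> 0" by blast
  note y' = CollectD[OF y(1)]
  have yB: "y \<in> Bx t t" and yG: "\<forall>g\<in>?G. g y = 0"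
    by (rule conjunct1[OF y']) (rule conjunct2[OF y'])
  have "dle (D - t) (cj y)" unfolding dle_def
  proof (intro allI impI)
    fix n assume n: "n < - (D - t)"
    show "cj y $$ n = 0"
    proof (cases "n < - t")
      case True then show ?thesis using yB by (simp add: Bx_def dle_def)
    next
      case False
      then have "(\<lambda>y. cj y $$ n) \<in> ?G" using n by (intro imageI) simp
      from bspec[OF yG this] show ?thesis .
    qed
  qed
  then show ?thesis using that[of y] y(2) yB by (auto simp: Bx_def dle_iff)
qed

lemma nontrivial_unit: obtains \<eta> where "unitA \<eta>" "dg \<eta> > 0"
proof -
  \<comment> \<open>With spacing \<open>D + 1\<close> the degrees of the \<open>y k\<close> are
    strictly increasing: the conjugate has degree at most \<open>D - T k\<close>, so nonnegativity
    of the norm degree gives \<open>dg (y k) \<ge> T k - D\<close>.\<close>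
  define T where "T = (\<lambda>k::nat. D + int k * (D + 1))"
  have "\<exists>y. y \<in> A \<and> y \<noteq> 0 \<and> dg y \<le> T k \<and> dg (cj y) \<le> D - T k" for k
  proof -
    have "T k \<ge> D" using D_ge_1 by (simp add: T_def)
    then show ?thesis using small_norm_elements[of "T k"] by metis
  qed
  then obtain y where y: "\<And>k. y k \<in> A" "\<And>k. y k \<noteq> 0" "\<And>k. dg (y k) \<le> T k" "\<And>k. dg (cj (y k)) \<le> D - T k"
    by metis
  have "\<exists>\<nu> a b. \<nu> \<noteq> 0 \<and> y k * cj (y k) = kinf_of_poly \<nu> \<and> y k = kinf_of_poly a + kinf_of_poly b * s" for k
    using norm_poly[of "y k"] A_cases[of "y k"] y by metis
  then obtain \<nu> a b where *: "\<And>k. \<nu> k \<noteq> 0" "\<And>k. y k * cj (y k) = kinf_of_poly (\<nu> k)"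
    "\<And>k. y k = kinf_of_poly (a k) + kinf_of_poly (b k) * s" by metis
  have deg: "int (Polynomial.degree (\<nu> k)) \<le> D" for k
    using dg_kinf[OF *(1)[of k]] y(3,4)[of k] dg_mult[of "y k" "cj (y k)"] y(1,2)[of k] by (simp flip: *(2))
  let ?S = "{p :: 'a poly. \<forall>i\<ge>Suc (nat D). Polynomial.coeff p i = 0}"
  \<comment> \<open>All norms have degree at most \<open>D\<close>, so the triple of the norm and
    the two coordinates modulo the norm takes finitely many values; two indices must share
    it.\<close>
  let ?f = "\<lambda>k. (\<nu> k, a k mod \<nu> k, b k mod \<nu> k)"
  have S: "p \<in> ?S" if "Polynomial.degree p \<le> nat D" for p
    using that by (auto intro!: coeff_eq_0)
  have "x mod \<nu> k \<in> ?S" for x k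
  proof (rule S)
    have "x mod \<nu> k = 0 \<or> Polynomial.degree (x mod \<nu> k) < Polynomial.degree (\<nu> k)"
      using degree_mod_less'[of "\<nu> k" x] *(1) by blast
    then show "Polynomial.degree (x mod \<nu> k) \<le> nat D" using deg[of k] by auto
  qed
  moreover have "\<nu> k \<in> ?S" for k using deg[of k] by (intro S) simp
  ultimately have "range ?f \<subseteq> ?S \<times> ?S \<times> ?S" by blast
  then have "finite (range ?f)"
    by (rule finite_subset) (intro finite_cartesian_product finite_poly_coeff_zero_above)
  then have "\<not> inj ?f" using finite_imageD[of ?f UNIV] infinite_UNIV_nat by blast
  then obtain k' l' where kl': "?f k' = ?f l'" "k' \<noteq> l'" unfolding inj_def by blast
  then consider "k' < l'" | "l' < k'" by linarith
  then obtain k l where kl: "?f k = ?f l" "k < l"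
    by cases (use that kl'(1) kl'(1)[symmetric] in blast)+
  then have \<nu>: "\<nu> k = \<nu> l" and "a k mod \<nu> k = a l mod \<nu> l" "b k mod \<nu> k = b l mod \<nu> l" by auto
  then have ab: "a l mod \<nu> l = a k mod \<nu> l" "b l mod \<nu> l = b k mod \<nu> l" by metis+
  from ab obtain a' b' where a'b': "a l - a k = \<nu> l * a'" "b l - b k = \<nu> l * b'"
    unfolding mod_eq_dvd_iff by (meson dvdE)
  define w where "w = kinf_of_poly a' + kinf_of_poly b' * s"
  have w: "w \<in> A" by (simp add: w_def)
  have "y l - y k = kinf_of_poly (a l - a k) + kinf_of_poly (b l - b k) * s"
    by (simp add: *(3) kinf_diff algebra_simps)
  then have diff: "y l - y k = kinf_of_poly (\<nu> l) * w"
    by (simp add: a'b' kinf_mult w_def algebra_simps)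
  \<comment> \<open>The common norm is a multiple of both elements, so congruence modulo it makes
    each of them divide the other.\<close>
  have "y l = y k * (1 + cj (y k) * w)"
    using diff by (simp add: \<nu>[symmetric] *(2)[symmetric] algebra_simps)
  then have 1: "y l / y k = 1 + cj (y k) * w" using y(2)[of k] by simp
  have "y k = y l * (1 - cj (y l) * w)"
    using diff by (simp add: *(2)[symmetric] algebra_simps)
  then have 2: "y k / y l = 1 - cj (y l) * w" using y(2)[of l] by (metis nonzero_mult_div_cancel_left)
  have "y l / y k \<in> A" unfolding 1 using w y by simp
  moreover have "inverse (y l / y k) \<in> A" using w y 2 by simp
  ultimately have unit: "unitA (y l / y k)" using y by (simp add: unitA_def)
  have "dg (y l) \<ge> - dg (cj (y l))" using dg_norm_nonneg[of "y l"] y by simp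
  then have "dg (y l) \<ge> T l - D" using y(4)[of l] by simp
  moreover have "T l \<ge> T k + (D + 1)"
  proof -
    have "int l * (D + 1) \<ge> (int k + 1) * (D + 1)" using kl(2) D_ge_1 by (intro mult_right_mono) auto
    then show ?thesis by (simp add: T_def algebra_simps)
  qed
  ultimately have "dg (y l) > dg (y k)" using y(3)[of k] by simp
  then show ?thesis using that[OF unit] y by (simp add: dg_divide)
qed

text \<open>Multiplying by a unit \<open>u\<close> shifts the imbalance
  \<open>dg x - dg (cj x)\<close> by \<open>2 * dg u\<close>. An associate of least imbalance cannot
  be improved by \<open>\<eta>\<close> or its inverse, so its imbalance is at most
  \<open>2 * dg \<eta>\<close>.\<close>

lemma balanced_associate:
  obtains Cb :: int where "Cb \<ge> 0"
    "\<And>c. c \<in> A \<Longrightarrow> c \<noteq> 0 \<Longrightarrow> \<exists>c'. assocA c c' \<and> \<bar>dg c' - dg (cj c')\<bar> \<le> Cb"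
proof -
  obtain \<eta> where \<eta>: "unitA \<eta>" "dg \<eta> > 0" by (rule nontrivial_unit)
  define Cb where "Cb = 2 * dg \<eta>"
  have "\<exists>c'. assocA c c' \<and> \<bar>dg c' - dg (cj c')\<bar> \<le> Cb" if c: "c \<in> A" "c \<noteq> 0" for c
  proof -
    let ?m = "\<lambda>x. nat \<bar>dg x - dg (cj x)\<bar>"
    obtain x where x: "assocA c x" "\<And>y. assocA c y \<Longrightarrow> ?m x \<le> ?m y"
      using ex_has_least_nat[of "assocA c" c ?m] by auto
    have xA: "x \<in> A" "x \<noteq> 0" using x(1) c assocA_in assocA_nz by auto
    have mul: "\<bar>dg x - dg (cj x)\<bar> \<le> \<bar>dg x - dg (cj x) + 2 * dg u\<bar>" if u: "unitA u" for u
    proof -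
      have "assocA c (x * u)" using x(1) u by (meson assocA_def assocA_trans)
      moreover have "dg (x * u) = dg x + dg u" "dg (cj (x * u)) = dg (cj x) - dg u"
        using xA u by (auto simp: dg_mult cj_mult unitA_def dg_unit)
      ultimately show ?thesis using x(2)[of "x * u"] by (simp add: algebra_simps)
    qed
    have "\<bar>dg x - dg (cj x)\<bar> \<le> Cb"
      using mul[OF \<eta>(1)] mul[OF unitA_inverse[OF \<eta>(1)]] \<eta>(2) unfolding Cb_def dg_inverse by linarith
    then show ?thesis using x(1) by blast
  qed
  moreover have "Cb \<ge> 0" using \<eta>(2) by (simp add: Cb_def)
  ultimately show ?thesis using that by blast
qed

definition Cb :: int where
  "Cb = (SOME C. C \<ge> 0 \<and> (\<forall>c\<in>A. c \<noteq> 0 \<longrightarrow> (\<exists>c'. assocA c c' \<and> \<bar>dg c' - dg (cj c')\<bar> \<le> C)))"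

lemma Cb: "Cb \<ge> 0" "c \<in> A \<Longrightarrow> c \<noteq> 0 \<Longrightarrow> \<exists>c'. assocA c c' \<and> \<bar>dg c' - dg (cj c')\<bar> \<le> Cb"
proof -
  have "\<exists>C. C \<ge> 0 \<and> (\<forall>c\<in>A. c \<noteq> 0 \<longrightarrow> (\<exists>c'. assocA c c' \<and> \<bar>dg c' - dg (cj c')\<bar> \<le> C))"
    using balanced_associate by metis
  from someI_ex[OF this, folded Cb_def] show "Cb \<ge> 0"
    "c \<in> A \<Longrightarrow> c \<noteq> 0 \<Longrightarrow> \<exists>c'. assocA c c' \<and> \<bar>dg c' - dg (cj c')\<bar> \<le> Cb" by auto
qed

text \<open>A balanced generator of the ideal with factorization \<open>M\<close>: both its degrees
  are about half of \<open>mdeg dN M\<close>, so its products with elements of a square box lie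
  again in a square box.\<close>

definition rep :: "'a fls multiset \<Rightarrow> 'a fls" where
  "rep M = (SOME c. c \<in> A \<and> c \<noteq> 0 \<and> fac c = M \<and> \<bar>dg c - dg (cj c)\<bar> \<le> Cb)"

lemma rep:
  assumes "set_mset M \<subseteq> PR"
  shows "rep M \<in> A" "rep M \<noteq> 0" "fac (rep M) = M" "\<bar>dg (rep M) - dg (cj (rep M))\<bar> \<le> Cb"
proof -
  have "\<exists>c. c \<in> A \<and> c \<noteq> 0 \<and> fac c = M \<and> \<bar>dg c - dg (cj c)\<bar> \<le> Cb"
    using Cb(2)[of "prod_mset M"] prod_PR[OF assms] fac_prod[OF assms] fac_assoc assocA_in assocA_nz by metis
  from someI_ex[OF this, folded rep_def] show "rep M \<in> A" "rep M \<noteq> 0" "fac (rep M) = M"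
    "\<bar>dg (rep M) - dg (cj (rep M))\<bar> \<le> Cb" by auto
qed

lemma dN_rep: "set_mset M \<subseteq> PR \<Longrightarrow> dN (rep M) = mdeg dN M"
  using rep mdeg_fac by metis

lemma dg_rep: "set_mset M \<subseteq> PR \<Longrightarrow> dg (rep M) + dg (cj (rep M)) = int (mdeg dN M)"
  using rep int_dN[of "rep M"] by (simp add: dN_rep)

end

section \<open>Diophantine approximation by lattice points\<close>

text \<open>The kernel is returned as a subgroup as well, so that several families of conditions can
  be imposed one after the other.\<close>

lemma card_le_kernel_family:
  fixes W :: "'g::ab_group_add set" and f :: "'i \<Rightarrow> 'g \<Rightarrow> 'b::{ab_group_add,finite}"
  assumes "finite W" "add_subgroup W" "finite I" "\<And>i. additive_on W (f i)"
  shows "card W \<le> CARD('b) ^ card I * card {w\<in>W. \<forall>i\<in>I. f i w = 0}"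
    and "add_subgroup {w\<in>W. \<forall>i\<in>I. f i w = 0}"
proof -
  have "card W \<le> CARD('b) ^ card (f ` I) * card {w\<in>W. \<forall>g\<in>f ` I. g w = 0}"
    by (rule card_le_kernel) (use assms in auto)
  also have "\<dots> \<le> CARD('b) ^ card I * card {w\<in>W. \<forall>g\<in>f ` I. g w = 0}"
    using card_image_le[OF assms(3), of f] card_UNIV_pos[where 'a='b]
    by (intro mult_right_mono power_increasing) (auto simp: Suc_le_eq)
  finally show "card W \<le> CARD('b) ^ card I * card {w\<in>W. \<forall>i\<in>I. f i w = 0}"
    by (simp only: ball_simps)
  have "f i 0 = 0" if "0 \<in> W" for i
    using assms(4)[of i] that unfolding additive_on_def by (metis diff_self)
  then show "add_subgroup {w\<in>W. \<forall>i\<in>I. f i w = 0}"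
    using assms(2,4) unfolding add_subgroup_def additive_on_def by auto
qed

lemma kinf_times_nth:
  "(kinf_of_poly a * z) $$ n = (\<Sum>i\<le>Polynomial.degree a. Polynomial.coeff a i * z $$ (n + int i))"
proof -
  have "(fls_X_inv ^ i * z) $$ n = z $$ (n + int i)" for i n
  proof (induction i arbitrary: n)
    case (Suc i)
    have "(fls_X_inv ^ Suc i * z) $$ n = (fls_X_inv * (fls_X_inv ^ i * z)) $$ n"
      by (simp only: power_Suc mult.assoc)
    also have "\<dots> = (fls_X_inv ^ i * z) $$ (n + 1)" by (subst fls_X_inv_times_conv_shift) simp
    finally show ?case by (simp only: Suc) (simp add: add.assoc)
  qed simp
  then show ?thesis
    unfolding kinf_of_poly_def by (simp add: sum_distrib_right fls_nth_sum mult.assoc)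
qed

lemma kinf_of_k_Fract: "m \<noteq> 0 \<Longrightarrow> kinf_of_k (Fract n m) = kinf_of_poly n / kinf_of_poly m"
  unfolding kinf_of_k_def
proof (rule the_equality)
  fix y assume m: "m \<noteq> 0" and "\<exists>n' m'. m' \<noteq> 0 \<and> Fract n m = Fract n' m' \<and> y = kinf_of_poly n' / kinf_of_poly m'"
  then obtain n' m' where *: "m' \<noteq> 0" "Fract n m = Fract n' m'" "y = kinf_of_poly n' / kinf_of_poly m'"
    by blast
  then have "n * m' = n' * m" using m by (simp add: eq_fract)
  then have "kinf_of_poly n * kinf_of_poly m' = kinf_of_poly n' * kinf_of_poly m"
    by (simp flip: kinf_mult)
  then show "y = kinf_of_poly n / kinf_of_poly m" using * m by (simp add: frac_eq_eq)
qed blast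

locale approximation = real_quadratic d s for d :: "'a::{field,finite} poly" and s +
  fixes x1 x2 :: "'a fls"
  assumes irrational: "(x1, x2) \<notin> sigmaK s"
begin

text \<open>The functional \<open>ell\<close> is the residue of \<open>c \<mapsto> tr(c x / s)\<close>; it pairs boxes with their dual boxes.\<close>

definition zdiff :: "'a fls \<Rightarrow> 'a fls" where "zdiff l = (l * x1 - cj l * x2) / s"
text \<open>If the pair \<open>l * x1\<close>, \<open>cj l * x2\<close> is close to the two
  embeddings of \<open>a + b * s\<close>, then \<open>zsum l\<close> is close to
  \<open>2 * a\<close> and \<open>zdiff l\<close> to \<open>2 * b\<close>. Approximation in the
  quadratic ring thus becomes approximation of two series by polynomials.\<close>

definition zsum :: "'a fls \<Rightarrow> 'a fls" where "zsum l = l * x1 + cj l * x2"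
definition ell :: "'a fls \<Rightarrow> 'a" where "ell l = zdiff l $$ 1"

text \<open>Defining closeness as an annihilator makes sums of \<open>delta_dev\<close> over boxes
  detect it exactly; \<open>near_approx\<close> recovers the approximating element.\<close>

definition near :: "int \<Rightarrow> 'a fls set" where
  "near t = {l\<in>A. \<forall>c\<in>Bx t t. ell (c * l) = 0}"

lemma zdiff_diff: "l \<in> A \<Longrightarrow> l' \<in> A \<Longrightarrow> zdiff (l - l') = zdiff l - zdiff l'"
  by (simp add: zdiff_def cj_diff algebra_simps flip: diff_divide_distrib)

lemma zsum_diff: "l \<in> A \<Longrightarrow> l' \<in> A \<Longrightarrow> zsum (l - l') = zsum l - zsum l'"
  by (simp add: zsum_def cj_diff algebra_simps)

lemma ell_diff: "l \<in> A \<Longrightarrow> l' \<in> A \<Longrightarrow> ell (l - l') = ell l - ell l'"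
  by (simp add: ell_def zdiff_diff)

lemma ell_scale: "l \<in> A \<Longrightarrow> ell (fls_const t * l) = t * ell l"
proof -
  assume l: "l \<in> A"
  have "zdiff (fls_const t * l) = fls_const t * zdiff l"
    using l by (simp add: zdiff_def cj_mult right_diff_distrib mult.assoc)
  then show ?thesis by (simp add: ell_def)
qed

lemma additive_ell: "W \<subseteq> A \<Longrightarrow> l \<in> A \<Longrightarrow> additive_on W (\<lambda>c. ell (c * l))"
  by (auto simp: additive_on_def left_diff_distrib ell_diff subset_iff)

text \<open>Multiplication by \<open>kinf_of_poly b * s\<close> exchanges the roles of
  \<open>zdiff\<close> and \<open>zsum\<close>, since conjugation changes the sign of
  \<open>s\<close>.\<close>

lemma ell_expand:
  assumes "l \<in> A"
  shows "ell ((kinf_of_poly a + kinf_of_poly b * s) * l) =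
    (\<Sum>i\<le>Polynomial.degree a. Polynomial.coeff a i * zdiff l $$ (1 + int i)) +
    (\<Sum>i\<le>Polynomial.degree b. Polynomial.coeff b i * zsum l $$ (1 + int i))"
proof -
  have "zdiff ((kinf_of_poly a + kinf_of_poly b * s) * l) = kinf_of_poly a * zdiff l + kinf_of_poly b * zsum l"
  proof -
    have "cj ((kinf_of_poly a + kinf_of_poly b * s) * l) = (kinf_of_poly a - kinf_of_poly b * s) * cj l"
      using assms by (simp only: cj_mult A_I cj_I)
    then have "zdiff ((kinf_of_poly a + kinf_of_poly b * s) * l) =
      ((kinf_of_poly a + kinf_of_poly b * s) * l * x1 - (kinf_of_poly a - kinf_of_poly b * s) * cj l * x2) / s"
      by (simp only: zdiff_def)
    then show ?thesis by (simp add: zdiff_def zsum_def field_simps)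
  qed
  then show ?thesis by (simp add: ell_def kinf_times_nth)
qed

text \<open>The box \<open>Bx t t\<close> is spanned by the powers of T up to \<open>t\<close> and
  \<open>s\<close> times those up to \<open>t - D\<close>; against these \<open>ell\<close> reads
  off single coefficients of \<open>zdiff l\<close> and \<open>zsum l\<close>. Coefficient 1 is the
  residue, whence the shift by one.\<close>

lemma near_iff:
  "l \<in> near t \<longleftrightarrow> l \<in> A \<and> (\<forall>n. 1 \<le> n \<and> n \<le> t + 1 \<longrightarrow> zdiff l $$ n = 0) \<and>
     (\<forall>n. 1 \<le> n \<and> n \<le> t - D + 1 \<longrightarrow> zsum l $$ n = 0)"
proof
  assume "l \<in> near t"
  then have l: "l \<in> A" and van: "\<And>c. c \<in> Bx t t \<Longrightarrow> ell (c * l) = 0" by (auto simp: near_def)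
  have mon: "dle u (kinf_of_poly (Polynomial.monom 1 i :: 'a poly)) \<longleftrightarrow> int i \<le> u" for u i
    by (auto simp: dle_kinf coeff_monom)
  have "zdiff l $$ n = 0" if "1 \<le> n" "n \<le> t + 1" for n
  proof -
    define i where "i = nat (n - 1)"
    have n: "n = 1 + int i" using that by (simp add: i_def)
    have "kinf_of_poly (Polynomial.monom 1 i) + kinf_of_poly 0 * s \<in> Bx t t"
      using that unfolding Bx_diag_iff by (simp add: mon i_def)
    from van[OF this] show ?thesis unfolding ell_expand[OF l] n
      by (simp add: Polynomial.degree_monom_eq coeff_monom if_distrib[of "\<lambda>x. x * _"] cong: if_cong)
  qed
  moreover have "zsum l $$ n = 0" if "1 \<le> n" "n \<le> t - D + 1" for n
  proof -
    define i where "i = nat (n - 1)"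
    have n: "n = 1 + int i" using that by (simp add: i_def)
    have "kinf_of_poly 0 + kinf_of_poly (Polynomial.monom 1 i) * s \<in> Bx t t"
      using that unfolding Bx_diag_iff by (simp add: mon i_def)
    from van[OF this] show ?thesis unfolding ell_expand[OF l] n
      by (simp add: Polynomial.degree_monom_eq coeff_monom if_distrib[of "\<lambda>x. x * _"] cong: if_cong)
  qed
  ultimately show "l \<in> A \<and> (\<forall>n. 1 \<le> n \<and> n \<le> t + 1 \<longrightarrow> zdiff l $$ n = 0) \<and>
     (\<forall>n. 1 \<le> n \<and> n \<le> t - D + 1 \<longrightarrow> zsum l $$ n = 0)" using l by blast
next
  assume *: "l \<in> A \<and> (\<forall>n. 1 \<le> n \<and> n \<le> t + 1 \<longrightarrow> zdiff l $$ n = 0) \<and>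
     (\<forall>n. 1 \<le> n \<and> n \<le> t - D + 1 \<longrightarrow> zsum l $$ n = 0)"
  have "ell (c * l) = 0" if c: "c \<in> Bx t t" for c
  proof -
    obtain a b where ab: "c = kinf_of_poly a + kinf_of_poly b * s" using A_cases Bx_A[OF c] by metis
    with c have ab': "\<forall>i. int i > t \<longrightarrow> Polynomial.coeff a i = 0" "\<forall>i. int i > t - D \<longrightarrow> Polynomial.coeff b i = 0"
      using Bx_diag_iff[of a b t] by (auto simp: dle_kinf)
    have "Polynomial.coeff a i * zdiff l $$ (1 + int i) = 0" for i
      using * ab'(1) by (cases "int i > t") auto
    then have 1: "(\<Sum>i\<le>Polynomial.degree a. Polynomial.coeff a i * zdiff l $$ (1 + int i)) = 0"
      by (intro sum.neutral ballI)
    have "Polynomial.coeff b i * zsum l $$ (1 + int i) = 0" for i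
      using * ab'(2) by (cases "int i > t - D") auto
    then have 2: "(\<Sum>i\<le>Polynomial.degree b. Polynomial.coeff b i * zsum l $$ (1 + int i)) = 0"
      by (intro sum.neutral ballI)
    show ?thesis unfolding ab ell_expand[OF conjunct1[OF *]] 1 2 by simp
  qed
  then show "l \<in> near t" using * by (simp add: near_def)
qed

lemma near_A: "l \<in> near t \<Longrightarrow> l \<in> A" by (simp add: near_def)

lemma near_mono: "t \<le> t' \<Longrightarrow> near t' \<subseteq> near t"
  using Bx_mono[of t t' t t'] by (auto simp: near_def)

lemma subgroup_near: "add_subgroup (near t)"
  unfolding add_subgroup_def
proof (intro conjI ballI)
  show "0 \<in> near t" by (simp add: near_iff zdiff_def zsum_def)
  fix l l' assume "l \<in> near t" "l' \<in> near t"
  then show "l - l' \<in> near t" unfolding near_iff by (simp add: zdiff_diff zsum_diff)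
qed

text \<open>The polynomial parts of \<open>zsum l\<close> and \<open>zdiff l\<close> are halved to
  get the coordinates of \<open>p\<close>. The error of \<open>zdiff l\<close> is at most
  \<open>- 2 - t\<close>, and multiplication by \<open>s\<close> adds \<open>D\<close>.\<close>

lemma near_approx:
  assumes l: "l \<in> near t" and t: "t \<ge> D - 1"
  obtains p where "p \<in> A" "dle (D - 2 - t) (l * x1 - p)" "dle (D - 2 - t) (cj l * x2 - cj p)"
proof -
  have half: "2 * kinf_of_poly (Polynomial.smult (inverse 2) p) = kinf_of_poly p" for p :: "'a poly"
    using two_neq_0 by (intro fls_eqI) (simp add: kinf_nth)
  obtain b where b: "\<forall>n\<le>0. (zdiff l - kinf_of_poly b) $$ n = 0" by (rule kinf_polypart)
  obtain a where a: "\<forall>n\<le>0. (zsum l - kinf_of_poly a) $$ n = 0" by (rule kinf_polypart)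
  have b': "dle (- 2 - t) (zdiff l - kinf_of_poly b)" unfolding dle_def
  proof (intro allI impI)
    fix n assume n: "n < - (- 2 - t)"
    show "(zdiff l - kinf_of_poly b) $$ n = 0"
      using l n b by (cases "n \<le> 0") (auto simp: near_iff kinf_nth)
  qed
  have a': "dle (D - 2 - t) (zsum l - kinf_of_poly a)" unfolding dle_def
  proof (intro allI impI)
    fix n assume n: "n < - (D - 2 - t)"
    show "(zsum l - kinf_of_poly a) $$ n = 0"
      using l n a by (cases "n \<le> 0") (auto simp: near_iff kinf_nth)
  qed
  let ?a = "kinf_of_poly (Polynomial.smult (inverse 2) a)" and ?b = "kinf_of_poly (Polynomial.smult (inverse 2) b)"
  let ?e1 = "l * x1 - (?a + ?b * s)" and ?e2 = "cj l * x2 - (?a - ?b * s)"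
  have "?e1 + ?e2 = zsum l - 2 * ?a" by (simp add: zsum_def)
  then have 1: "dle (D - 2 - t) (?e1 + ?e2)" using a' by (simp only: half)
  have "zdiff l * s = l * x1 - cj l * x2" by (simp add: zdiff_def)
  then have "?e1 - ?e2 = (zdiff l - 2 * ?b) * s" by (simp add: left_diff_distrib algebra_simps)
  then have "?e1 - ?e2 = (zdiff l - kinf_of_poly b) * s" by (simp only: half)
  then have 2: "dle (D - 2 - t) (?e1 - ?e2)" using b' by (simp only: dle_times_s) simp
  from 1 2 have "dle (D - 2 - t) ?e1 \<and> dle (D - 2 - t) ?e2" by (simp only: dle_sum_diff_iff[of _ ?e1 ?e2])
  then show ?thesis using that[of "?a + ?b * s"] by simp
qed

section \<open>Short lattice vectors and good scales\<close>

definition short :: "int \<Rightarrow> int \<Rightarrow> 'a fls \<Rightarrow> 'a fls \<Rightarrow> bool" where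
  "short C Q c p \<longleftrightarrow> c \<in> Bx (Q - C) (Q - C) \<and> c \<noteq> 0 \<and> p \<in> A \<and>
     dle (- Q - C) (c * x1 - p) \<and> dle (- Q - C) (cj c * x2 - cj p)"

text \<open>Extending both fractions by the conjugate of the denominator gives the common
  denominator \<open>c * cj c\<close>, a polynomial, and hence an element of
  \<open>sigmaK s\<close>.\<close>

lemma not_both_rational:
  assumes "c \<in> A" "c \<noteq> 0" "p \<in> A" "x1 = p / c" shows "x2 \<noteq> cj p / cj c"
proof
  assume x2: "x2 = cj p / cj c"
  obtain \<nu> where \<nu>: "c * cj c = kinf_of_poly \<nu>" "\<nu> \<noteq> 0" using norm_poly assms by blast
  have "p * cj c \<in> A" using assms by simp
  then obtain a b where ab: "p * cj c = kinf_of_poly a + kinf_of_poly b * s"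
    "cj (p * cj c) = kinf_of_poly a - kinf_of_poly b * s" by (metis A_cases)
  have ab2: "cj p * c = kinf_of_poly a - kinf_of_poly b * s"
    using ab(2) assms by (simp add: cj_mult cj_cj)
  have "x1 = (p * cj c) / (c * cj c)" "x2 = (cj p * c) / (c * cj c)"
    using assms x2 by simp_all
  then have "x1 = kinf_of_k (Fract a \<nu>) + kinf_of_k (Fract b \<nu>) * s"
    "x2 = kinf_of_k (Fract a \<nu>) - kinf_of_k (Fract b \<nu>) * s"
    using \<nu> unfolding ab(1) ab2 by (simp_all add: kinf_of_k_Fract add_divide_distrib diff_divide_distrib)
  then have "(x1, x2) \<in> sigmaK s" unfolding sigmaK_def by blast
  then show False using irrational by blast
qed

text \<open>The fraction representing \<open>x1\<close> has a unique conjugate, so its distance to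
  \<open>x2\<close> is one fixed number. A short vector exact in the first coordinate would force
  that degree to be at most \<open>- 2 * C\<close>, which a large \<open>C\<close> rules
  out.\<close>

lemma rational_gap1:
  "\<exists>C::int. \<forall>c p. c \<in> A \<and> c \<noteq> 0 \<and> p \<in> A \<and> x1 = p / c \<longrightarrow> 2 * C + dg (x2 - cj p / cj c) > 0"
proof (cases "\<exists>c p. c \<in> A \<and> c \<noteq> 0 \<and> p \<in> A \<and> x1 = p / c")
  case True
  then obtain c p where *: "c \<in> A" "c \<noteq> 0" "p \<in> A" "x1 = p / c" by blast
  have "cj p' / cj c' = cj p / cj c" if "c' \<in> A" "c' \<noteq> 0" "p' \<in> A" "x1 = p' / c'" for c' p'
  proof -
    have "p' * c = p * c'" using * that by (simp add: frac_eq_eq)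
    then have "cj p' * cj c = cj p * cj c'" using * that by (metis cj_mult)
    then show ?thesis using * that by (simp add: frac_eq_eq)
  qed
  note uniq = this
  have abs_pos: "0 < 2 * (\<bar>y\<bar> + 1) + y" for y :: int by (simp add: abs_if)
  show ?thesis
  proof (intro exI[of _ "\<bar>dg (x2 - cj p / cj c)\<bar> + 1"] allI impI, elim conjE)
    fix c' p' assume "c' \<in> A" "c' \<noteq> 0" "p' \<in> A" "x1 = p' / c'"
    from uniq[OF this] show "2 * (\<bar>dg (x2 - cj p / cj c)\<bar> + 1) + dg (x2 - cj p' / cj c') > 0"
      by (simp only: abs_pos)
  qed
qed auto

lemma rational_gap2:
  "\<exists>C::int. \<forall>c p. c \<in> A \<and> c \<noteq> 0 \<and> p \<in> A \<and> x2 = cj p / cj c \<longrightarrow> 2 * C + dg (x1 - p / c) > 0"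
proof (cases "\<exists>c p. c \<in> A \<and> c \<noteq> 0 \<and> p \<in> A \<and> x2 = cj p / cj c")
  case True
  then obtain c p where *: "c \<in> A" "c \<noteq> 0" "p \<in> A" "x2 = cj p / cj c" by blast
  have "p' / c' = p / c" if "c' \<in> A" "c' \<noteq> 0" "p' \<in> A" "x2 = cj p' / cj c'" for c' p'
  proof -
    have "cj p' * cj c = cj p * cj c'" using * that by (simp add: frac_eq_eq)
    then have "cj (cj p' * cj c) = cj (cj p * cj c')" by simp
    then have "p' * c = p * c'" using * that by (simp add: cj_mult cj_cj)
    then show ?thesis using * that by (simp add: frac_eq_eq)
  qed
  note uniq = this
  have abs_pos: "0 < 2 * (\<bar>y\<bar> + 1) + y" for y :: int by (simp add: abs_if)
  show ?thesis
  proof (intro exI[of _ "\<bar>dg (x1 - p / c)\<bar> + 1"] allI impI, elim conjE)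
    fix c' p' assume "c' \<in> A" "c' \<noteq> 0" "p' \<in> A" "x2 = cj p' / cj c'"
    from uniq[OF this] show "2 * (\<bar>dg (x1 - p / c)\<bar> + 1) + dg (x1 - p' / c') > 0"
      by (simp only: abs_pos)
  qed
qed auto

text \<open>Short vectors at consecutive scales are proportional since their determinant has norm below 1. So
  if all large scales had short vectors, these would lie on one line, which forces
  \<open>x1\<close> or \<open>x2\<close> to be the image of an element of \<open>K\<close>; the choice of \<open>C\<close> excludes this.\<close>
lemma no_short_vectors:
  "\<exists>C\<ge>1. \<forall>Q0. \<exists>Q\<ge>Q0. \<forall>c p. \<not> short C Q c p"
proof -
  obtain C1 where C1: "\<forall>c p. c \<in> A \<and> c \<noteq> 0 \<and> p \<in> A \<and> x1 = p / c \<longrightarrow> 2 * C1 + dg (x2 - cj p / cj c) > 0"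
    using rational_gap1 by blast
  obtain C2 where C2: "\<forall>c p. c \<in> A \<and> c \<noteq> 0 \<and> p \<in> A \<and> x2 = cj p / cj c \<longrightarrow> 2 * C2 + dg (x1 - p / c) > 0"
    using rational_gap2 by blast
  define C where "C = max 1 (max C1 C2)"
  have C: "C \<ge> 1" "C \<ge> C1" "C \<ge> C2" by (auto simp: C_def)
  have "\<exists>Q\<ge>Q0. \<forall>c p. \<not> short C Q c p" for Q0
  proof (rule ccontr)
    assume "\<not> ?thesis"
    then have "\<forall>Q. \<exists>c p. Q \<ge> Q0 \<longrightarrow> short C Q c p" by blast
    then obtain c p where sh: "\<And>Q. Q \<ge> Q0 \<Longrightarrow> short C Q (c Q) (p Q)" by metis
    have A: "c Q \<in> A" "c Q \<noteq> 0" "p Q \<in> A" if "Q \<ge> Q0" for Q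
      using sh[OF that] by (auto simp: short_def Bx_A)
    have cons: "p (Q + 1) * c Q = p Q * c (Q + 1)" if Q: "Q \<ge> Q0" for Q
    proof -
      let ?\<Delta> = "c Q * p (Q + 1) - c (Q + 1) * p Q"
      note s1 = sh[OF Q, unfolded short_def Bx_def] 
      have Q1: "Q + 1 \<ge> Q0" using Q by simp
      note s2 = sh[OF Q1, unfolded short_def Bx_def]
      have in_A: "?\<Delta> \<in> A" using A[of Q] A[of "Q + 1"] Q by simp
      have e1: "?\<Delta> = c (Q + 1) * (c Q * x1 - p Q) - c Q * (c (Q + 1) * x1 - p (Q + 1))"
        by (simp add: algebra_simps)
      have e2: "cj ?\<Delta> = cj (c (Q + 1)) * (cj (c Q) * x2 - cj (p Q)) - cj (c Q) * (cj (c (Q + 1)) * x2 - cj (p (Q + 1)))"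
        using A[of Q] A[of "Q + 1"] Q by (simp add: cj_diff cj_mult algebra_simps)
      have "dle ((Q + 1 - C) + (- Q - C)) (c (Q + 1) * (c Q * x1 - p Q))"
        "dle ((Q - C) + (- (Q + 1) - C)) (c Q * (c (Q + 1) * x1 - p (Q + 1)))"
        "dle ((Q + 1 - C) + (- Q - C)) (cj (c (Q + 1)) * (cj (c Q) * x2 - cj (p Q)))"
        "dle ((Q - C) + (- (Q + 1) - C)) (cj (c Q) * (cj (c (Q + 1)) * x2 - cj (p (Q + 1))))"
        by (rule dle_mult; use s1 s2 in simp)+
      then have d: "dle (1 - 2 * C) (c (Q + 1) * (c Q * x1 - p Q))"
        "dle (1 - 2 * C) (c Q * (c (Q + 1) * x1 - p (Q + 1)))"
        "dle (1 - 2 * C) (cj (c (Q + 1)) * (cj (c Q) * x2 - cj (p Q)))"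
        "dle (1 - 2 * C) (cj (c Q) * (cj (c (Q + 1)) * x2 - cj (p (Q + 1))))"
        by (auto elim!: dle_mono)
      have "dle (1 - 2 * C) ?\<Delta>" unfolding e1 by (rule dle_diff[OF d(1,2)])
      moreover have "dle (1 - 2 * C) (cj ?\<Delta>)" unfolding e2 by (rule dle_diff[OF d(3,4)])
      ultimately
      have "?\<Delta> \<in> Bx (1 - 2 * C) (1 - 2 * C)" using in_A by (simp add: Bx_def)
      then have "?\<Delta> = 0" using Bx_trivial[of "1 - 2 * C" "1 - 2 * C"] C by simp
      then show ?thesis by (simp add: mult.commute)
    qed
    have ratio1: "p Q / c Q = p Q0 / c Q0" if "Q \<ge> Q0" for Q
      using that
    proof (induction Q rule: int_ge_induct)
      case (step Q)
      have "p (Q + 1) / c (Q + 1) = p Q / c Q"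
        using cons[OF step(1)] A[of Q] A[of "Q + 1"] step(1)
        by (simp add: frac_eq_eq)
      with step show ?case by simp
    qed simp
    have ratio2: "cj (p Q) / cj (c Q) = cj (p Q0) / cj (c Q0)" if "Q \<ge> Q0" for Q
    proof -
      have "p Q * c Q0 = p Q0 * c Q" using ratio1[OF that] A[OF that] A[of Q0] by (simp add: frac_eq_eq)
      then have "cj (p Q) * cj (c Q0) = cj (p Q0) * cj (c Q)" using A[OF that] A[of Q0] by (metis cj_mult order_refl)
      then show ?thesis using A[OF that] A[of Q0] by (simp add: frac_eq_eq)
    qed
    define \<theta>1 \<theta>2 where "\<theta>1 = x1 - p Q0 / c Q0" and "\<theta>2 = x2 - cj (p Q0) / cj (c Q0)"
    have B: "dle (Q - C) (c Q)" "dle (Q - C) (cj (c Q))" "dle (- Q - C) (c Q * \<theta>1)" "dle (- Q - C) (cj (c Q) * \<theta>2)"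
      "dg (c Q) + dg (cj (c Q)) \<ge> 0" if Q: "Q \<ge> Q0" for Q
    proof -
      have "c Q * \<theta>1 = c Q * x1 - p Q" "cj (c Q) * \<theta>2 = cj (c Q) * x2 - cj (p Q)"
        unfolding \<theta>1_def \<theta>2_def using A[OF Q] by (simp_all add: ratio1[OF Q, symmetric] ratio2[OF Q, symmetric] algebra_simps)
      then show "dle (Q - C) (c Q)" "dle (Q - C) (cj (c Q))" "dle (- Q - C) (c Q * \<theta>1)" "dle (- Q - C) (cj (c Q) * \<theta>2)"
        using sh[OF Q] by (simp_all add: short_def Bx_def)
      show "dg (c Q) + dg (cj (c Q)) \<ge> 0" using A[OF Q] dg_norm_nonneg by blast
    qed
    note B' = B[unfolded dle_iff]
    have cjnz: "cj (c Q) \<noteq> 0" if "Q \<ge> Q0" for Q using A[OF that] by simp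
    \<comment> \<open>The first case makes both coordinates rational. In the two mixed cases the
      norm of \<open>c Q0\<close> meets the gap excluded by \<open>C1\<close> or \<open>C2\<close>.
      In the last one a single large scale suffices.\<close>
    consider "\<theta>1 = 0" "\<theta>2 = 0" | "\<theta>1 = 0" "\<theta>2 \<noteq> 0" | "\<theta>1 \<noteq> 0" "\<theta>2 = 0" | "\<theta>1 \<noteq> 0" "\<theta>2 \<noteq> 0" by blast
    then show False
    proof cases
      case 1
      then show False using not_both_rational[of "c Q0" "p Q0"] A[of Q0] by (simp add: \<theta>1_def \<theta>2_def)
    next
      case 2
      have "2 * C1 + dg \<theta>2 > 0" using C1 A[of Q0] 2 by (simp add: \<theta>1_def \<theta>2_def)
      moreover have "dg (cj (c Q0)) + dg \<theta>2 \<le> - Q0 - C" "dg (c Q0) \<le> Q0 - C"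
        using B'[of Q0] A[of Q0] cjnz[of Q0] 2 by (auto simp: dg_mult)
      ultimately show False using B(5)[of Q0] C by linarith
    next
      case 3
      have "2 * C2 + dg \<theta>1 > 0" using C2 A[of Q0] 3 by (simp add: \<theta>1_def \<theta>2_def)
      moreover have "dg (c Q0) + dg \<theta>1 \<le> - Q0 - C" "dg (cj (c Q0)) \<le> Q0 - C"
        using B'[of Q0] A[of Q0] cjnz[of Q0] 3 by (auto simp: dg_mult)
      ultimately show False using B(5)[of Q0] C by linarith
    next
      case 4
      \<comment> \<open>Adding the two error bounds gives norm degree plus
        \<open>dg \<theta>1 + dg \<theta>2\<close> at most \<open>- 2 * Q - 2 * C\<close>,
        impossible once \<open>Q\<close> exceeds the fixed degrees of the errors.\<close>
      define Q where "Q = max Q0 (\<bar>dg \<theta>1\<bar> + \<bar>dg \<theta>2\<bar>)"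
      have Q: "Q \<ge> Q0" "Q \<ge> \<bar>dg \<theta>1\<bar> + \<bar>dg \<theta>2\<bar>" by (simp_all add: Q_def)
      have "dg (cj (c Q)) + dg \<theta>2 \<le> - Q - C" "dg (c Q) + dg \<theta>1 \<le> - Q - C"
        using B'[OF Q(1)] A[OF Q(1)] cjnz[OF Q(1)] 4 by (auto simp: dg_mult)
      then show False using B(5)[OF Q(1)] C Q by linarith
    qed
  qed
  then show ?thesis using C(1) by blast
qed

definition good_scale :: "int \<Rightarrow> int \<Rightarrow> bool" where
  "good_scale C Q \<longleftrightarrow> Bx (Q - C) (Q - C) \<inter> near (Q + C) \<subseteq> {0}"

lemma good_scales: "\<exists>C\<ge>1. \<forall>Q0. \<exists>Q\<ge>Q0. good_scale C Q"
proof -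
  obtain C where C: "C \<ge> 1" "\<forall>Q0. \<exists>Q\<ge>Q0. \<forall>c p. \<not> short C Q c p" using no_short_vectors by blast
  \<comment> \<open>Passing from \<open>near\<close> to an actual approximation loses
    \<open>D\<close>, so the constant grows by \<open>D\<close>.\<close>
  have "\<exists>Q\<ge>Q0. good_scale (C + D) Q" for Q0
  proof -
    obtain Q where Q: "Q \<ge> max Q0 0" "\<forall>c p. \<not> short C Q c p" using C(2) by blast
    have "l = 0" if l: "l \<in> Bx (Q - (C + D)) (Q - (C + D))" "l \<in> near (Q + (C + D))" for l
    proof (rule ccontr)
      assume "l \<noteq> 0"
      obtain p where p: "p \<in> A" "dle (D - 2 - (Q + (C + D))) (l * x1 - p)" "dle (D - 2 - (Q + (C + D))) (cj l * x2 - cj p)"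
        using near_approx[OF l(2)] Q C(1) by auto
      have "l \<in> Bx (Q - C) (Q - C)"
        using l(1) Bx_mono[of "Q - (C + D)" "Q - C" "Q - (C + D)" "Q - C"] D_ge_1 by auto
      then have "short C Q l p" using p \<open>l \<noteq> 0\<close> unfolding short_def by (auto elim!: dle_mono)
      then show False using Q by blast
    qed
    then have "good_scale (C + D) Q" unfolding good_scale_def by blast
    then show ?thesis using Q(1) by (intro exI[of _ Q]) simp
  qed
  then show ?thesis using C(1) D_ge_1 by (intro exI[of _ "C + D"]) auto
qed

text \<open>Successive vanishing conditions on \<open>l\<close>, \<open>cj l\<close>,
  \<open>zdiff l\<close> and \<open>zsum l\<close> push the set into the intersection that a good
  scale makes trivial. Each condition costs at most a factor \<open>q\<close>, so the exponent
  counts the conditions.\<close>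

lemma card_near_le:
  assumes good: "good_scale C Q"
  shows "card (Bx L L \<inter> near t) \<le> q ^ (2 * nat (L - Q + C) + 2 * nat (Q + C - t))"
proof -
  define W where "W = Bx L L \<inter> near t"
  define I where "I = {- L..<- (Q - C)}"
  define J where "J = {t + 2..Q + C + 1}"
  define J' where "J' = {t - D + 2..Q + C - D + 1}"
  define W1 where "W1 = {w\<in>W. \<forall>i\<in>I. w $$ i = 0}"
  define W2 where "W2 = {w\<in>W1. \<forall>i\<in>I. cj w $$ i = 0}"
  define W3 where "W3 = {w\<in>W2. \<forall>i\<in>J. zdiff w $$ i = 0}"
  define W4 where "W4 = {w\<in>W3. \<forall>i\<in>J'. zsum w $$ i = 0}"
  have fin: "finite W" by (simp add: W_def)
  have finI: "finite I" "finite J" "finite J'" by (simp_all add: I_def J_def J'_def)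
  have sub: "add_subgroup W"
    using subgroup_Bx[of L L] subgroup_near[of t] unfolding W_def add_subgroup_def by blast
  have WA: "W \<subseteq> A" "W1 \<subseteq> A" "W2 \<subseteq> A" "W3 \<subseteq> A" 
    unfolding W1_def W2_def W3_def W_def using Bx_A by auto
  have fins: "finite W1" "finite W2" "finite W3" using fin by (simp_all add: W1_def W2_def W3_def)
  have addz: "additive_on V (\<lambda>l. zdiff l $$ i)" "additive_on V (\<lambda>l. zsum l $$ i)" if "V \<subseteq> A" for V i
    using that by (auto simp: additive_on_def zdiff_diff zsum_diff subset_iff)
  have 1: "card W \<le> q ^ card I * card W1" "add_subgroup W1"
    unfolding q_def W1_def by (rule card_le_kernel_family[OF fin sub finI(1) additive_nth])+
  have 2: "card W1 \<le> q ^ card I * card W2" "add_subgroup W2"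
    unfolding q_def W2_def by (rule card_le_kernel_family[OF fins(1) 1(2) finI(1) additive_cj_nth[OF WA(2)]])+
  have 3: "card W2 \<le> q ^ card J * card W3" "add_subgroup W3"
    unfolding q_def W3_def by (rule card_le_kernel_family[OF fins(2) 2(2) finI(2) addz(1)[OF WA(3)]])+
  have 4: "card W3 \<le> q ^ card J' * card W4"
    unfolding q_def W4_def by (rule card_le_kernel_family[OF fins(3) 3(2) finI(3) addz(2)[OF WA(4)]])
  have "W4 \<subseteq> {0}"
  proof
    fix l assume "l \<in> W4"
    then have l: "l \<in> Bx L L" "l \<in> near t" and van: "\<And>i. i \<in> I \<Longrightarrow> l $$ i = 0" "\<And>i. i \<in> I \<Longrightarrow> cj l $$ i = 0"
      "\<And>i. i \<in> J \<Longrightarrow> zdiff l $$ i = 0" "\<And>i. i \<in> J' \<Longrightarrow> zsum l $$ i = 0"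
      by (auto simp: W4_def W3_def W2_def W1_def W_def)
    have "l $$ n = 0 \<and> cj l $$ n = 0" if "n < - (Q - C)" for n
      using l(1) van(1,2)[of n] that by (cases "n < - L") (auto simp: Bx_def dle_def I_def)
    then have "l \<in> Bx (Q - C) (Q - C)" using Bx_A[OF l(1)] by (simp add: Bx_def dle_def)
    moreover have "l \<in> near (Q + C)" unfolding near_iff
    proof (intro conjI allI impI)
      fix n assume n: "1 \<le> n \<and> n \<le> Q + C + 1"
      show "zdiff l $$ n = 0"
        using l(2) van(3)[of n] n by (cases "n \<le> t + 1") (auto simp: near_iff J_def)
    next
      fix n assume n: "1 \<le> n \<and> n \<le> Q + C - D + 1"
      show "zsum l $$ n = 0"
        using l(2) van(4)[of n] n by (cases "n \<le> t - D + 1") (auto simp: near_iff J'_def)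
    qed (use l near_A in blast)
    ultimately show "l \<in> {0}" using good unfolding good_scale_def by blast
  qed
  then have "card W4 \<le> 1" using card_mono[of "{0}" W4] by simp
  then have "card W3 \<le> q ^ card J'" using 4 by (metis mult.right_neutral mult_le_mono2 order_trans)
  then have "card W2 \<le> q ^ card J * q ^ card J'" using 3(1) by (meson mult_le_mono2 order_trans)
  then have "card W1 \<le> q ^ card I * (q ^ card J * q ^ card J')" using 2(1) by (meson mult_le_mono2 order_trans)
  then have "card W \<le> q ^ card I * (q ^ card I * (q ^ card J * q ^ card J'))" using 1(1) by (meson mult_le_mono2 order_trans)
  also have "\<dots> = q ^ (2 * nat (L - Q + C) + 2 * nat (Q + C - t))"
  proof -
    have "card I = nat (L - Q + C)" "card J = nat (Q + C - t)" "card J' = nat (Q + C - t)"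
      by (simp_all add: I_def J_def J'_def algebra_simps)
    then show ?thesis by (simp add: power_add mult_2)
  qed
  finally show ?thesis by (simp add: W_def)
qed

end

section \<open>Counting elements and prime ideals\<close>

context real_quadratic
begin

definition qq :: "real \<Rightarrow> real" where "qq x = real q powr x"

lemma qq_pos [simp]: "qq x > 0" and qq_nonneg [simp]: "qq x \<ge> 0" and qq_nz [simp]: "qq x \<noteq> 0"
  using q_ge_3 by (auto simp: qq_def)

lemma qq_add: "qq (x + y) = qq x * qq y"
  by (simp add: qq_def powr_add)

lemma qq_mono: "x \<le> y \<Longrightarrow> qq x \<le> qq y"
  using q_ge_3 by (simp add: qq_def powr_mono)

lemma qq_0 [simp]: "qq 0 = 1"
  using q_ge_3 by (simp add: qq_def)

lemma qq_nat: "real q ^ k = qq (real k)"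
  using q_ge_3 by (simp add: qq_def powr_realpow)

lemma card_Bx_real:
  "u \<ge> D - 1 \<Longrightarrow> v \<ge> D - 1 \<Longrightarrow> real (card (Bx u v)) = qq (of_int (u + v + 2 - D))"
  using D_ge_1 by (simp add: card_Bx qq_nat)

definition KB :: real where "KB = of_int (D + 4 * Cb + 2)"

lemma KB_ge: "KB \<ge> 3"
  using D_ge_1 Cb(1) by (simp add: KB_def)

lemma card_Bx_le:
  assumes "u + v \<ge> 0" "\<bar>u - v\<bar> \<le> 2 * Cb"
  shows "real (card (Bx u v)) \<le> qq (of_int (u + v) + KB)"
proof -
  \<comment> \<open>Both \<open>u\<close> and \<open>v\<close> are at least \<open>- Cb\<close>, so
    this enlargement reaches the range where the cardinality is exact; it adds
    \<open>2 * ?h + 2 - D = D + 4 * Cb + 2\<close> to the exponent, which is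
    \<open>KB\<close>.\<close>
  let ?h = "D + 2 * Cb"
  have h: "u + ?h \<ge> D - 1" "v + ?h \<ge> D - 1" using assms Cb(1) by linarith+
  have "real (card (Bx u v)) \<le> real (card (Bx (u + ?h) (v + ?h)))"
    using D_ge_1 Cb(1) by (intro of_nat_mono card_mono Bx_mono) auto
  also have "\<dots> = qq (of_int (u + ?h + (v + ?h) + 2 - D))" using h by (rule card_Bx_real)
  also have "\<dots> = qq (of_int (u + v) + KB)" by (simp add: KB_def algebra_simps)
  finally show ?thesis .
qed

lemma dg_rep_bounds:
  assumes "set_mset M \<subseteq> PR"
  shows "2 * dg (rep M) \<le> int (mdeg dN M) + Cb" "2 * dg (rep M) \<ge> int (mdeg dN M) - Cb"
    "2 * dg (cj (rep M)) \<le> int (mdeg dN M) + Cb" "2 * dg (cj (rep M)) \<ge> int (mdeg dN M) - Cb"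
  using dg_rep[OF assms] rep(4)[OF assms] by linarith+

text \<open>By unique factorization these multisets are the nonzero ideals of norm at most
  q^m.\<close>

definition MM :: "nat \<Rightarrow> 'a fls multiset set" where
  "MM m = {M. set_mset M \<subseteq> PR \<and> mdeg dN M \<le> m}"

lemma MM_rep: "inj_on rep (MM m)" "rep ` MM m \<subseteq> Bx ((int m + Cb) div 2) ((int m + Cb) div 2)"
proof -
  show "inj_on rep (MM m)" by (rule inj_onI) (metis (mono_tags, lifting) MM_def mem_Collect_eq rep(3))
  show "rep ` MM m \<subseteq> Bx ((int m + Cb) div 2) ((int m + Cb) div 2)"
  proof (rule image_subsetI)
    fix M assume "M \<in> MM m"
    then have M: "set_mset M \<subseteq> PR" "mdeg dN M \<le> m" by (auto simp: MM_def)
    have "dg (rep M) \<le> (int m + Cb) div 2" "dg (cj (rep M)) \<le> (int m + Cb) div 2"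
      using dg_rep_bounds[OF M(1)] M(2) by linarith+
    then show "rep M \<in> Bx ((int m + Cb) div 2) ((int m + Cb) div 2)"
      using rep(1)[OF M(1)] by (simp add: Bx_def dle_iff)
  qed
qed

lemma finite_MM [simp, intro]: "finite (MM m)"
  using MM_rep finite_Bx by (meson inj_on_finite)

lemma card_MM_le: "real (card (MM m)) \<le> qq (real m + of_int Cb + KB)"
proof -
  let ?h = "(int m + Cb) div 2"
  have "real (card (MM m)) \<le> real (card (Bx ?h ?h))"
    using card_inj_on_le[OF MM_rep finite_Bx] by simp
  also have "\<dots> \<le> qq (of_int (?h + ?h) + KB)" using Cb(1) by (intro card_Bx_le) auto
  also have "\<dots> \<le> qq (real m + of_int Cb + KB)"
  proof (rule qq_mono)
    have "?h + ?h \<le> int m + Cb" by linarith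
    then have "real_of_int (?h + ?h) \<le> of_int (int m + Cb)" by (simp only: of_int_le_iff)
    then show "of_int (?h + ?h) + KB \<le> real m + of_int Cb + KB" by simp
  qed
  finally show ?thesis .
qed

text \<open>Each divisor \<open>N\<close> of \<open>c\<close> corresponds to exactly one cofactor
  \<open>k = c / rep N\<close>, so the double sum can be read with \<open>N\<close> outside and
  \<open>k\<close> inside.\<close>

lemma sum_over_divisors:
  assumes S: "finite S" "S \<subseteq> A - {0}" "\<And>c. c \<in> S \<Longrightarrow> dN c \<le> m"
  shows "(\<Sum>c\<in>S. \<Sum>N\<in>submsets (fac c). f N c) =
    (\<Sum>N\<in>MM m. \<Sum>k\<in>{k\<in>A. k \<noteq> 0 \<and> rep N * k \<in> S}. f N (rep N * k))"
proof -
  have fin: "finite {k\<in>A. k \<noteq> 0 \<and> rep N * k \<in> S}" if "N \<in> MM m" for N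
  proof (rule inj_on_finite[OF _ _ S(1)])
    have "rep N \<noteq> 0" using that rep(2) by (simp add: MM_def)
    then show "inj_on (\<lambda>k. rep N * k) {k\<in>A. k \<noteq> 0 \<and> rep N * k \<in> S}" by (auto simp: inj_on_def)
  qed auto
  have sub: "N \<in> MM m \<and> c / rep N \<in> A \<and> c / rep N \<noteq> 0 \<and> rep N * (c / rep N) = c"
    if c: "c \<in> S" "N \<subseteq># fac c" for c N
  proof -
    have cA: "c \<in> A" "c \<noteq> 0" using c S by auto
    have N: "set_mset N \<subseteq> PR" using fac_PR[OF cA] c(2) by (meson set_mset_mono subset_trans)
    have "mdeg dN N \<le> m" using mdeg_mono[OF c(2), of dN] mdeg_fac[OF cA] S(3)[OF c(1)] by simp
    moreover obtain k where "k \<in> A" "c = rep N * k"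
      using fac_subset_dvd[of "rep N" c] rep[OF N] cA c(2) by auto
    ultimately show ?thesis using N rep(2)[OF N] cA by (simp add: MM_def)
  qed
  have "(\<Sum>c\<in>S. \<Sum>N\<in>submsets (fac c). f N c) = (\<Sum>(c,N)\<in>(SIGMA c:S. submsets (fac c)). f N c)"
    using S(1) by (intro sum.Sigma) auto
  also have "\<dots> = (\<Sum>(N,k)\<in>(SIGMA N:MM m. {k\<in>A. k \<noteq> 0 \<and> rep N * k \<in> S}). f N (rep N * k))"
  proof (rule sum.reindex_bij_witness[of _ "\<lambda>(N,k). (rep N * k, N)" "\<lambda>(c,N). (N, c / rep N)"], goal_cases)
    case (1 x) then show ?case using sub by auto
  next
    case (2 x) then show ?case using sub by auto
  next
    case (3 x) then show ?case using rep(2) by (auto simp: MM_def)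
  next
    case (4 x)
    then obtain N k where x: "x = (N, k)" "N \<in> MM m" "k \<in> A" "k \<noteq> 0" "rep N * k \<in> S" by auto
    then have N: "set_mset N \<subseteq> PR" by (simp add: MM_def)
    have "fac (rep N * k) = N + fac k" using rep[OF N] x by (simp add: fac_mult)
    then show ?case using x by simp
  next
    case (5 x) then show ?case using sub by auto
  qed
  also have "\<dots> = (\<Sum>N\<in>MM m. \<Sum>k\<in>{k\<in>A. k \<noteq> 0 \<and> rep N * k \<in> S}. f N (rep N * k))"
    using fin by (intro sum.Sigma[symmetric]) auto
  finally show ?thesis .
qed

text \<open>Fixing both degrees, and not only the norm, makes the cofactors of \<open>rep N\<close>
  run over another full class, which is an alternating combination of boxes.\<close>

definition Cc :: "int \<Rightarrow> int \<Rightarrow> 'a fls set" where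
  "Cc u v = {c\<in>A. c \<noteq> 0 \<and> dg c = u \<and> dg (cj c) = v}"

lemma Cc_Bx: "Cc u v \<subseteq> Bx u v"
  by (auto simp: Cc_def Bx_def dle_iff)

lemma finite_Cc [simp, intro]: "finite (Cc u v)"
  using Cc_Bx finite_Bx finite_subset by blast

lemma Cc_A: "c \<in> Cc u v \<Longrightarrow> c \<in> A" and Cc_nz: "c \<in> Cc u v \<Longrightarrow> c \<noteq> 0"
  by (auto simp: Cc_def)

lemma Cc_dN: "c \<in> Cc u v \<Longrightarrow> int (dN c) = u + v"
  using int_dN by (auto simp: Cc_def)

lemma sum_divisors_Cc:
  assumes "u + v = int n"
  shows "(\<Sum>c\<in>Cc u v. \<Sum>N\<in>submsets (fac c). f N c) =
    (\<Sum>N\<in>MM n. \<Sum>k\<in>Cc (u - dg (rep N)) (v - dg (cj (rep N))). f N (rep N * k))"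
proof -
  have "(\<Sum>c\<in>Cc u v. \<Sum>N\<in>submsets (fac c). f N c) =
    (\<Sum>N\<in>MM n. \<Sum>k\<in>{k\<in>A. k \<noteq> 0 \<and> rep N * k \<in> Cc u v}. f N (rep N * k))"
  proof (rule sum_over_divisors)
    show "Cc u v \<subseteq> A - {0}" using Cc_A Cc_nz by blast
    show "dN c \<le> n" if "c \<in> Cc u v" for c using Cc_dN[OF that] assms by simp
  qed simp
  also have "\<dots> = (\<Sum>N\<in>MM n. \<Sum>k\<in>Cc (u - dg (rep N)) (v - dg (cj (rep N))). f N (rep N * k))"
  proof (rule sum.cong[OF refl], rule sum.cong)
    fix N assume "N \<in> MM n"
    then have N: "set_mset N \<subseteq> PR" by (simp add: MM_def)
    show "{k\<in>A. k \<noteq> 0 \<and> rep N * k \<in> Cc u v} = Cc (u - dg (rep N)) (v - dg (cj (rep N)))"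
      using rep(1,2)[OF N] by (auto simp: Cc_def dg_mult cj_mult)
  qed simp
  finally show ?thesis .
qed

text \<open>Chebyshev's device: the degree of \<open>c\<close> is the sum of \<open>mangoldt\<close>
  over its divisors, so the total counts multiples of \<open>rep N\<close> in the box. The
  \<open>- 1\<close> removes the multiple 0.\<close>

lemma sum_dN_box:
  "(\<Sum>c\<in>Bx (int t) (int t) - {0}. real (dN c)) =
    (\<Sum>N\<in>MM (2 * t). mangoldt dN N * (real (card (Bx (int t - dg (rep N)) (int t - dg (cj (rep N))))) - 1))"
proof -
  let ?S = "Bx (int t) (int t) - {0}"
  have S: "?S \<subseteq> A - {0}" using Bx_A by auto
  have dN_le: "dN c \<le> 2 * t" if "c \<in> ?S" for c
    using that int_dN[of c] by (auto simp: Bx_def dle_iff)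
  have "(\<Sum>c\<in>?S. real (dN c)) = (\<Sum>c\<in>?S. \<Sum>N\<in>submsets (fac c). mangoldt dN N)"
    using S by (intro sum.cong) (auto simp: sum_mangoldt mdeg_fac)
  also have "\<dots> = (\<Sum>N\<in>MM (2 * t). \<Sum>k\<in>{k\<in>A. k \<noteq> 0 \<and> rep N * k \<in> ?S}. mangoldt dN N)"
    using S dN_le by (intro sum_over_divisors) auto
  also have "\<dots> = (\<Sum>N\<in>MM (2 * t). mangoldt dN N * (real (card (Bx (int t - dg (rep N)) (int t - dg (cj (rep N))))) - 1))"
  proof (rule sum.cong[OF refl])
    fix N assume "N \<in> MM (2 * t)"
    then have N: "set_mset N \<subseteq> PR" by (simp add: MM_def)
    have eq: "{k\<in>A. k \<noteq> 0 \<and> rep N * k \<in> ?S} = Bx (int t - dg (rep N)) (int t - dg (cj (rep N))) - {0}"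
      using rep(1,2)[OF N] by (auto simp: Bx_def dle_iff dg_mult cj_mult)
    have "real (card (Bx (int t - dg (rep N)) (int t - dg (cj (rep N))) - {0})) =
      real (card (Bx (int t - dg (rep N)) (int t - dg (cj (rep N))))) - 1"
      using card_Bx_pos by (simp add: card_Diff_singleton of_nat_diff)
    then show "(\<Sum>k\<in>{k\<in>A. k \<noteq> 0 \<and> rep N * k \<in> ?S}. mangoldt dN N) =
      mangoldt dN N * (real (card (Bx (int t - dg (rep N)) (int t - dg (cj (rep N))))) - 1)"
      unfolding eq by simp
  qed
  finally show ?thesis .
qed

section \<open>Mertens-type bounds for sums over prime powers\<close>

definition mertens :: "nat \<Rightarrow> real" where
  "mertens m = (\<Sum>N\<in>MM m. mangoldt dN N * qq (- real (mdeg dN N)))"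

text \<open>In a large enough box every \<open>N\<close> in \<open>MM m\<close> has exactly the
  expected number of multiples, and at least q^w of them, so discarding 0 costs only a factor
  \<open>1 - qq (- real w)\<close>.\<close>

lemma mertens_upper:
  "mertens m * (1 - qq (- real w)) \<le> real m + of_int Cb + 2 * of_int D + 2 * real w + 2"
proof -
  \<comment> \<open>The first term absorbs the degrees of \<open>rep N\<close>, \<open>D\<close>
    reaches the exact range of \<open>card_Bx_real\<close>, and \<open>w\<close> guarantees the many
    multiples.\<close>
  define t where "t = nat ((int m + Cb) div 2 + D + int w)"
  have t: "int t = (int m + Cb) div 2 + D + int w" using Cb(1) D_ge_1 by (simp add: t_def)
  have m: "m \<le> 2 * t" using t Cb(1) D_ge_1 by linarith
  let ?E = "real_of_int (2 * int t + 2 - D)"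
  let ?b = "\<lambda>N. real (card (Bx (int t - dg (rep N)) (int t - dg (cj (rep N)))))"
  have b: "?b N - 1 \<ge> qq ?E * qq (- real (mdeg dN N)) * (1 - qq (- real w))" if N: "N \<in> MM m" for N
  proof -
    have N': "set_mset N \<subseteq> PR" "mdeg dN N \<le> m" using N by (auto simp: MM_def)
    have ge: "int t - dg (rep N) \<ge> D - 1 + int w" "int t - dg (cj (rep N)) \<ge> D - 1 + int w"
      using dg_rep_bounds[OF N'(1)] N'(2) t by linarith+
    then have "?b N = qq (of_int (int t - dg (rep N) + (int t - dg (cj (rep N))) + 2 - D))"
      by (intro card_Bx_real) auto
    also have "int t - dg (rep N) + (int t - dg (cj (rep N))) + 2 - D = 2 * int t + 2 - D - int (mdeg dN N)"
      using dg_rep[OF N'(1)] by linarith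
    also have "qq (of_int (2 * int t + 2 - D - int (mdeg dN N))) = qq ?E * qq (- real (mdeg dN N))"
      by (simp flip: qq_add)
    finally have b_eq: "?b N = qq ?E * qq (- real (mdeg dN N))" .
    have "int w \<le> 2 * int t + 2 - D - int (mdeg dN N)" using ge dg_rep[OF N'(1)] D_ge_1 by linarith
    then have "real_of_int (int w) \<le> of_int (2 * int t + 2 - D - int (mdeg dN N))" by (simp only: of_int_le_iff)
    then have "qq (real w) \<le> ?b N" unfolding b_eq by (simp add: qq_mono flip: qq_add)
    then have "qq (real w) * qq (- real w) \<le> ?b N * qq (- real w)" by (intro mult_right_mono) auto
    then have "?b N * qq (- real w) \<ge> 1" by (simp flip: qq_add)
    then show ?thesis unfolding b_eq[symmetric] by (simp add: algebra_simps)
  qed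
  have "qq ?E * (mertens m * (1 - qq (- real w))) =
    (\<Sum>N\<in>MM m. mangoldt dN N * (qq ?E * qq (- real (mdeg dN N)) * (1 - qq (- real w))))"
    unfolding mertens_def by (simp add: sum_distrib_left sum_distrib_right mult_ac)
  also have "\<dots> \<le> (\<Sum>N\<in>MM m. mangoldt dN N * (?b N - 1))"
    using b by (intro sum_mono mult_left_mono mangoldt_nonneg)
  also have "\<dots> \<le> (\<Sum>N\<in>MM (2 * t). mangoldt dN N * (?b N - 1))"
  proof (rule sum_mono2[OF finite_MM])
    show "MM m \<subseteq> MM (2 * t)" using m by (auto simp: MM_def)
    show "0 \<le> mangoldt dN N * (?b N - 1)" for N
      using card_Bx_pos by (intro mult_nonneg_nonneg mangoldt_nonneg) simp
  qed
  also have "\<dots> = (\<Sum>c\<in>Bx (int t) (int t) - {0}. real (dN c))" by (rule sum_dN_box[symmetric])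
  also have "\<dots> \<le> (\<Sum>c\<in>Bx (int t) (int t) - {0}. 2 * real t)"
  proof (rule sum_mono)
    fix c assume "c \<in> Bx (int t) (int t) - {0}"
    then have "int (dN c) \<le> 2 * int t" using int_dN[of c] by (auto simp: Bx_def dle_iff)
    then show "real (dN c) \<le> 2 * real t" by linarith
  qed
  also have "\<dots> \<le> (\<Sum>c\<in>Bx (int t) (int t). 2 * real t)" by (intro sum_mono2) auto
  also have "\<dots> = qq ?E * (2 * real t)"
    using t Cb(1) D_ge_1 by (simp add: card_Bx_real)
  finally have "mertens m * (1 - qq (- real w)) \<le> 2 * real t" by simp
  moreover have "2 * int t \<le> int m + Cb + 2 * D + 2 * int w" using t by linarith
  then have "real_of_int (2 * int t) \<le> of_int (int m + Cb + 2 * D + 2 * int w)" by (simp only: of_int_le_iff)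
  ultimately show ?thesis by simp
qed

text \<open>Removing two thinner boxes leaves almost all elements, all of norm degree above
  \<open>2 * t - 2 * w\<close>. Multiples are counted exactly for \<open>N\<close> in
  \<open>MM m\<close>; for larger \<open>N\<close> only an upper bound holds, so the tail carries
  the extra factor \<open>qq (KB + of_int D)\<close>.\<close>

lemma mertens_lower:
  assumes t: "int t \<ge> D - 1 + int w" and m: "int m + Cb + 2 * D \<le> 2 * int t"
  shows "(1 - 2 * qq (- real w)) * (2 * real t - 2 * real w) \<le>
    mertens m + qq (KB + of_int D) * (mertens (2 * t) - mertens m)"
proof -
  let ?E = "real_of_int (2 * int t + 2 - D)"
  let ?B = "Bx (int t) (int t)"
  let ?B1 = "Bx (int t - int w) (int t)" and ?B2 = "Bx (int t) (int t - int w)"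
  let ?b = "\<lambda>N. real (card (Bx (int t - dg (rep N)) (int t - dg (cj (rep N)))))"
  have m2: "m \<le> 2 * t" using m Cb(1) D_ge_1 by linarith
  have cB: "real (card ?B) = qq ?E" using t by (simp add: card_Bx_real)
  have c12: "real (card ?B1) = qq ?E * qq (- real w)" "real (card ?B2) = qq ?E * qq (- real w)"
    using t D_ge_1 by (simp_all add: card_Bx_real algebra_simps flip: qq_add)
  have wt: "w \<le> t" using t D_ge_1 by linarith
  have "card ?B \<le> card ((?B - (?B1 \<union> ?B2)) \<union> (?B1 \<union> ?B2))"
    by (rule card_mono) auto
  also have "\<dots> \<le> card (?B - (?B1 \<union> ?B2)) + card (?B1 \<union> ?B2)" by (rule card_Un_le)
  also have "\<dots> \<le> card (?B - (?B1 \<union> ?B2)) + (card ?B1 + card ?B2)" using card_Un_le[of ?B1 ?B2] by simp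
  finally have "real (card ?B) \<le> real (card (?B - (?B1 \<union> ?B2))) + (real (card ?B1) + real (card ?B2))"
    unfolding of_nat_add[symmetric] of_nat_le_iff .
  then have "qq ?E * (1 - 2 * qq (- real w)) \<le> real (card (?B - (?B1 \<union> ?B2)))"
    unfolding cB c12 by (simp add: algebra_simps)
  then have "qq ?E * (1 - 2 * qq (- real w)) * (2 * real t - 2 * real w) \<le>
      real (card (?B - (?B1 \<union> ?B2))) * (2 * real t - 2 * real w)"
    using wt by (intro mult_right_mono) auto
  also have "\<dots> = (\<Sum>c\<in>?B - (?B1 \<union> ?B2). 2 * real t - 2 * real w)" by simp
  also have "\<dots> \<le> (\<Sum>c\<in>?B - (?B1 \<union> ?B2). real (dN c))"
  proof (rule sum_mono)
    fix c assume c: "c \<in> ?B - (?B1 \<union> ?B2)"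
    then have "c \<in> A" "c \<noteq> 0" "dg c > int t - int w" "dg (cj c) > int t - int w"
      by (auto simp: Bx_def dle_iff)
    then have "int (dN c) \<ge> 2 * int t - 2 * int w" using int_dN[of c] by linarith
    then show "2 * real t - 2 * real w \<le> real (dN c)" by linarith
  qed
  also have "\<dots> \<le> (\<Sum>c\<in>?B - {0}. real (dN c))" by (intro sum_mono2) auto
  also have "\<dots> = (\<Sum>N\<in>MM (2 * t). mangoldt dN N * (?b N - 1))" by (rule sum_dN_box)
  also have "\<dots> \<le> (\<Sum>N\<in>MM (2 * t). mangoldt dN N * ?b N)"
    by (intro sum_mono mult_left_mono mangoldt_nonneg) simp
  also have "\<dots> = (\<Sum>N\<in>MM m. mangoldt dN N * ?b N) + (\<Sum>N\<in>MM (2 * t) - MM m. mangoldt dN N * ?b N)"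
    using m2 by (subst sum.subset_diff[of "MM m" "MM (2 * t)"]) (use finite_MM[of "2 * t"] in \<open>auto simp: MM_def\<close>)
  also have "(\<Sum>N\<in>MM m. mangoldt dN N * ?b N) = qq ?E * mertens m"
    unfolding mertens_def sum_distrib_left
  proof (rule sum.cong[OF refl])
    fix N assume "N \<in> MM m"
    then have N: "set_mset N \<subseteq> PR" "mdeg dN N \<le> m" by (auto simp: MM_def)
    have "?b N = qq (of_int (int t - dg (rep N) + (int t - dg (cj (rep N))) + 2 - D))"
      using dg_rep_bounds[OF N(1)] N(2) m by (intro card_Bx_real) linarith+
    also have "int t - dg (rep N) + (int t - dg (cj (rep N))) + 2 - D = 2 * int t + 2 - D - int (mdeg dN N)"
      using dg_rep[OF N(1)] by linarith
    finally show "mangoldt dN N * ?b N = qq ?E * (mangoldt dN N * qq (- real (mdeg dN N)))"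
      by (simp flip: qq_add)
  qed
  also have "(\<Sum>N\<in>MM (2 * t) - MM m. mangoldt dN N * ?b N) \<le>
      (\<Sum>N\<in>MM (2 * t) - MM m. qq ?E * qq (KB + of_int D) * (mangoldt dN N * qq (- real (mdeg dN N))))"
  proof (rule sum_mono)
    fix N assume "N \<in> MM (2 * t) - MM m"
    then have N: "set_mset N \<subseteq> PR" "mdeg dN N \<le> 2 * t" by (auto simp: MM_def)
    have sum: "int t - dg (rep N) + (int t - dg (cj (rep N))) = 2 * int t - int (mdeg dN N)"
      using dg_rep[OF N(1)] by linarith
    have "?b N \<le> qq (of_int (int t - dg (rep N) + (int t - dg (cj (rep N)))) + KB)"
      using sum N rep(4)[OF N(1)] Cb(1) by (intro card_Bx_le) linarith+
    also have "\<dots> \<le> qq (?E + (KB + of_int D) - real (mdeg dN N))"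
      unfolding sum by (intro qq_mono) simp
    also have "\<dots> = qq ?E * qq (KB + of_int D) * qq (- real (mdeg dN N))" by (simp flip: qq_add)
    finally have "mangoldt dN N * ?b N \<le> mangoldt dN N * (qq ?E * qq (KB + of_int D) * qq (- real (mdeg dN N)))"
      by (intro mult_left_mono mangoldt_nonneg)
    then show "mangoldt dN N * ?b N \<le> qq ?E * qq (KB + of_int D) * (mangoldt dN N * qq (- real (mdeg dN N)))"
      by (simp add: mult_ac)
  qed
  also have "\<dots> = qq ?E * qq (KB + of_int D) * (mertens (2 * t) - mertens m)"
  proof -
    have "mertens (2 * t) = mertens m + (\<Sum>N\<in>MM (2 * t) - MM m. mangoldt dN N * qq (- real (mdeg dN N)))"
      unfolding mertens_def using m2
      by (subst sum.subset_diff[of "MM m" "MM (2 * t)"]) (use finite_MM[of "2 * t"] in \<open>auto simp: MM_def\<close>)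
    then show ?thesis by (simp add: sum_distrib_left)
  qed
  finally have "qq ?E * ((1 - 2 * qq (- real w)) * (2 * real t - 2 * real w)) \<le>
      qq ?E * (mertens m + qq (KB + of_int D) * (mertens (2 * t) - mertens m))"
    by (simp add: algebra_simps)
  then show ?thesis by simp
qed

section \<open>A degree and a degree class rich in primes\<close>

definition psi :: "nat \<Rightarrow> real" where
  "psi k = (\<Sum>N\<in>{N. set_mset N \<subseteq> PR \<and> mdeg dN N = k}. mangoldt dN N)"

lemma finite_mdeg_eq: "finite {N. set_mset N \<subseteq> PR \<and> mdeg dN N = k}"
  by (rule finite_subset[OF _ finite_MM[of k]]) (auto simp: MM_def)

lemma mertens_diff: 
  assumes "m \<le> m'" shows "mertens m' - mertens m = (\<Sum>k\<in>{m<..m'}. psi k * qq (- real k))"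
proof -
  have "(\<Sum>k\<in>{m<..m'}. psi k * qq (- real k)) =
    (\<Sum>k\<in>{m<..m'}. \<Sum>N\<in>{N \<in> MM m' - MM m. mdeg dN N = k}. mangoldt dN N * qq (- real (mdeg dN N)))"
    unfolding psi_def sum_distrib_right by (intro sum.cong) (auto simp: MM_def)
  also have "\<dots> = (\<Sum>N\<in>MM m' - MM m. mangoldt dN N * qq (- real (mdeg dN N)))"
    by (rule sum.group[OF finite_Diff[OF finite_MM] finite_greaterThanAtMost]) (auto simp: MM_def)
  also have "\<dots> = mertens m' - mertens m"
    unfolding mertens_def using assms by (intro sum_diff finite_MM) (auto simp: MM_def)
  finally show ?thesis by simp
qed

text \<open>The partial sums of \<open>psi k / q^k\<close> grow like the identity up to bounded multiples of \<open>w\<close>, so a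
  window of degrees longer than this error contains a large term.\<close>
lemma psi_large:
  assumes R: "int R \<ge> 4 * int w + Cb + 4 * D + 10" "R \<le> 4 * Q" and w: "real q ^ w \<ge> 40 * real Q" and Q: "Q \<ge> 1"
    and Qw: "int Q \<ge> int w + Cb + 2 * D + 10"
  shows "\<exists>n. 4 * Q - R < n \<and> n \<le> 4 * Q \<and> psi n \<ge> qq (real n - KB - of_int D) / (4 * real Q)"
proof (rule ccontr)
  assume no: "\<not> ?thesis"
  define m where "m = 4 * Q - R"
  \<comment> \<open>The relative error of both Mertens bounds. Since
    \<open>y * real Q \<le> 1 / 40\<close>, it causes only a bounded absolute error although it
    multiplies quantities of size \<open>Q\<close>.\<close>
  define y where "y = qq (- real w)"
  have y0: "y > 0" by (simp add: y_def)
  have "qq (real w) \<ge> 40 * real Q" using w by (simp add: qq_nat)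
  then have "y * qq (real w) \<ge> y * (40 * real Q)" using y0 by (intro mult_left_mono) auto
  then have y: "y * real Q \<le> 1 / 40" by (simp add: y_def flip: qq_add)
  have y1: "y \<le> 1 / 40"
  proof -
    have "y * 1 \<le> y * real Q" using y0 Q by (intro mult_left_mono) auto
    then show ?thesis using y by simp
  qed
  have mR: "real m = 4 * real Q - real R" using R(2) by (simp add: m_def of_nat_diff)
  have up: "mertens m * (1 - y) \<le> real m + of_int Cb + 2 * of_int D + 2 * real w + 2"
    unfolding y_def by (rule mertens_upper)
  have low: "(1 - 2 * y) * (4 * real Q - 2 * real w) \<le>
     mertens m + qq (KB + of_int D) * (mertens (4 * Q) - mertens m)"
    using mertens_lower[of w "2 * Q" m] R Qw Cb(1) D_ge_1 unfolding y_def m_def by simp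
  have "qq (KB + of_int D) * (mertens (4 * Q) - mertens m) = (\<Sum>k\<in>{m<..4 * Q}. qq (KB + of_int D) * (psi k * qq (- real k)))"
    by (subst mertens_diff) (simp_all add: m_def sum_distrib_left)
  \<comment> \<open>By the negated claim each degree of the window contributes at most
    \<open>1 / (4 * real Q)\<close>, and the window has \<open>R \<le> 4 * Q\<close> degrees; so the
    tail is at most 1.\<close>
  also have "\<dots> \<le> (\<Sum>k\<in>{m<..4 * Q}. 1 / (4 * real Q))"
  proof (rule sum_mono)
    fix k assume k: "k \<in> {m<..4 * Q}"
    then have "psi k \<le> qq (real k - KB - of_int D) / (4 * real Q)" using no by (force simp: m_def)
    then have "qq (KB + of_int D) * (psi k * qq (- real k)) \<le>
        qq (KB + of_int D) * (qq (real k - KB - of_int D) / (4 * real Q) * qq (- real k))"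
      by (intro mult_left_mono mult_right_mono) auto
    also have "\<dots> = (qq (KB + of_int D) * qq (real k - KB - of_int D) * qq (- real k)) / (4 * real Q)" by simp
    also have "\<dots> = 1 / (4 * real Q)" by (simp flip: qq_add)
    finally show "qq (KB + of_int D) * (psi k * qq (- real k)) \<le> 1 / (4 * real Q)" .
  qed
  also have "\<dots> = real R / (4 * real Q)" using R(2) by (simp add: m_def)
  also have "\<dots> \<le> 1" using R(2) Q by simp
  finally have tail: "qq (KB + of_int D) * (mertens (4 * Q) - mertens m) \<le> 1" .
  have m0: "mertens m \<ge> 0" unfolding mertens_def by (intro sum_nonneg mult_nonneg_nonneg mangoldt_nonneg) simp
  have reals: "real R \<ge> 4 * real w + of_int Cb + 4 * of_int D + 10"
    "real Q \<ge> real w + of_int Cb + 2 * of_int D + 10" "of_int Cb \<ge> (0::real)" "of_int D \<ge> (1::real)"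
    using R(1) Qw Cb(1) D_ge_1 by linarith+
  let ?x = "real m + of_int Cb + 2 * of_int D + 2 * real w + 2"
  have x: "?x \<le> 7 * real Q" using reals mR by linarith
  have "mertens m * (1 - 1 / 40) \<le> mertens m * (1 - y)" using y1 m0 by (intro mult_left_mono) auto
  then have "mertens m \<le> 8 * real Q" using up x Q by simp
  then have "y * mertens m \<le> y * (8 * real Q)" using y0 by (intro mult_left_mono) auto
  then have "y * mertens m \<le> 1" using y by linarith
  then have 1: "mertens m \<le> ?x + 1" using up by (simp add: algebra_simps)
  have "y * (4 * real Q - 2 * real w) \<le> y * (4 * real Q)" using y0 by (intro mult_left_mono) auto
  then have "y * (4 * real Q - 2 * real w) \<le> 1" using y by linarith
  then have "(1 - 2 * y) * (4 * real Q - 2 * real w) \<ge> 4 * real Q - 2 * real w - 2" by (simp add: algebra_simps)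
  \<comment> \<open>With \<open>m = 4 * Q - R\<close> this says that \<open>R\<close> is at most
    \<open>4 * w + Cb + 2 * D + 6\<close>, against the assumed length of the window.\<close>
  then have "4 * real Q - 2 * real w - 2 \<le> ?x + 2" using low 1 tail by linarith
  then show False using reals mR by linarith
qed

text \<open>Pigeonhole over the \<open>2 * Cb + 1\<close> possible imbalances of a balanced
  generator; together with the norm degree, the imbalance determines both degrees.\<close>

lemma class_large:
  assumes "psi n \<ge> X" "X > 0"
  shows "\<exists>u v. u + v = int n \<and> \<bar>u - v\<bar> \<le> Cb \<and>
    (\<Sum>c\<in>Cc u v. mangoldt dN (fac c)) \<ge> X / (2 * of_int Cb + 1)"
proof -
  let ?P = "{N. set_mset N \<subseteq> PR \<and> mdeg dN N = n}"
  let ?d = "\<lambda>N. dg (rep N) - dg (cj (rep N))"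
  let ?S = "\<lambda>e. \<Sum>N\<in>{N\<in>?P. ?d N = e}. mangoldt dN N"
  have im: "?d ` ?P \<subseteq> {- Cb..Cb}"
  proof (rule image_subsetI)
    fix N assume "N \<in> ?P"
    then show "?d N \<in> {- Cb..Cb}" using rep(4)[of N] by (simp add: abs_le_iff)
  qed
  have "\<exists>e\<in>{- Cb..Cb}. ?S e \<ge> X / (2 * of_int Cb + 1)"
  proof (rule ccontr)
    assume no: "\<not> ?thesis"
    have "psi n = (\<Sum>e\<in>{- Cb..Cb}. ?S e)"
      unfolding psi_def by (rule sum.group[symmetric, OF finite_mdeg_eq _ im]) simp
    also have "\<dots> < (\<Sum>e\<in>{- Cb..Cb}. X / (2 * of_int Cb + 1))"
      using no Cb(1) by (intro sum_strict_mono) (auto simp: not_le)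
    also have "\<dots> = X" using Cb(1) by simp
    finally show False using assms by simp
  qed
  then obtain e where e: "?S e \<ge> X / (2 * of_int Cb + 1)" by blast
  have "X / (2 * of_int Cb + 1) > 0" using assms(2) Cb(1) by simp
  with e have "{N\<in>?P. ?d N = e} \<noteq> {}" by (metis (no_types, lifting) not_le sum.empty)
  then obtain N0 where N0: "set_mset N0 \<subseteq> PR" "mdeg dN N0 = n" "?d N0 = e" by blast
  define u v where "u = dg (rep N0)" and "v = dg (cj (rep N0))"
  have uv: "u + v = int n" "u - v = e" using dg_rep[OF N0(1)] N0 by (simp_all add: u_def v_def)
  have "\<bar>u - v\<bar> \<le> Cb" using rep(4)[OF N0(1)] by (simp add: u_def v_def)
  let ?P' = "{N\<in>?P. ?d N = e}"
  have inj: "inj_on rep ?P'" by (rule inj_onI) (metis (mono_tags, lifting) mem_Collect_eq rep(3))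
  have sub: "rep ` ?P' \<subseteq> Cc u v"
  proof (rule image_subsetI)
    fix N assume "N \<in> ?P'"
    then have N: "set_mset N \<subseteq> PR" "mdeg dN N = n" "?d N = e" by auto
    have "dg (rep N) = u" "dg (cj (rep N)) = v" using dg_rep[OF N(1)] N uv by linarith+
    then show "rep N \<in> Cc u v" using rep(1,2)[OF N(1)] by (simp add: Cc_def)
  qed
  have "?S e = (\<Sum>N\<in>?P'. mangoldt dN (fac (rep N)))"
    by (intro sum.cong) (auto simp: rep(3))
  also have "\<dots> = (\<Sum>c\<in>rep ` ?P'. mangoldt dN (fac c))"
    by (subst sum.reindex[OF inj]) (simp add: o_def)
  also have "\<dots> \<le> (\<Sum>c\<in>Cc u v. mangoldt dN (fac c))"
    using sub by (intro sum_mono2) (auto simp: mangoldt_nonneg)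
  finally show ?thesis using e uv(1) \<open>\<bar>u - v\<bar> \<le> Cb\<close> by (meson order_trans)
qed

end

section \<open>Type I and type II sums\<close>

context approximation
begin

abbreviation dd :: "'a \<Rightarrow> real" where "dd \<equiv> delta_dev"

text \<open>Omitting \<open>j = 0\<close> subtracts the expected value from the detector of
  \<open>near \<delta>\<close>, as \<open>F_eq\<close> shows. It also keeps the products
  \<open>j * rep N\<close> nonzero, so that a good scale can exclude them.\<close>

definition F :: "int \<Rightarrow> 'a fls \<Rightarrow> real" where
  "F \<delta> c = (\<Sum>j\<in>Bx \<delta> \<delta> - {0}. dd (ell (j * c)))"

lemma box_sum:
  assumes "l \<in> A"
  shows "(\<Sum>k\<in>Bx u v. dd (ell (k * l))) =
    (if \<forall>k\<in>Bx u v. ell (k * l) = 0 then card (Bx u v) * (1 - 1 / real q) else 0)"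
  unfolding q_def
proof (rule sum_delta_dev[OF finite_Bx subgroup_Bx])
  show "additive_on (Bx u v) (\<lambda>k. ell (k * l))" using assms Bx_A by (intro additive_ell) auto
  fix c w assume w: "w \<in> Bx u v"
  have "ell (fls_const c * w * l) = c * ell (w * l)"
    using ell_scale[of "w * l" c] assms Bx_A[OF w] by (simp add: mult.assoc)
  then show "fls_const c * w \<in> Bx u v \<and> ell (fls_const c * w * l) = c * ell (w * l)"
    using Bx_scale[OF w] by simp
qed

lemma box_sum_zero:
  assumes "l \<in> A" "l \<notin> near t" "t \<le> u" "t \<le> v"
  shows "(\<Sum>k\<in>Bx u v. dd (ell (k * l))) = 0"
proof -
  obtain c where "c \<in> Bx t t" "ell (c * l) \<noteq> 0" using assms(1,2) by (auto simp: near_def)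
  then have "\<not> (\<forall>k\<in>Bx u v. ell (k * l) = 0)" using Bx_mono[OF assms(3,4)] by blast
  then show ?thesis unfolding box_sum[OF assms(1)] by (rule if_not_P)
qed

text \<open>Inclusion-exclusion writes the class through four boxes. All of them contain
  \<open>Bx t t\<close>, even after lowering both bounds by one, so each sum vanishes.\<close>

lemma class_sum_zero:
  assumes "l \<in> A" "l \<notin> near t" "t \<le> u - 1" "t \<le> v - 1"
  shows "(\<Sum>k\<in>Cc u v. dd (ell (k * l))) = 0"
proof -
  let ?f = "\<lambda>k. dd (ell (k * l))" and ?X = "Bx (u - 1) v" and ?Y = "Bx u (v - 1)"
  have "Cc u v = Bx u v - (?X \<union> ?Y)"
    by (auto simp: Cc_def Bx_def dle_iff)
  moreover have "?X \<union> ?Y \<subseteq> Bx u v" using Bx_mono[of "u - 1" u v v] Bx_mono[of u u "v - 1" v] by auto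
  ultimately have "sum ?f (Cc u v) = sum ?f (Bx u v) - sum ?f (?X \<union> ?Y)"
    by (simp add: sum_diff)
  moreover have "?X \<inter> ?Y = Bx (u - 1) (v - 1)"
    by (auto simp: Bx_def elim!: dle_mono)
  then have "sum ?f (?X \<union> ?Y) + sum ?f (Bx (u - 1) (v - 1)) = sum ?f ?X + sum ?f ?Y"
    by (metis sum.union_inter finite_Bx)
  moreover have "sum ?f (Bx u v) = 0" "sum ?f ?X = 0" "sum ?f ?Y = 0" "sum ?f (Bx (u - 1) (v - 1)) = 0"
    by (rule box_sum_zero[OF assms(1,2)]; use assms(3,4) in simp)+
  ultimately show ?thesis by simp
qed

lemma F_eq:
  assumes "c \<in> A"
  shows "F \<delta> c = (1 - 1 / real q) * (of_bool (c \<in> near \<delta>) * real (card (Bx \<delta> \<delta>)) - 1)"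
proof -
  have "F \<delta> c = (\<Sum>j\<in>Bx \<delta> \<delta>. dd (ell (j * c))) - dd (ell (0 * c))"
    unfolding F_def by (simp add: sum_diff1)
  also have "dd (ell (0 * c)) = 1 - 1 / real q"
    by (simp add: ell_def zdiff_def delta_dev_def q_def)
  also have "(\<Sum>j\<in>Bx \<delta> \<delta>. dd (ell (j * c))) = of_bool (c \<in> near \<delta>) * (card (Bx \<delta> \<delta>) * (1 - 1 / real q))"
    unfolding box_sum[OF assms] using assms by (simp add: near_def)
  finally show ?thesis by (simp add: algebra_simps)
qed

text \<open>The pair \<open>(N, j)\<close> is recovered from \<open>l = j * rep N\<close> and its
  divisor \<open>N\<close>. Thus pairs are replaced by products at the price of summing over the
  divisors of \<open>l\<close>.\<close>

lemma pairs_to_products: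
  fixes f :: "'a fls multiset \<Rightarrow> 'a fls \<Rightarrow> real"
  assumes Z: "\<And>N j. (N, j) \<in> Z \<Longrightarrow> set_mset N \<subseteq> PR \<and> j \<in> A \<and> j \<noteq> 0 \<and> j * rep N \<in> LL"
    and LL: "finite LL" and f: "\<And>N l. f N l \<ge> 0"
  shows "(\<Sum>(N,j)\<in>Z. f N (j * rep N)) \<le> (\<Sum>l\<in>LL. \<Sum>N\<in>submsets (fac l). f N l)"
proof -
  let ?\<phi> = "\<lambda>(N,j). (j * rep N, N)"
  have inj: "inj_on ?\<phi> Z"
  proof (rule inj_onI)
    fix x y assume xy: "x \<in> Z" "y \<in> Z" "?\<phi> x = ?\<phi> y"
    obtain N j where x: "x = (N, j)" by fastforce
    obtain j' where y: "y = (N, j')" using xy(3) x by (cases y) auto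
    have "set_mset N \<subseteq> PR" using Z xy(1) x by blast
    from rep(2)[OF this] show "x = y" using xy(3) x y by simp
  qed
  have sub: "?\<phi> ` Z \<subseteq> (SIGMA l:LL. submsets (fac l))"
  proof (rule image_subsetI)
    fix x assume x: "x \<in> Z"
    obtain N j where Nj: "x = (N, j)" by fastforce
    have *: "set_mset N \<subseteq> PR" "j \<in> A" "j \<noteq> 0" "j * rep N \<in> LL" using Z x Nj by auto
    then have "fac (j * rep N) = fac j + N" using rep[OF *(1)] by (simp add: fac_mult)
    then show "?\<phi> x \<in> (SIGMA l:LL. submsets (fac l))" using * Nj by simp
  qed
  have "(\<Sum>(N,j)\<in>Z. f N (j * rep N)) = (\<Sum>(l,N)\<in>?\<phi> ` Z. f N l)"
    by (subst sum.reindex[OF inj]) (simp add: o_def case_prod_unfold)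
  also have "\<dots> \<le> (\<Sum>(l,N)\<in>(SIGMA l:LL. submsets (fac l)). f N l)"
    using sub LL f by (intro sum_mono2) auto
  also have "\<dots> = (\<Sum>l\<in>LL. \<Sum>N\<in>submsets (fac l). f N l)"
    using LL by (intro sum.Sigma[symmetric]) auto
  finally show ?thesis .
qed

end

lemma square_sum_le:
  fixes f :: "'i \<Rightarrow> real"
  shows "(\<Sum>i\<in>I. f i)\<^sup>2 \<le> real (card I) * (\<Sum>i\<in>I. (f i)\<^sup>2)"
proof -
  have "0 \<le> (\<Sum>i\<in>I. \<Sum>j\<in>I. (f i - f j)\<^sup>2)" by (intro sum_nonneg) simp
  also have "\<dots> = (\<Sum>i\<in>I. \<Sum>j\<in>I. (f i)\<^sup>2 + (f j)\<^sup>2 - 2 * (f i * f j))"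
    by (simp add: power2_diff mult.assoc)
  also have "\<dots> = 2 * (real (card I) * (\<Sum>i\<in>I. (f i)\<^sup>2)) - 2 * (\<Sum>i\<in>I. f i)\<^sup>2"
    by (simp add: sum.distrib sum_subtractf sum_distrib_left[symmetric] sum_distrib_right[symmetric]
        power2_eq_square)
  finally show ?thesis by simp
qed

text \<open>\<open>R\<close> is the length of the window below \<open>4 * Q\<close> and also
  controls the saving: errors will be about q^(n - R/2), for which \<open>\<delta>\<close> stays
  below \<open>Q / 2\<close> by \<open>R\<close>. The bound \<open>8 * Q\<close> in \<open>T\<close>
  covers all products \<open>j * rep N\<close> and cofactors that occur.\<close>

locale bilinear_setup = approximation d s x1 x2 for d :: "'a::{field,finite} poly" and s x1 x2 +
  fixes C \<delta> u v :: int and Q R n :: nat and T :: real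
  assumes good: "good_scale C (int Q)" and C: "C \<ge> 0"
    and \<delta>: "\<delta> \<ge> 0" "2 * \<delta> \<le> int Q - 2 * int R" and R: "R \<le> Q"
    and n: "4 * Q \<le> n + R" "n \<le> 4 * Q"
    and uv: "u + v = int n" "\<bar>u - v\<bar> \<le> Cb"
    and Q_large: "int Q \<ge> 2 * Cb + 2"
    and T: "\<And>l. l \<in> A \<Longrightarrow> l \<noteq> 0 \<Longrightarrow> dN l \<le> 8 * Q \<Longrightarrow> real (card (submsets (fac l))) \<le> T"
begin

definition KT :: real where "KT = 3 * KB + of_int (4 * C + 4 * Cb + 3)"

text \<open>The size of a square box containing every \<open>j * rep N\<close> with \<open>N\<close>
  of degree \<open>g\<close>.\<close>

definition Lg :: "nat \<Rightarrow> int" where "Lg g = \<delta> + (int g + Cb) div 2"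

text \<open>A size for which the square box fits into every box occurring in the class of cofactors
  of degree \<open>n - g\<close>; the \<open>- 1\<close> is the margin required by
  \<open>class_sum_zero\<close>.\<close>

definition tg :: "nat \<Rightarrow> int" where "tg g = (int n - int g) div 2 - Cb - 1"

lemma T_ge_1: "T \<ge> 1"
proof -
  have "card (submsets (fac 1)) \<ge> 1"
    by (metis One_nat_def Suc_leI card_gt_0_iff empty_iff finite_submsets submsets_mem subset_mset.order_refl)
  moreover have "real (card (submsets (fac 1))) \<le> T" by (intro T) auto
  ultimately show ?thesis by simp
qed

lemma rep_uv_bounds:
  assumes "set_mset N \<subseteq> PR" "mdeg dN N \<le> n"
  shows "tg (mdeg dN N) \<le> u - dg (rep N) - 1" "tg (mdeg dN N) \<le> v - dg (cj (rep N)) - 1"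
    "real (card (Cc (u - dg (rep N)) (v - dg (cj (rep N))))) \<le> qq (real n - real (mdeg dN N) + KB)"
proof -
  show "tg (mdeg dN N) \<le> u - dg (rep N) - 1" "tg (mdeg dN N) \<le> v - dg (cj (rep N)) - 1"
    using dg_rep_bounds[OF assms(1)] uv unfolding tg_def by linarith+
  have sum: "u - dg (rep N) + (v - dg (cj (rep N))) = int n - int (mdeg dN N)"
    using dg_rep[OF assms(1)] uv by linarith
  have "real (card (Cc (u - dg (rep N)) (v - dg (cj (rep N))))) \<le>
      real (card (Bx (u - dg (rep N)) (v - dg (cj (rep N)))))"
    using Cc_Bx by (simp add: card_mono)
  also have "\<dots> \<le> qq (of_int (u - dg (rep N) + (v - dg (cj (rep N)))) + KB)"
    using sum assms rep(4)[OF assms(1)] uv by (intro card_Bx_le) linarith+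
  also have "\<dots> = qq (real n - real (mdeg dN N) + KB)" unfolding sum by simp
  finally show "real (card (Cc (u - dg (rep N)) (v - dg (cj (rep N))))) \<le> qq (real n - real (mdeg dN N) + KB)" .
qed

lemma mult_rep_in_box:
  assumes "set_mset N \<subseteq> PR" "j \<in> Bx \<delta> \<delta>" "j \<noteq> 0"
  shows "j * rep N \<in> Bx (Lg (mdeg dN N)) (Lg (mdeg dN N)) - {0}"
proof -
  have "rep N \<in> Bx ((int (mdeg dN N) + Cb) div 2) ((int (mdeg dN N) + Cb) div 2)"
    using MM_rep(2)[of "mdeg dN N"] assms(1) by (auto simp: MM_def)
  from Bx_mult[OF assms(2) this] show ?thesis
    using assms rep(2)[OF assms(1)] by (simp add: Lg_def)
qed

lemma dN_box:
  assumes "l \<in> Bx (Lg g) (Lg g) - {0}" "g \<le> 3 * Q" shows "dN l \<le> 8 * Q" "l \<in> A" "l \<noteq> 0"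
proof -
  show l: "l \<in> A" "l \<noteq> 0" using assms Bx_A by auto
  have "dg l \<le> Lg g" "dg (cj l) \<le> Lg g" using assms(1) l by (auto simp: Bx_def dle_iff)
  then have "int (dN l) \<le> 2 * Lg g" using int_dN[OF l] by linarith
  also have "\<dots> \<le> int (8 * Q)" using assms(2) \<delta> Q_large Cb(1) unfolding Lg_def by simp
  finally show "dN l \<le> 8 * Q" by simp
qed

text \<open>If box and closeness both lie beyond the good scale, there is no nonzero element at all;
  this handles small \<open>g\<close>, where even one element would cost q^(n - g). Otherwise at
  least one excess in \<open>card_near_le\<close> is positive.\<close>

lemma near_count:
  assumes g: "g \<le> 3 * Q"
  shows "qq (real n - real g) * real (card ((Bx (Lg g) (Lg g) - {0}) \<inter> near (tg g)))
     \<le> qq (real n - real R + of_int (4 * C + 3 * Cb + 3))"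
proof (cases "Lg g \<le> int Q - C \<and> tg g \<ge> int Q + C")
  case True
  then have "(Bx (Lg g) (Lg g) - {0}) \<inter> near (tg g) \<subseteq> (Bx (int Q - C) (int Q - C) \<inter> near (int Q + C)) - {0}"
    using Bx_mono[of "Lg g" "int Q - C" "Lg g" "int Q - C"] near_mono[of "int Q + C" "tg g"] by blast
  then have "(Bx (Lg g) (Lg g) - {0}) \<inter> near (tg g) = {}" using good unfolding good_scale_def by blast
  then show ?thesis by simp
next
  case False
  let ?X = "2 * nat (Lg g - int Q + C) + 2 * nat (int Q + C - tg g)"
  have "card ((Bx (Lg g) (Lg g) - {0}) \<inter> near (tg g)) \<le> card (Bx (Lg g) (Lg g) \<inter> near (tg g))"
    by (intro card_mono) auto
  also have "\<dots> \<le> q ^ ?X" by (rule card_near_le[OF good])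
  finally have "real (card ((Bx (Lg g) (Lg g) - {0}) \<inter> near (tg g))) \<le> real q ^ ?X"
    by (metis of_nat_le_iff of_nat_power)
  then have "qq (real n - real g) * real (card ((Bx (Lg g) (Lg g) - {0}) \<inter> near (tg g))) \<le>
      qq (real n - real g) * qq (real ?X)"
    unfolding qq_nat[symmetric] by (intro mult_left_mono) auto
  also have "\<dots> = qq (real n - real g + real ?X)" by (simp only: qq_add)
  also have "\<dots> \<le> qq (real n - real R + of_int (4 * C + 3 * Cb + 3))"
  proof (rule qq_mono)
    define a b where "a = max 0 (Lg g - int Q + C)" and "b = max 0 (int Q + C - tg g)"
    define h h' where "h = (int g + Cb) div 2" and "h' = (int n - int g) div 2"
    have "2 * h \<le> int g + Cb" "int n - int g - 1 \<le> 2 * h'" by (simp_all add: h_def h'_def)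
    moreover have "Lg g = \<delta> + h" "tg g = h' - Cb - 1" by (simp_all add: Lg_def tg_def h_def h'_def)
    moreover have "a = 0 \<or> 2 * a = 2 * Lg g - 2 * int Q + 2 * C" "b = 0 \<or> 2 * b = 2 * int Q + 2 * C - 2 * tg g"
      "a \<ge> 0" "b \<ge> 0" "a > 0 \<or> b > 0"
      using False by (auto simp: a_def b_def max_def)
    moreover have "int g \<le> 3 * int Q" "4 * int Q \<le> int n + int R" "int R \<le> int Q" using g n R by linarith+
    \<comment> \<open>Up to constants the left side is \<open>n + 2 * \<delta> - 2 * Q\<close>,
      \<open>2 * Q\<close> or \<open>2 * \<delta> + g\<close>, according to whether the first, the
      second or both excesses are positive. The last case is the critical one and uses
      \<open>g \<le> 3 * Q\<close>.\<close>
    ultimately have le: "int n - int g + (2 * a + 2 * b) \<le> int n - int R + (4 * C + 3 * Cb + 3)"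
      using \<delta>(2) C Cb(1) by (elim disjE) linarith+
    have "int ?X = 2 * a + 2 * b" by (simp add: a_def b_def)
    then have X: "real ?X = of_int (2 * a + 2 * b)" by (metis of_int_of_nat_eq)
    from le have "real_of_int (int n - int g + (2 * a + 2 * b)) \<le> of_int (int n - int R + (4 * C + 3 * Cb + 3))"
      by (simp only: of_int_le_iff)
    then show "real n - real g + real ?X \<le> real n - real R + of_int (4 * C + 3 * Cb + 3)" unfolding X by simp
  qed
  finally show ?thesis .
qed

text \<open>The sum over cofactors vanishes unless \<open>j * rep N\<close> is in
  \<open>near (tg (mdeg dN N))\<close>, where it is bounded trivially. Pairs \<open>(N, j)\<close>
  are grouped by degree and counted through their product, which costs \<open>T\<close> and a factor
  \<open>3 * Q + 1\<close>.\<close>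

lemma type_I:
  assumes G: "G \<ge> 0" "\<And>N. mdeg dN N \<le> n \<Longrightarrow> \<bar>\<gamma> N\<bar> \<le> G" and supp: "\<And>N. \<gamma> N \<noteq> 0 \<Longrightarrow> mdeg dN N \<le> 3 * Q"
  shows "\<bar>\<Sum>c\<in>Cc u v. (\<Sum>N\<in>submsets (fac c). \<gamma> N) * F \<delta> c\<bar> \<le>
    (3 * real Q + 1) * G * T * qq (real n - real R / 2 + KT)"
proof -
  let ?J = "Bx \<delta> \<delta> - {0}"
  let ?K = "\<lambda>N. Cc (u - dg (rep N)) (v - dg (cj (rep N)))"
  let ?b = "\<lambda>N j. of_bool (j * rep N \<in> near (tg (mdeg dN N))) * qq (real n - real (mdeg dN N) + KB)"
  let ?M = "{N \<in> MM n. mdeg dN N \<le> 3 * Q}"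
  have finM: "finite ?M" by simp
  have inner: "\<bar>\<Sum>k\<in>?K N. dd (ell (j * (rep N * k)))\<bar> \<le> ?b N j" if N: "N \<in> MM n" and j: "j \<in> ?J" for N j
  proof -
    have N': "set_mset N \<subseteq> PR" "mdeg dN N \<le> n" using N by (auto simp: MM_def)
    let ?l = "j * rep N"
    have l: "?l \<in> A" using j Bx_A rep(1)[OF N'(1)] by auto
    have eq: "(\<Sum>k\<in>?K N. dd (ell (j * (rep N * k)))) = (\<Sum>k\<in>?K N. dd (ell (k * ?l)))"
      by (simp add: mult_ac)
    show ?thesis
    proof (cases "?l \<in> near (tg (mdeg dN N))")
      case True
      have "\<bar>\<Sum>k\<in>?K N. dd (ell (k * ?l))\<bar> \<le> (\<Sum>k\<in>?K N. 1)"
        by (intro order_trans[OF sum_abs] sum_mono delta_dev_abs_le)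
      also have "\<dots> \<le> qq (real n - real (mdeg dN N) + KB)" using rep_uv_bounds(3)[OF N'] by simp
      finally show ?thesis using True eq by simp
    next
      case False
      then show ?thesis using class_sum_zero[OF l False rep_uv_bounds(1,2)[OF N']] eq by simp
    qed
  qed
  have "(\<Sum>c\<in>Cc u v. (\<Sum>N\<in>submsets (fac c). \<gamma> N) * F \<delta> c) =
      (\<Sum>c\<in>Cc u v. \<Sum>N\<in>submsets (fac c). \<gamma> N * F \<delta> c)" by (simp add: sum_distrib_right)
  also have "\<dots> = (\<Sum>N\<in>MM n. \<Sum>k\<in>?K N. \<gamma> N * F \<delta> (rep N * k))"
    by (rule sum_divisors_Cc[OF uv(1)])
  also have "\<dots> = (\<Sum>N\<in>?M. \<Sum>k\<in>?K N. \<gamma> N * F \<delta> (rep N * k))"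
  proof (rule sum.mono_neutral_right)
    show "\<forall>N\<in>MM n - ?M. (\<Sum>k\<in>?K N. \<gamma> N * F \<delta> (rep N * k)) = 0"
    proof
      fix N assume "N \<in> MM n - ?M"
      then have "\<gamma> N = 0" using supp[of N] by auto
      then show "(\<Sum>k\<in>?K N. \<gamma> N * F \<delta> (rep N * k)) = 0" by simp
    qed
  qed auto
  also have "\<dots> = (\<Sum>N\<in>?M. \<gamma> N * (\<Sum>j\<in>?J. \<Sum>k\<in>?K N. dd (ell (j * (rep N * k)))))"
    unfolding F_def by (subst sum.swap) (simp add: sum_distrib_left)
  finally have eq: "(\<Sum>c\<in>Cc u v. (\<Sum>N\<in>submsets (fac c). \<gamma> N) * F \<delta> c) =
    (\<Sum>N\<in>?M. \<gamma> N * (\<Sum>j\<in>?J. \<Sum>k\<in>?K N. dd (ell (j * (rep N * k)))))" .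
  have "\<bar>\<Sum>N\<in>?M. \<gamma> N * (\<Sum>j\<in>?J. \<Sum>k\<in>?K N. dd (ell (j * (rep N * k))))\<bar> \<le> (\<Sum>N\<in>?M. G * (\<Sum>j\<in>?J. ?b N j))"
  proof (intro order_trans[OF sum_abs] sum_mono)
    fix N assume N: "N \<in> ?M"
    have "\<bar>\<Sum>j\<in>?J. \<Sum>k\<in>?K N. dd (ell (j * (rep N * k)))\<bar> \<le> (\<Sum>j\<in>?J. ?b N j)"
      by (rule order_trans[OF sum_abs], rule sum_mono, rule inner) (use N in auto)
    moreover have "\<bar>\<gamma> N\<bar> \<le> G" using N G by (auto simp: MM_def)
    ultimately show "\<bar>\<gamma> N * (\<Sum>j\<in>?J. \<Sum>k\<in>?K N. dd (ell (j * (rep N * k))))\<bar> \<le> G * (\<Sum>j\<in>?J. ?b N j)"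
      unfolding abs_mult by (intro mult_mono) (auto simp: G)
  qed
  also have "\<dots> = G * (\<Sum>g\<in>{..3 * Q}. \<Sum>N\<in>{N\<in>?M. mdeg dN N = g}. \<Sum>j\<in>?J. ?b N j)"
  proof -
    have "mdeg dN ` ?M \<subseteq> {..3 * Q}" by auto
    from sum.group[OF finM finite_atMost this, of "\<lambda>N. \<Sum>j\<in>?J. ?b N j"]
    show ?thesis by (simp only: sum_distrib_left[symmetric])
  qed
  also have "\<dots> \<le> G * (\<Sum>g\<in>{..3 * Q}. T * qq (real n - real R / 2 + KT))"
  proof (rule mult_left_mono[OF sum_mono G(1)])
    fix g assume "g \<in> {..3 * Q}"
    then have g: "g \<le> 3 * Q" by simp
    let ?P = "{N\<in>?M. mdeg dN N = g}"
    let ?Z = "{(N, j). N \<in> ?P \<and> j \<in> ?J \<and> j * rep N \<in> near (tg g)}"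
    let ?LL = "(Bx (Lg g) (Lg g) - {0}) \<inter> near (tg g)"
    have finP: "finite ?P" by simp
    have "(\<Sum>N\<in>?P. \<Sum>j\<in>?J. ?b N j) =
        (\<Sum>N\<in>?P. \<Sum>j\<in>{j\<in>?J. j * rep N \<in> near (tg g)}. qq (real n - real g + KB))"
    proof (rule sum.cong[OF refl])
      fix N assume "N \<in> ?P"
      then have "mdeg dN N = g" by simp
      then show "(\<Sum>j\<in>?J. ?b N j) = (\<Sum>j\<in>{j\<in>?J. j * rep N \<in> near (tg g)}. qq (real n - real g + KB))"
        by (intro sum.mono_neutral_cong_right) auto
    qed
    also have "\<dots> = (\<Sum>(N, j)\<in>(SIGMA N:?P. {j\<in>?J. j * rep N \<in> near (tg g)}). qq (real n - real g + KB))"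
      using finP by (intro sum.Sigma) auto
    also have "(SIGMA N:?P. {j\<in>?J. j * rep N \<in> near (tg g)}) = ?Z" by auto
    also have "(\<Sum>(N, j)\<in>?Z. qq (real n - real g + KB)) \<le> (\<Sum>l\<in>?LL. \<Sum>N\<in>submsets (fac l). qq (real n - real g + KB))"
    proof (rule pairs_to_products)
      fix N j assume "(N, j) \<in> ?Z"
      then have *: "set_mset N \<subseteq> PR" "j \<in> Bx \<delta> \<delta>" "j \<noteq> 0" "j * rep N \<in> near (tg g)" "mdeg dN N = g"
        by (auto simp: MM_def)
      then show "set_mset N \<subseteq> PR \<and> j \<in> A \<and> j \<noteq> 0 \<and> j * rep N \<in> ?LL"
        using mult_rep_in_box[OF *(1-3)] Bx_A by auto
    qed auto
    also have "\<dots> \<le> (\<Sum>l\<in>?LL. T * qq (real n - real g + KB))"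
    proof (rule sum_mono)
      fix l assume "l \<in> ?LL"
      then have "real (card (submsets (fac l))) \<le> T" using dN_box[of l g] g by (intro T) auto
      then show "(\<Sum>N\<in>submsets (fac l). qq (real n - real g + KB)) \<le> T * qq (real n - real g + KB)"
        by (simp add: mult_right_mono)
    qed
    also have "\<dots> = T * qq KB * (qq (real n - real g) * real (card ?LL))"
      by (simp add: qq_add)
    also have "\<dots> \<le> T * qq KB * qq (real n - real R + of_int (4 * C + 3 * Cb + 3))"
      using T_ge_1 by (intro mult_left_mono near_count g) auto
    also have "\<dots> = T * qq (KB + (real n - real R + of_int (4 * C + 3 * Cb + 3)))" by (simp only: qq_add mult.assoc)
    also have "\<dots> \<le> T * qq (real n - real R / 2 + KT)"
      using T_ge_1 KB_ge Cb(1) by (intro mult_left_mono qq_mono) (auto simp: KT_def)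
    finally show "(\<Sum>N\<in>?P. \<Sum>j\<in>?J. ?b N j) \<le> T * qq (real n - real R / 2 + KT)" .
  qed
  also have "\<dots> = (3 * real Q + 1) * G * T * qq (real n - real R / 2 + KT)" by simp
  finally show ?thesis unfolding eq .
qed

text \<open>Dispersion: after Cauchy-Schwarz in \<open>l\<close>, positive definiteness of \<open>delta_dev\<close> leaves only the
  pairs \<open>k, k'\<close> whose difference pairs trivially with the whole box of \<open>l\<close>.\<close>
lemma dispersion:
  assumes \<alpha>: "\<And>k. k \<in> K \<Longrightarrow> \<bar>\<alpha> k\<bar> \<le> T" and K: "finite K" "K \<subseteq> Bx M M"
  shows "(\<Sum>l\<in>Bx L L. \<bar>\<Sum>k\<in>K. \<alpha> k * dd (ell (l * k))\<bar>)\<^sup>2 \<le>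
    T\<^sup>2 * (real (card (Bx L L)))\<^sup>2 * real (card K) * real (card (Bx M M \<inter> near L))"
proof -
  let ?B = "Bx L L" and ?N = "Bx M M \<inter> near L"
  have KA: "K \<subseteq> A" using K(2) Bx_A by blast
  have T0: "T \<ge> 0" using T_ge_1 by simp
  have pair: "(\<Sum>l\<in>?B. \<alpha> k * \<alpha> k' * dd (ell (l * k) - ell (l * k'))) \<le>
      T\<^sup>2 * real (card ?B) * of_bool (k - k' \<in> ?N)" if k: "k \<in> K" "k' \<in> K" for k k'
  proof -
    have kA: "k \<in> A" "k' \<in> A" using k KA by auto
    have "(\<Sum>l\<in>?B. dd (ell (l * k) - ell (l * k'))) = (\<Sum>l\<in>?B. dd (ell (l * (k - k'))))"
      using kA Bx_A by (intro sum.cong) (auto simp: right_diff_distrib ell_diff)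
    also have "\<dots> = of_bool (k - k' \<in> near L) * (real (card ?B) * (1 - 1 / real q))"
      using kA by (subst box_sum) (auto simp: near_def)
    also have "k - k' \<in> near L \<longleftrightarrow> k - k' \<in> ?N"
      using k K(2) subgroup_Bx[of M M] unfolding add_subgroup_def by auto
    finally have eq: "(\<Sum>l\<in>?B. \<alpha> k * \<alpha> k' * dd (ell (l * k) - ell (l * k'))) =
        of_bool (k - k' \<in> ?N) * ((\<alpha> k * \<alpha> k') * (real (card ?B) * (1 - 1 / real q)))"
      by (simp only: sum_distrib_left[symmetric]) simp
    have "\<bar>\<alpha> k\<bar> * \<bar>\<alpha> k'\<bar> \<le> T * T" using \<alpha> k T0 by (intro mult_mono) auto
    then have "\<alpha> k * \<alpha> k' \<le> T\<^sup>2" by (simp add: power2_eq_square abs_mult[symmetric])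
    moreover have "real (card ?B) * (1 - 1 / real q) \<le> real (card ?B)" "real (card ?B) * (1 - 1 / real q) \<ge> 0"
    proof -
      have "1 - 1 / real q \<le> 1" "1 - 1 / real q \<ge> 0" using q_ge_3 by (simp_all add: field_simps)
      then show "real (card ?B) * (1 - 1 / real q) \<le> real (card ?B)" "real (card ?B) * (1 - 1 / real q) \<ge> 0"
        by (intro mult_left_le mult_nonneg_nonneg; simp)+
    qed
    ultimately have "(\<alpha> k * \<alpha> k') * (real (card ?B) * (1 - 1 / real q)) \<le> T\<^sup>2 * real (card ?B)"
      by (intro mult_mono) auto
    then show ?thesis unfolding eq by simp
  qed
  have "(\<Sum>l\<in>?B. \<bar>\<Sum>k\<in>K. \<alpha> k * dd (ell (l * k))\<bar>)\<^sup>2 \<le>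
      real (card ?B) * (\<Sum>l\<in>?B. \<bar>\<Sum>k\<in>K. \<alpha> k * dd (ell (l * k))\<bar>\<^sup>2)"
    by (rule square_sum_le)
  also have "(\<Sum>l\<in>?B. \<bar>\<Sum>k\<in>K. \<alpha> k * dd (ell (l * k))\<bar>\<^sup>2) \<le>
      (\<Sum>l\<in>?B. \<Sum>k\<in>K. \<Sum>k'\<in>K. \<alpha> k * \<alpha> k' * dd (ell (l * k) - ell (l * k')))"
    unfolding power2_abs by (intro sum_mono delta_dev_posdef K)
  also have "\<dots> = (\<Sum>k\<in>K. \<Sum>k'\<in>K. \<Sum>l\<in>?B. \<alpha> k * \<alpha> k' * dd (ell (l * k) - ell (l * k')))"
    by (subst sum.swap, rule sum.cong[OF refl], rule sum.swap)
  also have "\<dots> \<le> (\<Sum>k\<in>K. \<Sum>k'\<in>K. T\<^sup>2 * real (card ?B) * of_bool (k - k' \<in> ?N))"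
    by (intro sum_mono pair)
  also have "\<dots> \<le> (\<Sum>k\<in>K. T\<^sup>2 * real (card ?B) * real (card ?N))"
  proof (rule sum_mono)
    fix k assume "k \<in> K"
    have "(\<Sum>k'\<in>K. of_bool (k - k' \<in> ?N) :: real) = real (card {k'\<in>K. k - k' \<in> ?N})"
      using K(1) by (simp add: of_bool_def flip: sum.inter_filter)
    also have "\<dots> \<le> real (card ?N)"
      by (intro of_nat_mono card_inj_on_le[of "\<lambda>k'. k - k'"]) (auto simp: inj_on_def)
    finally have "T\<^sup>2 * real (card ?B) * (\<Sum>k'\<in>K. of_bool (k - k' \<in> ?N)) \<le> T\<^sup>2 * real (card ?B) * real (card ?N)"
      by (intro mult_left_mono) auto
    then show "(\<Sum>k'\<in>K. T\<^sup>2 * real (card ?B) * of_bool (k - k' \<in> ?N)) \<le> T\<^sup>2 * real (card ?B) * real (card ?N)"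
      by (simp only: sum_distrib_left)
  qed
  finally have "(\<Sum>l\<in>?B. \<bar>\<Sum>k\<in>K. \<alpha> k * dd (ell (l * k))\<bar>)\<^sup>2 \<le>
      real (card ?B) * (real (card K) * (T\<^sup>2 * real (card ?B) * real (card ?N)))"
    by (simp add: mult_left_mono)
  then show ?thesis by (simp add: power2_eq_square mult_ac)
qed

text \<open>Dispersion over a full box of \<open>l\<close> for one fixed degree class of
  \<open>k\<close>. The differences of the \<open>k\<close> that survive are counted at the good
  scale.\<close>

lemma type_II_class:
  assumes e: "e1 + e2 = int g" "\<bar>e1 - e2\<bar> \<le> Cb" and g: "Q < g" "g + 2 * Q < n"
    and \<alpha>: "\<And>k. k \<in> Cc (u - e1) (v - e2) \<Longrightarrow> \<bar>\<alpha> k\<bar> \<le> T"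
  shows "(\<Sum>l\<in>Bx (Lg g) (Lg g). \<bar>\<Sum>k\<in>Cc (u - e1) (v - e2). \<alpha> k * dd (ell (l * k))\<bar>) \<le>
     T * qq (real n - real R / 2 + KT)"
proof -
  let ?L = "Lg g"
  \<comment> \<open>Half of the cofactor degree plus the imbalance of both factors; the 1 covers
    rounding.\<close>
  define M where "M = (int n - int g) div 2 + Cb + 1"
  let ?K = "Cc (u - e1) (v - e2)"
  have KM: "?K \<subseteq> Bx M M"
  proof -
    have "u - e1 \<le> M" "v - e2 \<le> M" using e uv unfolding M_def by linarith+
    then show ?thesis using Cc_Bx Bx_mono by blast
  qed
  let ?X = "2 * nat (M - int Q + C) + 2 * nat (int Q + C - ?L)"
  have L0: "?L \<ge> 0" using \<delta> Cb(1) unfolding Lg_def by simp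
  have cL: "real (card (Bx ?L ?L)) \<le> qq (of_int (2 * ?L) + KB)"
    using card_Bx_le[of ?L ?L] L0 Cb(1) by simp
  have cK: "real (card ?K) \<le> qq (real n - real g + KB)"
  proof -
    have "real (card ?K) \<le> real (card (Bx (u - e1) (v - e2)))" using Cc_Bx by (simp add: card_mono)
    also have "\<dots> \<le> qq (of_int (u - e1 + (v - e2)) + KB)"
      using e uv g by (intro card_Bx_le) linarith+
    also have "u - e1 + (v - e2) = int n - int g" using e uv by linarith
    finally show ?thesis by simp
  qed
  have cN: "real (card (Bx M M \<inter> near ?L)) \<le> qq (real ?X)"
    using card_near_le[OF good, of M ?L] unfolding qq_nat[symmetric] by (metis of_nat_le_iff of_nat_power)
  have "(\<Sum>l\<in>Bx ?L ?L. \<bar>\<Sum>k\<in>?K. \<alpha> k * dd (ell (l * k))\<bar>)\<^sup>2 \<le>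
      T\<^sup>2 * (real (card (Bx ?L ?L)))\<^sup>2 * real (card ?K) * real (card (Bx M M \<inter> near ?L))"
    by (rule dispersion[OF \<alpha> finite_Cc KM])
  also have "\<dots> \<le> T\<^sup>2 * (qq (of_int (2 * ?L) + KB))\<^sup>2 * qq (real n - real g + KB) * qq (real ?X)"
    using cL cK cN T_ge_1 by (intro mult_mono power_mono mult_nonneg_nonneg) auto
  also have "\<dots> = T\<^sup>2 * qq ((of_int (2 * ?L) + KB) + (of_int (2 * ?L) + KB) + (real n - real g + KB) + real ?X)"
    by (simp only: qq_add power2_eq_square mult.assoc)
  also have "\<dots> \<le> T\<^sup>2 * qq ((real n - real R / 2 + KT) + (real n - real R / 2 + KT))"
  proof (intro mult_left_mono qq_mono)
    define a b where "a = max 0 (M - int Q + C)" and "b = max 0 (int Q + C - ?L)"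
    define h h' where "h = (int g + Cb) div 2" and "h' = (int n - int g) div 2"
    have "2 * h \<le> int g + Cb" "2 * h' \<le> int n - int g" by (simp_all add: h_def h'_def)
    moreover have "?L = \<delta> + h" "M = h' + Cb + 1" by (simp_all add: Lg_def M_def h_def h'_def)
    moreover have "a = 0 \<or> 2 * a = 2 * M - 2 * int Q + 2 * C" "b = 0 \<or> 2 * b = 2 * int Q + 2 * C - 2 * ?L"
      by (auto simp: a_def b_def max_def)
    moreover have "int Q < int g" "int g + 2 * int Q < int n" using g by linarith+
    \<comment> \<open>Depending on which excesses are positive, the left side is
      \<open>4 * \<delta> + n + g\<close>, \<open>4 * \<delta> + 2 * n - 2 * Q\<close>,
      \<open>2 * \<delta> + n + 2 * Q\<close> or \<open>2 * \<delta> + 2 * n - g\<close> up to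
      constants. The two bounds on \<open>g\<close> and the bound on \<open>\<delta>\<close> handle
      all four.\<close>
    ultimately have le: "4 * ?L + (int n - int g) + (2 * a + 2 * b) \<le> 2 * int n - int R + (4 * Cb + 2 + 4 * C)"
      using \<delta>(2) C Cb(1) by (elim disjE) linarith+
    have "int ?X = 2 * a + 2 * b" by (simp add: a_def b_def)
    then have X: "real ?X = of_int (2 * a + 2 * b)" by (metis of_int_of_nat_eq)
    from le have "real_of_int (4 * ?L + (int n - int g) + (2 * a + 2 * b)) \<le> of_int (2 * int n - int R + (4 * Cb + 2 + 4 * C))"
      by (simp only: of_int_le_iff)
    then show "(of_int (2 * ?L) + KB) + (of_int (2 * ?L) + KB) + (real n - real g + KB) + real ?X \<le>
       (real n - real R / 2 + KT) + (real n - real R / 2 + KT)"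
      unfolding X using KB_ge C Cb(1) by (simp add: KT_def)
  qed simp
  also have "\<dots> = (T * qq (real n - real R / 2 + KT))\<^sup>2"
    by (simp only: qq_add power2_eq_square mult_ac)
  finally show ?thesis by (rule power2_le_imp_le) (use T_ge_1 in simp)
qed

text \<open>The class of the cofactor depends only on the two degrees of \<open>rep b\<close>.
  Fixing these, at the cost of \<open>(2 * Q + 1)\<^sup>2\<close> classes, makes the inner sum a
  function of \<open>l = j * rep b\<close> alone. Then the weights \<open>mangoldt\<close> add up
  over the divisors \<open>b\<close> of \<open>l\<close> to \<open>dN l\<close>, so no divisor bound
  is spent on \<open>b\<close>.\<close>

lemma type_II:
  assumes \<alpha>: "\<And>k. k \<in> A \<Longrightarrow> k \<noteq> 0 \<Longrightarrow> dN k \<le> 8 * Q \<Longrightarrow> \<bar>\<alpha> (fac k)\<bar> \<le> T"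
  shows "\<bar>\<Sum>c\<in>Cc u v. (\<Sum>b\<in>submsets (fac c). if mdeg dN b > Q \<and> mdeg dN (fac c - b) > 2 * Q
       then mangoldt dN b * \<alpha> (fac c - b) else 0) * F \<delta> c\<bar> \<le>
    (2 * real Q + 1)\<^sup>2 * (8 * real Q) * T * qq (real n - real R / 2 + KT)"
proof -
  let ?J = "Bx \<delta> \<delta> - {0}"
  let ?K = "\<lambda>(e1, e2). Cc (u - e1) (v - e2)"
  let ?e = "\<lambda>N. (dg (rep N), dg (cj (rep N)))"
  let ?M = "{b \<in> MM n. Q < mdeg dN b \<and> mdeg dN b + 2 * Q < n}"
  let ?S = "\<lambda>e l. \<Sum>k\<in>?K e. \<alpha> (fac k) * dd (ell (l * k))"
  let ?E = "{0..2 * int Q} \<times> {0..2 * int Q}"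
  let ?f = "\<lambda>b c. (if mdeg dN b > Q \<and> mdeg dN (fac c - b) > 2 * Q
       then mangoldt dN b * \<alpha> (fac c - b) else 0) * F \<delta> c"
  have finM: "finite ?M" by simp
  have E: "?e ` ?M \<subseteq> ?E"
  proof (rule image_subsetI)
    fix b assume "b \<in> ?M"
    then have b: "set_mset b \<subseteq> PR" "Q < mdeg dN b" "mdeg dN b + 2 * Q < n" by (auto simp: MM_def)
    then show "?e b \<in> ?E" using dg_rep_bounds[OF b(1)] n Q_large Cb(1) by auto
  qed
  have inner: "(\<Sum>k\<in>?K (?e b). ?f b (rep b * k)) = (if b \<in> ?M then mangoldt dN b * (\<Sum>j\<in>?J. ?S (?e b) (j * rep b)) else 0)"
    if b: "b \<in> MM n" for b
  proof -
    have b': "set_mset b \<subseteq> PR" "mdeg dN b \<le> n" using b by (auto simp: MM_def)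
    have k: "fac (rep b * k) - b = fac k \<and> mdeg dN (fac k) = n - mdeg dN b" if "k \<in> ?K (?e b)" for k
    proof -
      have kA: "k \<in> A" "k \<noteq> 0" using that Cc_A Cc_nz by auto
      have "int (dN k) = u - dg (rep b) + (v - dg (cj (rep b)))" using that Cc_dN by auto
      then have "dN k = n - mdeg dN b" using dg_rep[OF b'(1)] uv by linarith
      then show ?thesis using kA rep[OF b'(1)] by (simp add: fac_mult mdeg_fac)
    qed
    have cond: "(mdeg dN b > Q \<and> n - mdeg dN b > 2 * Q) \<longleftrightarrow> b \<in> ?M" using b b' by auto
    have "(\<Sum>k\<in>?K (?e b). ?f b (rep b * k)) =
      (\<Sum>k\<in>?K (?e b). if b \<in> ?M then mangoldt dN b * (\<alpha> (fac k) * F \<delta> (rep b * k)) else 0)"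
    proof (rule sum.cong[OF refl])
      fix k assume "k \<in> ?K (?e b)"
      from k[OF this] show "?f b (rep b * k) = (if b \<in> ?M then mangoldt dN b * (\<alpha> (fac k) * F \<delta> (rep b * k)) else 0)"
        using cond by simp
    qed
    also have "\<dots> = (if b \<in> ?M then mangoldt dN b * (\<Sum>k\<in>?K (?e b). \<alpha> (fac k) * F \<delta> (rep b * k)) else 0)"
      by (cases "b \<in> ?M") (simp_all only: if_True if_False sum_distrib_left sum.neutral_const)
    also have "(\<Sum>k\<in>?K (?e b). \<alpha> (fac k) * F \<delta> (rep b * k)) = (\<Sum>j\<in>?J. ?S (?e b) (j * rep b))"
      unfolding F_def sum_distrib_left by (subst sum.swap) (simp add: mult.assoc)
    finally show ?thesis .
  qed
  have "(\<Sum>c\<in>Cc u v. (\<Sum>b\<in>submsets (fac c). if mdeg dN b > Q \<and> mdeg dN (fac c - b) > 2 * Q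
       then mangoldt dN b * \<alpha> (fac c - b) else 0) * F \<delta> c) = (\<Sum>c\<in>Cc u v. \<Sum>b\<in>submsets (fac c). ?f b c)"
    by (simp only: sum_distrib_right)
  also have "\<dots> = (\<Sum>b\<in>MM n. \<Sum>k\<in>?K (?e b). ?f b (rep b * k))"
    using sum_divisors_Cc[OF uv(1), of ?f] by simp
  also have "\<dots> = (\<Sum>b\<in>MM n. if b \<in> ?M then mangoldt dN b * (\<Sum>j\<in>?J. ?S (?e b) (j * rep b)) else 0)"
    by (rule sum.cong[OF refl inner])
  also have "\<dots> = (\<Sum>b\<in>?M. mangoldt dN b * (\<Sum>j\<in>?J. ?S (?e b) (j * rep b)))"
    by (intro sum.mono_neutral_cong_right) auto
  finally have eq: "(\<Sum>c\<in>Cc u v. (\<Sum>b\<in>submsets (fac c). if mdeg dN b > Q \<and> mdeg dN (fac c - b) > 2 * Q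
       then mangoldt dN b * \<alpha> (fac c - b) else 0) * F \<delta> c) =
    (\<Sum>b\<in>?M. mangoldt dN b * (\<Sum>j\<in>?J. ?S (?e b) (j * rep b)))" .
  have "\<bar>\<Sum>b\<in>?M. mangoldt dN b * (\<Sum>j\<in>?J. ?S (?e b) (j * rep b))\<bar> \<le>
    (\<Sum>b\<in>?M. \<Sum>j\<in>?J. mangoldt dN b * \<bar>?S (?e b) (j * rep b)\<bar>)"
  proof (intro order_trans[OF sum_abs] sum_mono)
    fix b
    have "\<bar>mangoldt dN b * (\<Sum>j\<in>?J. ?S (?e b) (j * rep b))\<bar> = mangoldt dN b * \<bar>\<Sum>j\<in>?J. ?S (?e b) (j * rep b)\<bar>"
      by (simp add: abs_mult mangoldt_nonneg)
    also have "\<dots> \<le> mangoldt dN b * (\<Sum>j\<in>?J. \<bar>?S (?e b) (j * rep b)\<bar>)"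
      by (intro mult_left_mono sum_abs mangoldt_nonneg)
    finally show "\<bar>mangoldt dN b * (\<Sum>j\<in>?J. ?S (?e b) (j * rep b))\<bar> \<le> (\<Sum>j\<in>?J. mangoldt dN b * \<bar>?S (?e b) (j * rep b)\<bar>)"
      by (simp only: sum_distrib_left)
  qed
  also have "\<dots> = (\<Sum>e\<in>?E. \<Sum>b\<in>{b\<in>?M. ?e b = e}. \<Sum>j\<in>?J. mangoldt dN b * \<bar>?S (?e b) (j * rep b)\<bar>)"
    by (rule sum.group[symmetric, OF finM _ E]) simp
  also have "\<dots> \<le> (\<Sum>e\<in>?E. 8 * real Q * (T * qq (real n - real R / 2 + KT)))"
  proof (rule sum_mono)
    fix e assume "e \<in> ?E"
    let ?P = "{b\<in>?M. ?e b = e}"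
    show "(\<Sum>b\<in>?P. \<Sum>j\<in>?J. mangoldt dN b * \<bar>?S (?e b) (j * rep b)\<bar>) \<le> 8 * real Q * (T * qq (real n - real R / 2 + KT))"
    proof (cases "?P = {}")
      case True
      then show ?thesis unfolding True using T_ge_1 by simp
    next
      case False
      then obtain b0 where b0: "b0 \<in> ?M" "?e b0 = e" by blast
      define g where "g = mdeg dN b0"
      have b0': "set_mset b0 \<subseteq> PR" "Q < g" "g + 2 * Q < n" using b0 by (auto simp: MM_def g_def)
      obtain e1 e2 where e: "e = (e1, e2)" by fastforce
      have e12: "e1 + e2 = int g" "\<bar>e1 - e2\<bar> \<le> Cb"
        using dg_rep[OF b0'(1)] rep(4)[OF b0'(1)] b0(2) e g_def by auto
      have g_eq: "mdeg dN b = g" if "b \<in> ?P" for b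
      proof -
        have "set_mset b \<subseteq> PR" using that by (auto simp: MM_def)
        from dg_rep[OF this] show ?thesis using that e e12 by auto
      qed
      have g3: "g \<le> 3 * Q" using b0' n by linarith
      let ?LL = "Bx (Lg g) (Lg g) - {0}"
      have "(\<Sum>b\<in>?P. \<Sum>j\<in>?J. mangoldt dN b * \<bar>?S (?e b) (j * rep b)\<bar>) =
         (\<Sum>b\<in>?P. \<Sum>j\<in>?J. mangoldt dN b * \<bar>?S e (j * rep b)\<bar>)" by (intro sum.cong) auto
      also have "\<dots> = (\<Sum>(b, j)\<in>?P \<times> ?J. mangoldt dN b * \<bar>?S e (j * rep b)\<bar>)"
        by (rule sum.cartesian_product)
      also have "\<dots> \<le> (\<Sum>l\<in>?LL. \<Sum>b\<in>submsets (fac l). mangoldt dN b * \<bar>?S e l\<bar>)"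
      proof (rule pairs_to_products)
        fix b j assume bj: "(b, j) \<in> ?P \<times> ?J"
        then have *: "set_mset b \<subseteq> PR" "j \<in> Bx \<delta> \<delta>" "j \<noteq> 0" by (auto simp: MM_def)
        show "set_mset b \<subseteq> PR \<and> j \<in> A \<and> j \<noteq> 0 \<and> j * rep b \<in> ?LL"
        proof -
          have "b \<in> ?P" using bj by (rule mem_Sigma_iff[THEN iffD1, THEN conjunct1])
          from g_eq[OF this] mult_rep_in_box[OF *] Bx_A[OF *(2)] show ?thesis using *(1,3) by simp
        qed
      qed (auto simp: mangoldt_nonneg)
      also have "\<dots> \<le> (\<Sum>l\<in>?LL. 8 * real Q * \<bar>?S e l\<bar>)"
      proof (rule sum_mono)
        fix l assume l: "l \<in> ?LL"
        have "(\<Sum>b\<in>submsets (fac l). mangoldt dN b * \<bar>?S e l\<bar>) = real (dN l) * \<bar>?S e l\<bar>"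
          using dN_box(2,3)[OF l g3] by (simp add: sum_distrib_right[symmetric] sum_mangoldt mdeg_fac)
        also have "\<dots> \<le> 8 * real Q * \<bar>?S e l\<bar>" using dN_box(1)[OF l g3] by (intro mult_right_mono) auto
        finally show "(\<Sum>b\<in>submsets (fac l). mangoldt dN b * \<bar>?S e l\<bar>) \<le> 8 * real Q * \<bar>?S e l\<bar>" .
      qed
      also have "\<dots> \<le> (\<Sum>l\<in>Bx (Lg g) (Lg g). 8 * real Q * \<bar>?S e l\<bar>)" by (intro sum_mono2) auto
      also have "\<dots> = 8 * real Q * (\<Sum>l\<in>Bx (Lg g) (Lg g). \<bar>?S e l\<bar>)" by (simp only: sum_distrib_left)
      also have "\<dots> \<le> 8 * real Q * (T * qq (real n - real R / 2 + KT))"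
      proof (intro mult_left_mono)
        have "\<bar>\<alpha> (fac k)\<bar> \<le> T" if "k \<in> Cc (u - e1) (v - e2)" for k
        proof (rule \<alpha>)
          show "k \<in> A" "k \<noteq> 0" using that Cc_A Cc_nz by auto
          show "dN k \<le> 8 * Q" using Cc_dN[OF that] e12 uv n by linarith
        qed
        from type_II_class[OF e12 b0'(2,3) this]
        show "(\<Sum>l\<in>Bx (Lg g) (Lg g). \<bar>?S e l\<bar>) \<le> T * qq (real n - real R / 2 + KT)" unfolding e by simp
      qed simp
      finally show ?thesis .
    qed
  qed
  also have "\<dots> = (2 * real Q + 1)\<^sup>2 * (8 * real Q) * T * qq (real n - real R / 2 + KT)"
  proof -
    have "card ?E = (2 * Q + 1) * (2 * Q + 1)" by (simp add: card_cartesian_product nat_add_distrib nat_mult_distrib)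
    then have "real (card ?E) = real ((2 * Q + 1) * (2 * Q + 1))" by (simp only:)
    also have "\<dots> = (2 * real Q + 1)\<^sup>2" by (simp add: power2_eq_square algebra_simps)
    finally show ?thesis by (simp only: sum_constant mult.assoc)
  qed
  finally show ?thesis unfolding eq .
qed

end

section \<open>Primes in the approximating lattice\<close>

context bilinear_setup
begin

lemma mangoldt_correlation:
  assumes Q1: "Q \<ge> 1"
  shows "\<bar>\<Sum>c\<in>Cc u v. mangoldt dN (fac c) * F \<delta> c\<bar> \<le> 104 * real Q ^ 3 * T * qq (real n - real R / 2 + KT)"
proof -
  \<comment> \<open>With \<open>U = Q\<close> and \<open>V = 2 * Q\<close> the type I degrees end at
    \<open>3 * Q\<close> and the type II factor \<open>b\<close> has degree between \<open>Q\<close>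
    and \<open>n - 2 * Q\<close>, as the two estimates demand.\<close>
  let ?\<gamma> = "vaughan_coeff dN Q (2 * Q) n" and ?\<alpha> = "moebius_trunc dN (2 * Q)"
  let ?E = "qq (real n - real R / 2 + KT)"
  let ?R = "\<lambda>c. \<Sum>b\<in>submsets (fac c). if mdeg dN b > Q \<and> mdeg dN (fac c - b) > 2 * Q
       then mangoldt dN b * ?\<alpha> (fac c - b) else 0"
  have nQ: "n > Q" using n R Q1 by linarith
  have van: "mangoldt dN (fac c) = (\<Sum>N\<in>submsets (fac c). ?\<gamma> N) - ?R c" if "c \<in> Cc u v" for c
  proof (rule vaughan_identity[OF _ nQ])
    have "int (dN c) = int n" using Cc_dN[OF that] uv by simp
    then show "mdeg dN (fac c) = n" using mdeg_fac Cc_A[OF that] Cc_nz[OF that] by simp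
  qed
  have "(\<Sum>c\<in>Cc u v. mangoldt dN (fac c) * F \<delta> c) =
    (\<Sum>c\<in>Cc u v. ((\<Sum>N\<in>submsets (fac c). ?\<gamma> N) - ?R c) * F \<delta> c)"
    by (rule sum.cong[OF refl]) (simp only: van)
  also have "\<dots> = (\<Sum>c\<in>Cc u v. (\<Sum>N\<in>submsets (fac c). ?\<gamma> N) * F \<delta> c) - (\<Sum>c\<in>Cc u v. ?R c * F \<delta> c)"
    by (simp only: left_diff_distrib sum_subtractf)
  finally have eq: "(\<Sum>c\<in>Cc u v. mangoldt dN (fac c) * F \<delta> c) =
    (\<Sum>c\<in>Cc u v. (\<Sum>N\<in>submsets (fac c). ?\<gamma> N) * F \<delta> c) - (\<Sum>c\<in>Cc u v. ?R c * F \<delta> c)" .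
  have I: "\<bar>\<Sum>c\<in>Cc u v. (\<Sum>N\<in>submsets (fac c). ?\<gamma> N) * F \<delta> c\<bar> \<le> (3 * real Q + 1) * (2 * real n) * T * ?E"
    using vaughan_coeff_abs_le[of dN _ n Q "2 * Q"] vaughan_coeff_support[of dN Q "2 * Q" n]
    by (intro type_I) (auto simp: algebra_simps)
  have II: "\<bar>\<Sum>c\<in>Cc u v. ?R c * F \<delta> c\<bar> \<le> (2 * real Q + 1)\<^sup>2 * (8 * real Q) * T * ?E"
    by (rule type_II) (rule order_trans[OF moebius_trunc_abs_le T])
  have Qr: "real Q \<ge> 1" using Q1 by simp
  have nr: "real n \<le> 4 * real Q" using n(2) by linarith
  have TE: "T * ?E \<ge> 0" using T_ge_1 by simp
  have Q2: "real Q \<le> real Q ^ 2" "real Q ^ 2 \<le> real Q ^ 3"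
    using Qr by (auto simp: power2_eq_square power3_eq_cube mult_le_cancel_left1)
  have "(3 * real Q + 1) * (2 * real n) \<le> (4 * real Q) * (8 * real Q)"
    by (rule mult_mono) (use Qr nr in auto)
  also have "\<dots> = 32 * real Q ^ 2" by (simp add: power2_eq_square)
  finally have 1: "(3 * real Q + 1) * (2 * real n) \<le> 32 * real Q ^ 3" using Q2 by linarith
  have "(2 * real Q + 1)\<^sup>2 \<le> (3 * real Q)\<^sup>2" using Qr by (intro power_mono) auto
  then have "(2 * real Q + 1)\<^sup>2 * (8 * real Q) \<le> (3 * real Q)\<^sup>2 * (8 * real Q)" by (intro mult_right_mono) auto
  then have 2: "(2 * real Q + 1)\<^sup>2 * (8 * real Q) \<le> 72 * real Q ^ 3"
    by (simp add: power2_eq_square power3_eq_cube)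
  \<comment> \<open>The constant 104 is 32 from type I plus 72 from type II.\<close>
  have "((3 * real Q + 1) * (2 * real n) + (2 * real Q + 1)\<^sup>2 * (8 * real Q)) * (T * ?E) \<le> (104 * real Q ^ 3) * (T * ?E)"
    by (rule mult_right_mono[OF _ TE]) (use 1 2 in linarith)
  moreover have "\<bar>\<Sum>c\<in>Cc u v. mangoldt dN (fac c) * F \<delta> c\<bar> \<le>
     (3 * real Q + 1) * (2 * real n) * T * ?E + (2 * real Q + 1)\<^sup>2 * (8 * real Q) * T * ?E"
    using I II unfolding eq by linarith
  ultimately show ?thesis by (simp only: distrib_right mult.assoc)
qed

end

context real_quadratic
begin

text \<open>A nonprime \<open>c\<close> with nonzero weight is a unit times \<open>p ^ r\<close>
  with \<open>r \<ge> 2\<close>, so \<open>p\<close> has norm degree at most \<open>n / 2\<close>.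
  Since both \<open>c\<close> and \<open>rep (fac c)\<close> are balanced, the unit between
  \<open>c\<close> and its representative lies in a fixed box.\<close>

lemma prime_powers_few:
  assumes uv: "u + v = int n" "\<bar>u - v\<bar> \<le> Cb"
  shows "(\<Sum>c\<in>{c\<in>Cc u v. \<not> primeA c}. mangoldt dN (fac c)) \<le>
    real n * (real n + 1) * qq (real n / 2 + of_int Cb + KB) * real (card (Bx Cb Cb))"
proof -
  let ?X = "{c\<in>Cc u v. \<not> primeA c \<and> mangoldt dN (fac c) \<noteq> 0}"
  let ?Y = "{..n} \<times> MM (n div 2) \<times> Bx Cb Cb"
  \<comment> \<open>This records the exponent, the prime as a one-element multiset, and the unit
    \<open>c / rep (fac c)\<close>; together they determine \<open>c\<close>.\<close>
  let ?\<phi> = "\<lambda>c. (size (fac c), mset_set (set_mset (fac c)), c / rep (fac c))"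
  have form: "\<exists>p r. fac c = replicate_mset r p \<and> r \<ge> 2 \<and> p \<in> PR \<and> r * dN p = n" if c: "c \<in> ?X" for c
  proof -
    obtain p r where pr: "fac c = replicate_mset r p" "r \<ge> 1" using c by (auto elim: mangoldt_nz_iff)
    have cA: "c \<in> A" "c \<noteq> 0" using c Cc_A[of c u v] Cc_nz[of c u v] by auto
    have "r \<noteq> 1"
    proof
      assume "r = 1"
      then have "fac c = {#p#}" using pr by simp
      then show False using fac_prime[OF cA] c by simp
    qed
    moreover have "p \<in> PR" using fac_PR[OF cA] pr by auto
    moreover have "int (dN c) = int n" using Cc_dN[of c u v] c uv by simp
    then have "r * dN p = n" using mdeg_fac[OF cA] pr by simp
    ultimately show ?thesis using pr by (intro exI[of _ p] exI[of _ r]) auto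
  qed
  have "card ?X \<le> card ?Y"
  proof (rule card_inj_on_le[of ?\<phi>])
    show "inj_on ?\<phi> ?X"
    proof (rule inj_onI)
      fix c c' assume c: "c \<in> ?X" "c' \<in> ?X" "?\<phi> c = ?\<phi> c'"
      obtain p r where pr: "fac c = replicate_mset r p" "r \<ge> 2" using form[OF c(1)] by blast
      obtain p' r' where pr': "fac c' = replicate_mset r' p'" "r' \<ge> 2" using form[OF c(2)] by blast
      have "r = r'" "p = p'" using c(3) pr pr' by auto
      then have fac: "fac c = fac c'" using pr pr' by simp
      have "rep (fac c) \<noteq> 0" by (intro rep(2) fac_PR) (use c(1) Cc_A[of c u v] Cc_nz[of c u v] in auto)
      then show "c = c'" using c(3) unfolding fac by simp
    qed
    show "?\<phi> ` ?X \<subseteq> ?Y"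
    proof (rule image_subsetI)
      fix c assume c: "c \<in> ?X"
      then have cA: "c \<in> A" "c \<noteq> 0" using Cc_A[of c u v] Cc_nz[of c u v] by auto
      obtain p r where pr: "fac c = replicate_mset r p" "r \<ge> 2" "p \<in> PR" "r * dN p = n" using form[OF c] by blast
      have "r * 1 \<le> r * dN p" using PR_dN[OF pr(3)] by (intro mult_le_mono2)
      then have "r \<le> n" using pr by simp
      moreover have "2 * dN p \<le> n" using pr(2,4) by (metis mult_le_mono1)
      then have "{#p#} \<in> MM (n div 2)" using pr(3) by (auto simp: MM_def)
      moreover have "c / rep (fac c) \<in> Bx Cb Cb"
      proof -
        note facPR = fac_PR[OF cA]
        obtain w where w: "unitA w" "c = rep (fac c) * w"
          using fac_eq_assoc[of "rep (fac c)" c] rep[OF facPR] cA by (auto simp: assocA_def)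
        then have eq: "c / rep (fac c) = w" using rep(2)[OF facPR] by (metis nonzero_mult_div_cancel_left)
        have wA: "w \<in> A" "w \<noteq> 0" using w(1) by (auto simp: unitA_def)
        have "dg c = dg (rep (fac c)) + dg w"
          by (subst (1) w(2)) (simp add: dg_mult rep[OF facPR] wA)
        moreover have "dg c = u" "mdeg dN (fac c) = n"
          using c Cc_dN[of c u v] uv mdeg_fac[OF cA] by (auto simp: Cc_def)
        ultimately have "\<bar>dg w\<bar> \<le> Cb" using dg_rep_bounds[OF facPR] uv by linarith
        then show ?thesis unfolding eq using wA dg_unit[OF w(1)] by (simp add: Bx_def dle_iff abs_le_iff)
      qed
      ultimately show "?\<phi> c \<in> ?Y" using pr by simp
    qed
  qed simp
  then have "real (card ?X) \<le> real (card ?Y)" by (rule of_nat_mono)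
  also have "\<dots> = (real n + 1) * (real (card (MM (n div 2))) * real (card (Bx Cb Cb)))"
    by (simp add: card_cartesian_product algebra_simps)
  also have "\<dots> \<le> (real n + 1) * (qq (real n / 2 + of_int Cb + KB) * real (card (Bx Cb Cb)))"
  proof (intro mult_left_mono mult_right_mono)
    have "real (card (MM (n div 2))) \<le> qq (real (n div 2) + of_int Cb + KB)" by (rule card_MM_le)
    also have "\<dots> \<le> qq (real n / 2 + of_int Cb + KB)"
      using of_nat_div_le_of_nat[of n 2] by (intro qq_mono) simp
    finally show "real (card (MM (n div 2))) \<le> qq (real n / 2 + of_int Cb + KB)" .
  qed auto
  finally have card: "real (card ?X) \<le> (real n + 1) * (qq (real n / 2 + of_int Cb + KB) * real (card (Bx Cb Cb)))" .
  have "(\<Sum>c\<in>{c\<in>Cc u v. \<not> primeA c}. mangoldt dN (fac c)) = (\<Sum>c\<in>?X. mangoldt dN (fac c))"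
    by (intro sum.mono_neutral_right) auto
  also have "\<dots> \<le> (\<Sum>c\<in>?X. real n)"
  proof (rule sum_mono)
    fix c assume c: "c \<in> ?X"
    then have "mdeg dN (fac c) = n" using Cc_dN[of c u v] uv mdeg_fac by (auto simp: Cc_def)
    then show "mangoldt dN (fac c) \<le> real n" using mangoldt_le[of dN "fac c"] by simp
  qed
  also have "\<dots> = real n * real (card ?X)" by simp
  also have "\<dots> \<le> real n * ((real n + 1) * (qq (real n / 2 + of_int Cb + KB) * real (card (Bx Cb Cb))))"
    using card by (intro mult_left_mono) auto
  finally show ?thesis by (simp add: mult.assoc)
qed

end

context bilinear_setup
begin

text \<open>If no prime of the class is near, only prime powers can make \<open>F\<close> positive,
  and by the last assumption they compensate at most half of the total weight. With
  \<open>1 - 1 / q \<ge> 2 / 3\<close> the correlation is then at most minus a third of that weight;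
  hence \<open>312 = 3 * 104\<close>.\<close>

lemma prime_near_exists:
  assumes Q1: "Q \<ge> 1"
    and main: "(\<Sum>c\<in>Cc u v. mangoldt dN (fac c)) > 312 * real Q ^ 3 * T * qq (real n - real R / 2 + KT)"
    and pp: "(\<Sum>c\<in>Cc u v. mangoldt dN (fac c)) \<ge> 2 * real (card (Bx \<delta> \<delta>)) *
       (real n * (real n + 1) * qq (real n / 2 + of_int Cb + KB) * real (card (Bx Cb Cb)))"
  shows "\<exists>c\<in>Cc u v. primeA c \<and> c \<in> near \<delta>"
proof (rule ccontr)
  assume no: "\<not> ?thesis"
  let ?\<Lambda> = "\<lambda>c. mangoldt dN (fac c)"
  define \<Psi> where "\<Psi> = (\<Sum>c\<in>Cc u v. ?\<Lambda> c)"
  define P where "P = real n * (real n + 1) * qq (real n / 2 + of_int Cb + KB) * real (card (Bx Cb Cb))"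
  define \<kappa> where "\<kappa> = real (card (Bx \<delta> \<delta>))"
  have \<Psi>0: "\<Psi> \<ge> 0" unfolding \<Psi>_def by (intro sum_nonneg mangoldt_nonneg)
  have \<kappa>0: "\<kappa> \<ge> 0" by (simp add: \<kappa>_def)
  have q23: "1 - 1 / real q \<ge> 2 / 3" using q_ge_3 by (simp add: field_simps)
  have "(\<Sum>c\<in>Cc u v. ?\<Lambda> c * of_bool (c \<in> near \<delta>)) \<le> (\<Sum>c\<in>Cc u v. if primeA c then 0 else ?\<Lambda> c)"
    using no by (intro sum_mono) (auto simp: mangoldt_nonneg)
  also have "\<dots> = (\<Sum>c\<in>{c\<in>Cc u v. \<not> primeA c}. ?\<Lambda> c)"
    by (intro sum.mono_neutral_cong_right) auto
  also have "\<dots> \<le> P" unfolding P_def by (rule prime_powers_few[OF uv])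
  finally have near_le: "(\<Sum>c\<in>Cc u v. ?\<Lambda> c * of_bool (c \<in> near \<delta>)) \<le> P" .
  have "(\<Sum>c\<in>Cc u v. ?\<Lambda> c * F \<delta> c) =
      (\<Sum>c\<in>Cc u v. (1 - 1 / real q) * (\<kappa> * (?\<Lambda> c * of_bool (c \<in> near \<delta>)) - ?\<Lambda> c))"
    by (intro sum.cong) (auto simp: F_eq Cc_A \<kappa>_def algebra_simps)
  also have "\<dots> = (1 - 1 / real q) * (\<kappa> * (\<Sum>c\<in>Cc u v. ?\<Lambda> c * of_bool (c \<in> near \<delta>)) - \<Psi>)"
    by (simp only: sum_distrib_left[symmetric] sum_subtractf \<Psi>_def)
  also have "\<dots> \<le> (1 - 1 / real q) * (- (\<Psi> / 2))"
  proof (rule mult_left_mono)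
    have "\<kappa> * (\<Sum>c\<in>Cc u v. ?\<Lambda> c * of_bool (c \<in> near \<delta>)) \<le> \<kappa> * P"
      using near_le \<kappa>0 by (rule mult_left_mono)
    moreover have "2 * \<kappa> * P \<le> \<Psi>" using pp by (simp add: \<kappa>_def P_def \<Psi>_def)
    ultimately show "\<kappa> * (\<Sum>c\<in>Cc u v. ?\<Lambda> c * of_bool (c \<in> near \<delta>)) - \<Psi> \<le> - (\<Psi> / 2)" by simp
  qed (use q23 in simp)
  also have "\<dots> \<le> - (\<Psi> / 3)"
  proof -
    have "2 / 3 * (\<Psi> / 2) \<le> (1 - 1 / real q) * (\<Psi> / 2)" using q23 \<Psi>0 by (intro mult_right_mono) auto
    then show ?thesis by simp
  qed
  finally have "\<Psi> / 3 \<le> \<bar>\<Sum>c\<in>Cc u v. ?\<Lambda> c * F \<delta> c\<bar>" by linarith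
  also have "\<dots> \<le> 104 * real Q ^ 3 * T * qq (real n - real R / 2 + KT)" by (rule mangoldt_correlation[OF Q1])
  finally show False using main by (simp add: \<Psi>_def)
qed

end

section \<open>Choice of parameters and conclusion\<close>

lemma power4_less_exp:
  fixes K :: real
  shows "\<exists>w0. \<forall>w\<ge>w0. K * real w ^ 4 < 3 ^ w"
proof -
  \<comment> \<open>The fourth root reduces the claim to \<open>n / ?x ^ n\<close> tending to
    0.\<close>
  let ?x = "root 4 (3 :: real)"
  have x: "?x > 1" "?x ^ 4 = 3" by simp_all
  have "(\<lambda>n. real n / ?x ^ n) \<longlonglongrightarrow> 0" using lim_n_over_pown[of ?x] x by simp
  then have "(\<lambda>n. (real n / ?x ^ n) ^ 4) \<longlonglongrightarrow> 0 ^ 4" by (rule tendsto_power)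
  then have lim: "(\<lambda>n. \<bar>K\<bar> * (real n / ?x ^ n) ^ 4) \<longlonglongrightarrow> \<bar>K\<bar> * 0 ^ 4" by (rule tendsto_mult[OF tendsto_const])
  then have "eventually (\<lambda>n. \<bar>K\<bar> * (real n / ?x ^ n) ^ 4 < 1) sequentially"
    by (rule order_tendstoD) simp
  then obtain w0 where w0: "\<And>n. n \<ge> w0 \<Longrightarrow> \<bar>K\<bar> * (real n / ?x ^ n) ^ 4 < 1"
    unfolding eventually_sequentially by blast
  have "K * real w ^ 4 < 3 ^ w" if "w \<ge> w0" for w
  proof -
    have "(?x ^ w) ^ 4 = 3 ^ w" using x(2) by (metis power_mult mult.commute)
    then have "\<bar>K\<bar> * (real w ^ 4 / 3 ^ w) < 1" using w0[OF that] by (simp add: power_divide)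
    then have "\<bar>K\<bar> * real w ^ 4 < 3 ^ w" by (simp add: field_simps)
    moreover have "K * real w ^ 4 \<le> \<bar>K\<bar> * real w ^ 4" by (intro mult_right_mono) auto
    ultimately show ?thesis by linarith
  qed
  then show ?thesis by blast
qed

context approximation
begin

lemma prime_approximations:
  assumes eps: "\<epsilon> > 0"
  shows "\<exists>\<pi> p. primeA \<pi> \<and> p \<in> A \<and> dN \<pi> \<ge> N0 \<and>
    (x1 - p / \<pi> = 0 \<or> of_int (dg (x1 - p / \<pi>)) \<le> real (dN \<pi>) * (- 5 / 8 + \<epsilon>)) \<and>
    (x2 - cj p / cj \<pi> = 0 \<or> of_int (dg (x2 - cj p / cj \<pi>)) \<le> real (dN \<pi>) * (- 5 / 8 + \<epsilon>))"
proof -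
  obtain C where C: "C \<ge> 1" "\<forall>Q0. \<exists>Q\<ge>Q0. good_scale C Q" using good_scales by blast
  \<comment> \<open>\<open>w\<close> will be about \<open>Q / a\<close>. The bound
    \<open>16 / \<epsilon>\<close> makes the total loss \<open>16 * w\<close> at most
    \<open>\<epsilon> * n\<close>, and 40 leaves room for all comparisons of \<open>w\<close> with
    \<open>Q\<close>.\<close>
  obtain a :: nat where a: "a \<ge> 40" "16 / \<epsilon> \<le> real a"
  proof -
    obtain a0 where "16 / \<epsilon> \<le> real a0" using real_arch_simple by blast
    then show ?thesis using that[of "max 40 a0"] by simp
  qed
  \<comment> \<open>Chosen so that the divisor bound \<open>B ^ (8 * Q)\<close> is q^(Q/(2a)), which
    is at most q^w because \<open>Q < 2 * a * w\<close>.\<close>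
  define B where "B = qq (1 / (16 * real a))"
  have "B > qq 0" unfolding B_def qq_def using q_ge_3 a by (intro powr_less_mono) auto
  then have B: "B > 1" by simp
  have finPR: "finite {p\<in>PR. dN p \<le> k}" for k
  proof (rule finite_imageD)
    show "finite ((\<lambda>p. {#p#}) ` {p\<in>PR. dN p \<le> k})"
      by (rule finite_subset[OF _ finite_MM[of k]]) (auto simp: MM_def)
  qed (simp add: inj_on_def)
  obtain C0 where C0: "C0 \<ge> 1" "\<And>M. set_mset M \<subseteq> PR \<Longrightarrow> real (card (submsets M)) \<le> C0 * B ^ mdeg dN M"
    using card_submsets_bound[OF B finPR PR_dN] by blast
  define \<beta> where "\<beta> = 2 * of_int Cb + (1::real)"
  have \<beta>: "\<beta> \<ge> 1" using Cb(1) by (simp add: \<beta>_def)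
  \<comment> \<open>The value of \<open>KT\<close>, needed before the locale that defines it can be
    interpreted.\<close>
  define KT' where "KT' = 3 * KB + of_int (4 * C + 4 * Cb + 3)"
  define Bc where "Bc = real (card (Bx Cb Cb))"
  \<comment> \<open>Here \<open>1248 = 312 * 4\<close>, with 4 from the lower bound for
    \<open>psi\<close>. In \<open>K2\<close>, 160 is \<open>2 * 20 * 4\<close>, with 20 from
    \<open>n * (n + 1) \<le> 20 * Q ^ 2\<close>.\<close>
  define K1 where "K1 = 1248 * C0 * \<beta> * qq (KT' + KB + of_int D)"
  define K2 where "K2 = 160 * \<beta> * Bc * qq (3 * KB + of_int Cb + of_int D)"
  define K where "K = (40 + K1 + K2) * (2 * real a) ^ 4"
  have Bc: "Bc \<ge> 0" by (simp add: Bc_def)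
  have K12: "K1 \<ge> 0" "K2 \<ge> 0" unfolding K1_def K2_def using C0 \<beta> Bc by auto
  obtain w0 where w0: "\<And>w. w \<ge> w0 \<Longrightarrow> K * real w ^ 4 < 3 ^ w" using power4_less_exp by blast
  \<comment> \<open>A lower bound for \<open>w\<close>, ensured through
    \<open>Q \<ge> a * m\<close>; the good scale is chosen first and \<open>w\<close> is derived
    from it.\<close>
  define m where "m = Suc (max w0 (max N0 (nat (2 * Cb + 4 * D + 20))))"
  obtain Qi where Qi: "Qi \<ge> int (a * m)" "good_scale C Qi" using C(2) by blast
  define Q where "Q = nat Qi"
  have QQ: "int Q = Qi" using Qi(1) of_nat_0_le_iff[of "a * m"] unfolding Q_def by linarith
  have Q: "Q \<ge> a * m" "good_scale C (int Q)"
    using Qi unfolding QQ[symmetric] by (simp_all only: of_nat_le_iff)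
  define w where "w = Q div a"
  have a0: "a > 0" using a by simp
  have wm: "w \<ge> m" unfolding w_def using Q(1) a0 by (metis div_le_mono nonzero_mult_div_cancel_left not_gr0)
  have w: "w \<ge> w0" "w \<ge> N0" "int w \<ge> 2 * Cb + 4 * D + 20" "w \<ge> 1"
    using wm unfolding m_def by linarith+
  have aw: "a * w \<le> Q" by (simp add: w_def)
  have "Q < a * w + a" unfolding w_def using a0 by (metis mod_less_divisor mult_div_mod_eq nat_add_left_cancel_less)
  also have "a * w + a \<le> 2 * a * w" using w(4) by (cases w) auto
  finally have Qaw: "Q < 2 * a * w" .
  have Q40: "40 * w \<le> Q" using aw a(1) by (metis le_trans mult_le_mono1)
  have Q1: "Q \<ge> 1" using Q40 w(4) by linarith
  \<comment> \<open>The saving q^(R/2) is q^(4w), which pays q^w for \<open>T\<close> and q^w for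
    the powers of \<open>Q\<close>. The length also exceeds the error \<open>4 * w\<close> plus
    constants in \<open>psi_large\<close>.\<close>
  define R where "R = 8 * w"
  \<comment> \<open>The largest integer allowed by
    \<open>2 * \<delta> \<le> int Q - 2 * int R\<close>.\<close>
  define \<delta> where "\<delta> = (int Q - 16 * int w) div 2"
  have Qreal: "real Q \<le> 2 * real a * real w"
  proof -
    have "real Q \<le> real (2 * a * w)" using Qaw by (simp only: of_nat_le_iff less_imp_le)
    then show ?thesis by simp
  qed
  have Q4: "(40 + K1 + K2) * real Q ^ 4 < qq (real w)"
  proof -
    have "real Q ^ 4 \<le> (2 * real a * real w) ^ 4" using Qreal by (intro power_mono) auto
    then have "(40 + K1 + K2) * real Q ^ 4 \<le> (40 + K1 + K2) * (2 * real a * real w) ^ 4"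
      using K12 by (intro mult_left_mono) auto
    also have "\<dots> = K * real w ^ 4" by (simp add: K_def power_mult_distrib)
    also have "\<dots> < 3 ^ w" by (rule w0[OF w(1)])
    also have "\<dots> \<le> real q ^ w" using q_ge_3 by (intro power_mono) auto
    finally show ?thesis by (simp add: qq_nat)
  qed
  have Qr: "real Q \<ge> 1" using Q1 by simp
  have Qp: "real Q \<le> real Q ^ 4" "real Q ^ 3 \<le> real Q ^ 4"
    using Qr power_increasing[of 1 4 "real Q"] power_increasing[of 3 4 "real Q"] by auto
  have KQ: "K1 * real Q ^ 4 < qq (real w)" "K2 * real Q ^ 4 < qq (real w)" "40 * real Q < qq (real w)"
  proof -
    have "K1 * real Q ^ 4 \<ge> 0" "K2 * real Q ^ 4 \<ge> 0" using K12 by auto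
    moreover have "(40 + K1 + K2) * real Q ^ 4 = 40 * real Q ^ 4 + K1 * real Q ^ 4 + K2 * real Q ^ 4"
      by (simp add: algebra_simps)
    ultimately show "K1 * real Q ^ 4 < qq (real w)" "K2 * real Q ^ 4 < qq (real w)" "40 * real Q < qq (real w)"
      using Q4 Qp(1) Qr by linarith+
  qed
  have "\<exists>n. 4 * Q - R < n \<and> n \<le> 4 * Q \<and> psi n \<ge> qq (real n - KB - of_int D) / (4 * real Q)"
  proof (rule psi_large[where w = w])
    show "int R \<ge> 4 * int w + Cb + 4 * D + 10" using w(3) Cb(1) D_ge_1 by (simp add: R_def)
    show "R \<le> 4 * Q" using Q40 by (simp add: R_def)
    show "real q ^ w \<ge> 40 * real Q" using KQ(3) by (simp add: qq_nat)
    show "int Q \<ge> int w + Cb + 2 * D + 10" using Q40 w(3) Cb(1) D_ge_1 by linarith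
  qed (rule Q1)
  then obtain n where n: "4 * Q - R < n" "n \<le> 4 * Q" "psi n \<ge> qq (real n - KB - of_int D) / (4 * real Q)" by blast
  have "qq (real n - KB - of_int D) / (4 * real Q) > 0" using Qr by simp
  from class_large[OF n(3) this] obtain u v where uv: "u + v = int n" "\<bar>u - v\<bar> \<le> Cb"
    and \<Psi>: "(\<Sum>c\<in>Cc u v. mangoldt dN (fac c)) \<ge> qq (real n - KB - of_int D) / (4 * real Q) / \<beta>"
    unfolding \<beta>_def by blast
  define T where "T = C0 * qq (real w)"
  interpret bilinear_setup d s x1 x2 C \<delta> u v Q R n T
  proof unfold_locales
    show "good_scale C (int Q)" by (rule Q(2))
    show "C \<ge> 0" using C(1) by simp
    show "\<delta> \<ge> 0" using Q40 by (simp add: \<delta>_def)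
    show "2 * \<delta> \<le> int Q - 2 * int R" by (simp add: \<delta>_def R_def)
    show "R \<le> Q" using Q40 by (simp add: R_def)
    show "4 * Q \<le> n + R" using n by linarith
    show "n \<le> 4 * Q" by (rule n(2))
    show "u + v = int n" "\<bar>u - v\<bar> \<le> Cb" by (rule uv)+
    show "int Q \<ge> 2 * Cb + 2" using Q40 w(3) D_ge_1 by linarith
    fix l assume l: "l \<in> A" "l \<noteq> 0" "dN l \<le> 8 * Q"
    have "real (card (submsets (fac l))) \<le> C0 * B ^ mdeg dN (fac l)" by (rule C0(2)[OF fac_PR[OF l(1,2)]])
    also have "\<dots> \<le> C0 * B ^ (8 * Q)"
      using C0(1) B l by (intro mult_left_mono power_increasing) (auto simp: mdeg_fac)
    also have "B ^ (8 * Q) = qq (real Q / (2 * real a))"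
      unfolding B_def using q_ge_3 by (simp add: qq_def powr_realpow[symmetric] powr_powr)
    also have "\<dots> \<le> qq (real w)" using Qreal a0 by (intro qq_mono) (simp add: field_simps)
    finally show "real (card (submsets (fac l))) \<le> T" using C0(1) by (simp add: T_def)
  qed
  have \<beta>0: "\<beta> > 0" using \<beta> by simp
  have "\<exists>c\<in>Cc u v. primeA c \<and> c \<in> near \<delta>"
  proof (rule prime_near_exists[OF Q1])
    let ?Z = "qq (real n - KB - of_int D)"
    have "312 * real Q ^ 3 * T * qq (real n - real R / 2 + KT) * (4 * real Q * \<beta>) = 
       1248 * C0 * \<beta> * real Q ^ 4 * (qq (real w) * qq (real n - real R / 2 + KT))"
      by (simp add: T_def power_numeral_reduce)
    also have "qq (real w) * qq (real n - real R / 2 + KT) = qq (KT' + KB + of_int D) * (qq (- 3 * real w) * ?Z)"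
      unfolding qq_add[symmetric] by (rule arg_cong[of _ _ qq]) (simp add: KT_def KT'_def R_def)
    also have "1248 * C0 * \<beta> * real Q ^ 4 * (qq (KT' + KB + of_int D) * (qq (- 3 * real w) * ?Z)) =
        K1 * real Q ^ 4 * (qq (- 3 * real w) * ?Z)" by (simp add: K1_def)
    also have "\<dots> < qq (real w) * (qq (- 3 * real w) * ?Z)" using KQ(1) by (intro mult_strict_right_mono) auto
    also have "\<dots> = qq (real w + (- 3 * real w) + (real n - KB - of_int D))" by (simp only: qq_add mult.assoc)
    also have "\<dots> \<le> ?Z" by (intro qq_mono) simp
    finally have "312 * real Q ^ 3 * T * qq (real n - real R / 2 + KT) < ?Z / (4 * real Q * \<beta>)"
      using Qr \<beta>0 by (subst pos_less_divide_eq) auto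
    then show "(\<Sum>c\<in>Cc u v. mangoldt dN (fac c)) > 312 * real Q ^ 3 * T * qq (real n - real R / 2 + KT)"
      using \<Psi> by simp
    \<comment> \<open>The box contributes at most about q^Q and the prime powers about q^(n/2); with
      \<open>n\<close> close to \<open>4 * Q\<close> their product stays well below q^n.\<close>
    have \<kappa>: "real (card (Bx \<delta> \<delta>)) \<le> qq (real Q + KB)"
    proof -
      have "2 * \<delta> \<le> int Q" using w(4) by (simp add: \<delta>_def)
      then have "real_of_int (\<delta> + \<delta>) \<le> real Q" by linarith
      moreover have "real (card (Bx \<delta> \<delta>)) \<le> qq (of_int (\<delta> + \<delta>) + KB)"
        using Q40 Cb(1) by (intro card_Bx_le) (auto simp: \<delta>_def)
      ultimately show ?thesis using qq_mono[of "of_int (\<delta> + \<delta>) + KB" "real Q + KB"] by simp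
    qed
    have nr: "real n \<le> 4 * real Q" "real n \<ge> 4 * real Q - 8 * real w" "real Q \<ge> 40 * real w"
      using n Q40 by (simp_all add: R_def)
    have nn: "real n * (real n + 1) \<le> 20 * real Q ^ 2"
    proof -
      have "real n * (real n + 1) \<le> (4 * real Q) * (5 * real Q)" using nr(1) Qr by (intro mult_mono) auto
      then show ?thesis by (simp add: power2_eq_square)
    qed
    have "2 * real (card (Bx \<delta> \<delta>)) * (real n * (real n + 1) * qq (real n / 2 + of_int Cb + KB) * real (card (Bx Cb Cb)))
        \<le> 2 * qq (real Q + KB) * (20 * real Q ^ 2 * qq (real n / 2 + of_int Cb + KB) * Bc)"
    proof (rule mult_mono)
      show "real n * (real n + 1) * qq (real n / 2 + of_int Cb + KB) * real (card (Bx Cb Cb)) \<le>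
          20 * real Q ^ 2 * qq (real n / 2 + of_int Cb + KB) * Bc"
        unfolding Bc_def by (rule mult_right_mono[OF mult_right_mono[OF nn]]) simp_all
    qed (use \<kappa> in simp_all)
    then have "2 * real (card (Bx \<delta> \<delta>)) * (real n * (real n + 1) * qq (real n / 2 + of_int Cb + KB) * real (card (Bx Cb Cb)))
        * (4 * real Q * \<beta>) \<le> 2 * qq (real Q + KB) * (20 * real Q ^ 2 * qq (real n / 2 + of_int Cb + KB) * Bc) * (4 * real Q * \<beta>)"
      using Qr \<beta>0 by (intro mult_right_mono) auto
    also have "\<dots> = 160 * \<beta> * Bc * real Q ^ 3 * (qq (real Q + KB) * qq (real n / 2 + of_int Cb + KB))"
      by (simp add: power2_eq_square power3_eq_cube)
    also have "qq (real Q + KB) * qq (real n / 2 + of_int Cb + KB) =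
        qq (3 * KB + of_int Cb + of_int D) * (qq (real Q - real n / 2) * ?Z)"
      unfolding qq_add[symmetric] by (rule arg_cong[of _ _ qq]) (simp add: field_simps)
    also have "160 * \<beta> * Bc * real Q ^ 3 * (qq (3 * KB + of_int Cb + of_int D) * (qq (real Q - real n / 2) * ?Z)) =
        K2 * real Q ^ 3 * (qq (real Q - real n / 2) * ?Z)" by (simp add: K2_def)
    also have "\<dots> \<le> qq (real w) * (qq (real Q - real n / 2) * ?Z)"
    proof (rule mult_right_mono)
      have "K2 * real Q ^ 3 \<le> K2 * real Q ^ 4" using K12 Qp by (intro mult_left_mono) auto
      then show "K2 * real Q ^ 3 \<le> qq (real w)" using KQ(2) by linarith
    qed simp
    also have "\<dots> = qq (real w + (real Q - real n / 2) + (real n - KB - of_int D))" by (simp only: qq_add mult.assoc)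
    also have "\<dots> \<le> ?Z" using nr by (intro qq_mono) linarith
    finally have "2 * real (card (Bx \<delta> \<delta>)) * (real n * (real n + 1) * qq (real n / 2 + of_int Cb + KB) * real (card (Bx Cb Cb)))
        \<le> ?Z / (4 * real Q * \<beta>)"
      using Qr \<beta>0 by (subst pos_le_divide_eq) auto
    then show "(\<Sum>c\<in>Cc u v. mangoldt dN (fac c)) \<ge> 2 * real (card (Bx \<delta> \<delta>)) *
       (real n * (real n + 1) * qq (real n / 2 + of_int Cb + KB) * real (card (Bx Cb Cb)))"
      using \<Psi> by simp
  qed
  then obtain \<pi> where \<pi>: "\<pi> \<in> Cc u v" "primeA \<pi>" "\<pi> \<in> near \<delta>" by blast
  have dN\<pi>: "dN \<pi> = n" using Cc_dN[OF \<pi>(1)] uv by simp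
  have "\<delta> \<ge> D - 1" using Q40 w(3) Cb(1) D_ge_1 unfolding \<delta>_def by linarith
  from near_approx[OF \<pi>(3) this] obtain p where p: "p \<in> A" "dle (D - 2 - \<delta>) (\<pi> * x1 - p)"
    "dle (D - 2 - \<delta>) (cj \<pi> * x2 - cj p)" by blast
  have \<pi>A: "\<pi> \<in> A" "\<pi> \<noteq> 0" "dg \<pi> = u" "dg (cj \<pi>) = v" "cj \<pi> \<noteq> 0"
    using \<pi>(1) by (auto simp: Cc_def)
  \<comment> \<open>Here \<open>\<delta> + t\<close> is about \<open>Q / 2 + n / 2\<close>, and
    \<open>n \<le> 4 * Q\<close> makes this \<open>5 / 8 * n\<close> up to an error of
    \<open>8 * w\<close> plus constants, which is below
    \<open>16 * w \<le> \<epsilon> * n\<close>.\<close>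
  have bound: "of_int (D - 2 - \<delta> - t) \<le> real n * (- 5 / 8 + \<epsilon>)" if t: "2 * t \<ge> int n - Cb" for t :: int
  proof -
    have "2 * \<delta> \<ge> int Q - 16 * int w - 1" unfolding \<delta>_def by linarith
    then have "real_of_int (2 * \<delta>) \<ge> of_int (int Q - 16 * int w - 1)" by (simp only: of_int_le_iff)
    moreover have "real_of_int (2 * t) \<ge> of_int (int n - Cb)" using t by (simp only: of_int_le_iff)
    moreover have "real_of_int (int w) \<ge> of_int (2 * Cb + 4 * D + 20)" using w(3) by (simp only: of_int_le_iff)
    moreover have "\<epsilon> * real n \<ge> 16 * real w"
    proof -
      have "16 \<le> \<epsilon> * real a" using a(2) eps by (simp add: field_simps)
      then have "16 * real w \<le> \<epsilon> * real a * real w" by (intro mult_right_mono) auto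
      also have "\<dots> = \<epsilon> * (real a * real w)" by simp
      also have "\<dots> \<le> \<epsilon> * real n"
      proof (intro mult_left_mono)
        have "a * w \<le> n" using aw n(1) Q40 unfolding R_def by linarith
        then show "real a * real w \<le> real n" by (simp flip: of_nat_mult)
      qed (use eps in simp)
      finally show ?thesis .
    qed
    moreover have "real n \<le> 4 * real Q" "real_of_int Cb \<ge> 0" "real_of_int D \<ge> 1"
      using n(2) Cb(1) D_ge_1 by linarith+
    ultimately show ?thesis by (simp add: algebra_simps)
  qed
  have "x1 - p / \<pi> = (\<pi> * x1 - p) / \<pi>" using \<pi>A by (simp add: field_simps)
  then have 1: "x1 - p / \<pi> = 0 \<or> dg (x1 - p / \<pi>) \<le> D - 2 - \<delta> - u"
    using p(2) \<pi>A by (cases "\<pi> * x1 - p = 0") (simp_all add: dle_iff dg_divide)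
  have "x2 - cj p / cj \<pi> = (cj \<pi> * x2 - cj p) / cj \<pi>" using \<pi>A by (simp add: field_simps)
  then have 2: "x2 - cj p / cj \<pi> = 0 \<or> dg (x2 - cj p / cj \<pi>) \<le> D - 2 - \<delta> - v"
    using p(3) \<pi>A by (cases "cj \<pi> * x2 - cj p = 0") (simp_all add: dle_iff dg_divide)
  have "2 * u \<ge> int n - Cb" "2 * v \<ge> int n - Cb" using uv by linarith+
  note b = bound[OF this(1)] bound[OF this(2)]
  have "N0 \<le> n" using w(2) n(1) Q40 unfolding R_def by linarith
  moreover have "x1 - p / \<pi> = 0 \<or> of_int (dg (x1 - p / \<pi>)) \<le> real n * (- 5 / 8 + \<epsilon>)"
    using 1 b(1) by (meson of_int_le_iff order_trans)
  moreover have "x2 - cj p / cj \<pi> = 0 \<or> of_int (dg (x2 - cj p / cj \<pi>)) \<le> real n * (- 5 / 8 + \<epsilon>)"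
    using 2 b(2) by (meson of_int_le_iff order_trans)
  ultimately show ?thesis using \<pi>(2) p(1) dN\<pi> by blast
qed

end

unbundle no fps_syntax

theorem mainTheorem1:
  fixes d :: "'a::{field,finite} poly" and s :: "'a fls" and x1 x2 :: "'a fls" and \<epsilon> :: real
  assumes "odd (card (UNIV :: 'a set))" and "card (UNIV :: 'a set) > 2 ^ 12"
    and "lead_coeff d = 1" and "squarefree d" and "even (Polynomial.degree d)"
    and "s * s = kinf_of_poly d"
    and "factorial_domain (ringA d)"
    and "(x1, x2) \<notin> sigmaK s"
    and "\<epsilon> > 0"
  shows "infinite {(sigma1 s p / sigma1 s \<pi>, sigma2 s p / sigma2 s \<pi>) | p \<pi>.
            ring_prime\<^bsub>ringA d\<^esub> \<pi> \<and>
            kinf_abs (x1 - sigma1 s p / sigma1 s \<pi>) \<le>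
              normA s \<pi> powr (- 1/2 - 1/8 + log (real (card (UNIV :: 'a set))) (sqrt 2) + \<epsilon>) \<and>
            kinf_abs (x2 - sigma2 s p / sigma2 s \<pi>) \<le>
              normA s \<pi> powr (- 1/2 - 1/8 + log (real (card (UNIV :: 'a set))) (sqrt 2) + \<epsilon>)}"
    (is "infinite ?S")
proof
  assume fin: "finite ?S"
  interpret approximation d s x1 x2
    by (intro approximation.intro real_quadratic.intro approximation_axioms.intro assms)
  have abs_eq: "kinf_abs y = (if y = 0 then 0 else qq (of_int (dg y)))" for y :: "'a fls"
    by (simp add: kinf_abs_def qq_def q_def dg_def)
  have abs_pos: "y \<noteq> 0 \<Longrightarrow> kinf_abs y > 0" and abs_nonneg: "kinf_abs y \<ge> 0" for y :: "'a fls"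
    by (simp_all add: abs_eq)
  have log0: "log (real q) (sqrt 2) \<ge> 0" using q_ge_3 by (intro zero_le_log_cancel_iff[THEN iffD2]) auto
  \<comment> \<open>Besides \<open>e \<le> \<epsilon>\<close>, the bound \<open>1 / 8\<close> keeps
    the exponent at most \<open>- 1 / 2\<close>, so the errors tend to 0 with growing norm.\<close>
  define e where "e = min \<epsilon> (1 / 8)"
  have e: "e > 0" "e \<le> \<epsilon>" "e \<le> 1 / 8" using assms(9) by (auto simp: e_def)
  let ?r = "\<lambda>(y1, y2). max (kinf_abs (x1 - y1)) (kinf_abs (x2 - y2))"
  \<comment> \<open>The smallest error in the supposedly finite set, positive because no element of
    K matches both coordinates. Inserting 1 keeps the minimum meaningful if the set is
    empty.\<close>
  define r where "r = Min (insert 1 (?r ` ?S))"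
  have r_pos: "r > 0"
  proof -
    have "?r y > 0" if "y \<in> ?S" for y
    proof -
      from that obtain p \<pi> where y: "y = (sigma1 s p / sigma1 s \<pi>, sigma2 s p / sigma2 s \<pi>)"
        and \<pi>: "ring_prime\<^bsub>ringA d\<^esub> \<pi>" by blast
      have "sigma1 s \<pi> \<noteq> 0" using \<pi> sigma1_eq_iff[of \<pi> "\<zero>\<^bsub>ringA d\<^esub>"]
        by (auto simp: ring_prime_def sigma1_zero)
      then have "x1 \<noteq> sigma1 s p / sigma1 s \<pi> \<or> x2 \<noteq> sigma2 s p / sigma2 s \<pi>"
        using not_both_rational[of "sigma1 s \<pi>" "sigma1 s p"] by auto
      then show ?thesis unfolding y using abs_pos by (auto simp: less_max_iff_disj)
    qed
    then show ?thesis unfolding r_def using fin by (subst Min_gr_iff) auto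
  qed
  \<comment> \<open>From this norm degree on, the error q^(-N0/2) is smaller than \<open>r\<close>,
    so the new fraction cannot belong to the set.\<close>
  obtain N0 :: nat where N0: "- log (real q) r < real N0 / 2" 
    using reals_Archimedean2[of "- 2 * log (real q) r"] by (auto simp: field_simps)
  obtain \<pi>' p' where \<pi>': "primeA \<pi>'" "p' \<in> A" "dN \<pi>' \<ge> N0"
    and b1: "x1 - p' / \<pi>' = 0 \<or> of_int (dg (x1 - p' / \<pi>')) \<le> real (dN \<pi>') * (- 5 / 8 + e)"
    and b2: "x2 - cj p' / cj \<pi>' = 0 \<or> of_int (dg (x2 - cj p' / cj \<pi>')) \<le> real (dN \<pi>') * (- 5 / 8 + e)"
    using prime_approximations[OF e(1), of N0] by blast
  obtain \<pi> where \<pi>: "\<pi>' = sigma1 s \<pi>" using \<pi>'(1) by (auto simp: primeA_def A_def)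
  obtain p where p: "p' = sigma1 s p" using \<pi>'(2) by (auto simp: A_def)
  let ?n = "real (dN \<pi>')"
  have nz: "\<pi>' \<in> A" "\<pi>' \<noteq> 0" using \<pi>'(1) by (auto simp: primeA_def)
  have norm: "normA s \<pi> = qq ?n"
  proof -
    have "normA s \<pi> = kinf_abs (\<pi>' * cj \<pi>')" by (simp add: normA_def \<pi>)
    also have "\<dots> = qq (of_int (dg \<pi>' + dg (cj \<pi>')))" using nz by (simp add: abs_eq dg_mult)
    also have "dg \<pi>' + dg (cj \<pi>') = int (dN \<pi>')" using int_dN[OF nz] by simp
    finally show ?thesis by simp
  qed
  have le1: "kinf_abs (x1 - p' / \<pi>') \<le> qq (?n * (- 5 / 8 + e))"
    using b1 by (auto simp: abs_eq intro!: qq_mono)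
  have le2: "kinf_abs (x2 - cj p' / cj \<pi>') \<le> qq (?n * (- 5 / 8 + e))"
    using b2 by (auto simp: abs_eq intro!: qq_mono)
  have "qq (?n * (- 5 / 8 + e)) \<le> qq (?n * (- 1/2 - 1/8 + log (real q) (sqrt 2) + \<epsilon>))"
    using e(2) log0 by (intro qq_mono mult_left_mono) auto
  also have "\<dots> = normA s \<pi> powr (- 1/2 - 1/8 + log (real q) (sqrt 2) + \<epsilon>)"
    unfolding norm by (simp add: qq_def powr_powr)
  finally have le: "qq (?n * (- 5 / 8 + e)) \<le> normA s \<pi> powr (- 1/2 - 1/8 + log (real q) (sqrt 2) + \<epsilon>)" .
  have "kinf_abs (x1 - sigma1 s p / sigma1 s \<pi>) \<le>
      normA s \<pi> powr (- 1/2 - 1/8 + log (real (card (UNIV :: 'a set))) (sqrt 2) + \<epsilon>)"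
    using order_trans[OF le1 le] unfolding \<pi> p q_def .
  moreover have "kinf_abs (x2 - sigma2 s p / sigma2 s \<pi>) \<le>
      normA s \<pi> powr (- 1/2 - 1/8 + log (real (card (UNIV :: 'a set))) (sqrt 2) + \<epsilon>)"
    using order_trans[OF le2 le] unfolding \<pi> p q_def cj_sigma1 .
  moreover have "ring_prime\<^bsub>ringA d\<^esub> \<pi>" using \<pi>'(1) unfolding \<pi> by (rule primeA_ring_prime)
  ultimately have "(sigma1 s p / sigma1 s \<pi>, sigma2 s p / sigma2 s \<pi>) \<in> ?S" by blast
  then have "?r (sigma1 s p / sigma1 s \<pi>, sigma2 s p / sigma2 s \<pi>) \<in> insert 1 (?r ` ?S)"
    by (intro insertI2 imageI)
  then have "?r (sigma1 s p / sigma1 s \<pi>, sigma2 s p / sigma2 s \<pi>) \<ge> r"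
    unfolding r_def by (rule Min_le[OF finite.insertI[OF finite_imageI[OF fin]]])
  then have "r \<le> qq (?n * (- 5 / 8 + e))" using le1 le2 unfolding \<pi> p by auto
  also have "\<dots> \<le> qq (- real N0 / 2)"
  proof (rule qq_mono)
    have "?n * (- 5 / 8 + e) \<le> ?n * (- 1 / 2)" using e(3) by (intro mult_left_mono) auto
    also have "\<dots> \<le> - real N0 / 2" using \<pi>'(3) by simp
    finally show "?n * (- 5 / 8 + e) \<le> - real N0 / 2" .
  qed
  also have "\<dots> < r"
  proof -
    have "qq (- real N0 / 2) < qq (log (real q) r)"
      unfolding qq_def using N0 q_ge_3 by (intro powr_less_mono) auto
    also have "qq (log (real q) r) = r" unfolding qq_def using r_pos q_ge_3 by (simp add: powr_log_cancel)
    finally show ?thesis .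
  qed
  finally show False by simp
qed

end
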